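(* Let $n\ge 2$, $d=n-1$, and let $M\subset\mathbb{R}^n$ be a $d$-submanifold of class $C^2$ (with $\mathcal{H}^d(M)<\infty$), with mean curvature vector $H:M\to\mathbb{R}^n$. Let $V=\mathcal{H}^d_{|M}\otimes\delta_{T_xM}$ be the $d$-varifold associated with $M$. Then for every $x_0\in M$ and for each of the choices $$\Pi\in\left\{\Pi_S,\ -2\Pi_{S^\perp},\ 2\,\mathrm{Id},\ \Pi_{(T_{x_0}M)^\perp}\circ\Pi_S,\ -2\,\Pi_{(T_{x_0}M)^\perp}\circ\Pi_{S^\perp},\ 2\,\Pi_{(T_{x_0}M)^\perp}\right\}$$ one has $$H_\varepsilon^{\Pi}(x_0,V)\xrightarrow[\varepsilon\to0]{}H(x_0).$$ If moreover $M$ is at least of class $C^3$, then $\left|H_\varepsilon^{\Pi}(x_0,V)-H(x_0)\right|=O(\varepsilon)$ as $\varepsilon\to0$.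
   Context: Notation. $G_{d,n}$ is the Grassmannian of $d$-dimensional linear subspaces of $\mathbb{R}^n$; for a linear subspace $P$, $\Pi_P$ is the orthogonal projector onto $P$. A $d$-varifold in $\mathbb{R}^n$ is a (nonnegative) Radon measure on $\mathbb{R}^n\times G_{d,n}$; its mass is the Radon measure $\|V\|(A)=V(A\times G_{d,n})$. $\mathcal{H}^d$ is the $d$-dimensional Hausdorff measure. The varifold associated with a $d$-submanifold $M$ is $V=\mathcal{H}^d_{|M}\otimes\delta_{T_xM}$, i.e. $\int\varphi\,dV=\int_M\varphi(x,T_xM)\,d\mathcal{H}^d(x)$ for continuous compactly supported $\varphi$ on $\mathbb{R}^n\times G_{d,n}$. Submanifolds are embedded and without boundary. The mean curvature vector $H$ is the trace (not the average) of the vector-valued second fundamental form: if near $x_0=0$ the manifold is the graph over $\mathbb{R}^{n-1}\times\{0\}$ of $u$ with $u(0)=0$, $\nabla u(0)=0$, then $H(0)=\operatorname{trace}(D^2u(0))\,e_n$. Kernels. $\rho,\xi\in C^\infty(\mathbb{R})$ are fixed nonnegative even functions, compactly supported in $[-1,1]$, positive on $(0,1)$, with $\rho$ nonincreasing on $[0,1]$, and satisfying $n\,\xi(s)=-s\,\rho'(s)$ for all $s\in(-1,1)$. Approximate mean curvature. For a $d$-varifold $V$, $x_0\in\mathbb{R}^n$, $\varepsilon>0$, and a linear operator $\Pi:\mathbb{R}^n\to\mathbb{R}^n$ which may depend on $x_0$, $x$ and $S\in G_{d,n}$, $$H_\varepsilon^{\Pi}(x_0,V)=-\frac{d}{n\varepsilon}\,\frac{\displaystyle\int_{\mathbb{R}^n\times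 G_{d,n}}\rho'\!\left(\frac{|x-x_0|}{\varepsilon}\right)\frac{\Pi(x-x_0)}{|x-x_0|}\,dV(x,S)}{\displaystyle\int_{\mathbb{R}^n}\xi\!\left(\frac{|x-x_0|}{\varepsilon}\right)d\|V\|(x)},$$ where the first integrand is taken to be $0$ at $x=x_0$ (recall $\rho'(0)=0$). *)

theory Defs
  imports "HOL-Analysis.Analysis" "HOL-Library.Landau_Symbols"
begin

subsection \<open>Maps of class C^k and submanifolds\<close>

text \<open>Intended for open \<open>U\<close>: all iterated directional derivatives up to order \<open>k\<close> exist
  (in the Frechet sense) and are continuous on \<open>U\<close>.\<close>

primrec Ck_on :: "nat \<Rightarrow> ('a::real_normed_vector \<Rightarrow> 'b::real_normed_vector) \<Rightarrow> 'a set \<Rightarrow> bool" where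
  "Ck_on 0 f U \<longleftrightarrow> continuous_on U f"
| "Ck_on (Suc k) f U \<longleftrightarrow>
     (\<forall>x\<in>U. f differentiable (at x)) \<and> (\<forall>v. Ck_on k (\<lambda>x. frechet_derivative f (at x) v) U)"

definition Ck_diffeo ::
  "nat \<Rightarrow> 'a::real_normed_vector set \<Rightarrow> 'b::real_normed_vector set \<Rightarrow> ('a \<Rightarrow> 'b) \<Rightarrow> ('b \<Rightarrow> 'a) \<Rightarrow> bool" where
  "Ck_diffeo k U W \<phi> \<psi> \<longleftrightarrow>
     open U \<and> open W \<and> homeomorphism U W \<phi> \<psi> \<and> Ck_on k \<phi> U \<and> Ck_on k \<psi> W"

text \<open>Embedded \<open>d\<close>-dimensional submanifolds without boundary (not necessarily closed):
  near each of its points, \<open>M\<close> is flattened onto a \<open>d\<close>-plane by an ambient diffeomorphism.\<close>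

definition submanifold :: "nat \<Rightarrow> nat \<Rightarrow> (real^'n) set \<Rightarrow> bool" where
  "submanifold k d M \<longleftrightarrow>
     (\<forall>x\<in>M. \<exists>U (W :: (real^'n) set) L \<phi> \<psi>.
        x \<in> U \<and> subspace L \<and> dim L = d \<and> Ck_diffeo k U W \<phi> \<psi> \<and> \<phi> ` (M \<inter> U) = W \<inter> L)"

definition tangent_space :: "(real^'n) set \<Rightarrow> real^'n \<Rightarrow> (real^'n) set" where
  "tangent_space M x =
     {v. \<exists>\<gamma> \<delta>. \<delta> > 0 \<and> \<gamma> C1_differentiable_on {-\<delta><..<\<delta>} \<and> \<gamma> ` {-\<delta><..<\<delta>} \<subseteq> M \<and>
           \<gamma> 0 = x \<and> (\<gamma> has_vector_derivative v) (at 0)}"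


subsection \<open>Orthogonal projectors and mean curvature\<close>

definition oproj :: "(real^'n) set \<Rightarrow> real^'n \<Rightarrow> real^'n" where
  "oproj S v = (THE p. p \<in> S \<and> v - p \<in> S\<^sup>\<bottom>)"

text \<open>The vector-valued second fundamental form: the normal component at \<open>x\<close> of the derivative
  in direction \<open>v\<close> of a vector field \<open>Y\<close> with \<open>Y x = w\<close> that is tangent along \<open>M\<close> near \<open>x\<close>.
  For \<open>M\<close> of class \<open>C^2\<close> and \<open>v\<close>, \<open>w\<close> tangent at \<open>x\<close>, it does not depend on \<open>Y\<close>.\<close>

definition second_fundamental_form ::
  "(real^'n) set \<Rightarrow> real^'n \<Rightarrow> real^'n \<Rightarrow> real^'n \<Rightarrow> real^'n" where
  "second_fundamental_form M x v w =
     (THE z. \<exists>Y Y'. (Y has_derivative Y') (at x) \<and> Y x = w \<and>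
        (\<forall>\<^sub>F y in at x within M. Y y \<in> tangent_space M y) \<and>
        z = oproj ((tangent_space M x)\<^sup>\<bottom>) (Y' v))"

definition orthonormal_basis :: "(real^'n) set \<Rightarrow> (real^'n) set \<Rightarrow> bool" where
  "orthonormal_basis T B \<longleftrightarrow> pairwise orthogonal B \<and> (\<forall>b\<in>B. norm b = 1) \<and> span B = T"

text \<open>Trace over a subspace of a vector-valued bilinear form (independent of the chosen basis).\<close>

definition trace_on :: "(real^'n) set \<Rightarrow> (real^'n \<Rightarrow> real^'n \<Rightarrow> real^'n) \<Rightarrow> real^'n" where
  "trace_on T b = (\<Sum>e\<in>(SOME B. orthonormal_basis T B). b e e)"

definition mean_curvature :: "(real^'n) set \<Rightarrow> real^'n \<Rightarrow> real^'n" where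
  "mean_curvature M x = trace_on (tangent_space M x) (second_fundamental_form M x)"


subsection \<open>Hausdorff measure\<close>

text \<open>The normalised size \<open>\<omega>\<^sub>d (diam C / 2)^d\<close>, with the usual convention that the empty set
  has size zero also for \<open>d = 0\<close>. The library's \<open>diameter\<close> is only meaningful on bounded sets,
  hence the boundedness requirement in the coverings below.\<close>

definition hausdorff_size :: "nat \<Rightarrow> 'a::metric_space set \<Rightarrow> ennreal" where
  "hausdorff_size d C =
     (if C = {} then 0 else ennreal (unit_ball_vol (real d) * (diameter C / 2) ^ d))"

definition hausdorff_pre :: "nat \<Rightarrow> real \<Rightarrow> 'a::metric_space set \<Rightarrow> ennreal" where
  "hausdorff_pre d \<delta> A =
     (INF C \<in> {C :: nat \<Rightarrow> 'a set. A \<subseteq> (\<Union>i. C i) \<and> (\<forall>i. bounded (C i) \<and> diameter (C i) \<le> \<delta>)}.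
        (\<Sum>i. hausdorff_size d (C i)))"

definition hausdorff_outer :: "nat \<Rightarrow> 'a::metric_space set \<Rightarrow> ennreal" where
  "hausdorff_outer d A = (SUP \<delta>\<in>{0<..}. hausdorff_pre d \<delta> A)"

definition hausdorff_measure :: "nat \<Rightarrow> 'a::metric_space measure" where
  "hausdorff_measure d = measure_of UNIV (sets borel) (hausdorff_outer d)"


subsection \<open>Varifolds\<close>

definition grassmannian :: "nat \<Rightarrow> (real^'n) set set" where
  "grassmannian d = {S. subspace S \<and> dim S = d}"

text \<open>The Grassmannian carries the topology induced by identifying a subspace with its
  orthogonal projector; this is the corresponding Borel space.\<close>

definition grassmannian_borel :: "nat \<Rightarrow> (real^'n) set measure" where
  "grassmannian_borel d = vimage_algebra (grassmannian d) (\<lambda>S. matrix (oproj S)) borel"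

text \<open>A varifold is rendered as a measure on \<open>borel \<Otimes>\<^sub>M grassmannian_borel d\<close>. The one associated
  with \<open>M\<close> is the image of \<open>d\<close>-dimensional Hausdorff measure on \<open>M\<close> under \<open>x \<mapsto> (x, T\<^sub>x M)\<close>.\<close>

definition submanifold_varifold ::
  "nat \<Rightarrow> (real^'n) set \<Rightarrow> ((real^'n) \<times> (real^'n) set) measure" where
  "submanifold_varifold d M =
     distr (restrict_space (hausdorff_measure d) M) (borel \<Otimes>\<^sub>M grassmannian_borel d)
       (\<lambda>x. (x, tangent_space M x))"

definition mass :: "((real^'n) \<times> (real^'n) set) measure \<Rightarrow> (real^'n) measure" where
  "mass V = distr V borel fst"

text \<open>The operator \<open>P x S\<close> depends on \<open>x\<close> and \<open>S\<close>; its dependence on \<open>x0\<close> is obtained by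
  choosing \<open>P\<close> after \<open>x0\<close>.\<close>

definition approx_mean_curvature ::
  "(real \<Rightarrow> real) \<Rightarrow> (real \<Rightarrow> real) \<Rightarrow> nat \<Rightarrow> real \<Rightarrow>
   (real^'n \<Rightarrow> (real^'n) set \<Rightarrow> real^'n \<Rightarrow> real^'n) \<Rightarrow>
   real^'n \<Rightarrow> ((real^'n) \<times> (real^'n) set) measure \<Rightarrow> real^'n" where
  "approx_mean_curvature \<rho> \<xi> d \<epsilon> P x0 V =
     - (real d / (real CARD('n) * \<epsilon>)) *\<^sub>R
       ((\<integral>(x, S). (if x = x0 then 0
                   else (deriv \<rho> (norm (x - x0) / \<epsilon>) / norm (x - x0)) *\<^sub>R P x S (x - x0)) \<partial>V)
        /\<^sub>R (\<integral>x. \<xi> (norm (x - x0) / \<epsilon>) \<partial>mass V))"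

definition projection_choices ::
  "(real^'n) set \<Rightarrow> real^'n \<Rightarrow> (real^'n \<Rightarrow> (real^'n) set \<Rightarrow> real^'n \<Rightarrow> real^'n) set" where
  "projection_choices M x0 =
     (let N = oproj ((tangent_space M x0)\<^sup>\<bottom>) in
      {\<lambda>x S v. oproj S v,
       \<lambda>x S v. - 2 *\<^sub>R oproj (S\<^sup>\<bottom>) v,
       \<lambda>x S v. 2 *\<^sub>R v,
       \<lambda>x S v. N (oproj S v),
       \<lambda>x S v. - 2 *\<^sub>R N (oproj (S\<^sup>\<bottom>) v),
       \<lambda>x S v. 2 *\<^sub>R N v})"

end

theory Submission
  imports Defs
begin

text \<open>Near \<open>x0\<close> the submanifold is a level set \<open>g = 0\<close> with gradient \<open>G\<close>, normalised so that
  \<open>N = G x0\<close> is a unit vector, and \<open>T\<^sub>x M\<close> is the orthogonal complement of \<open>G x\<close>. With \<open>Q\<close> the derivative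
  of \<open>G\<close> at \<open>x0\<close> and \<open>y\<close> the projection of \<open>x - x0\<close> onto the tangent plane, Taylor expansion gives, for
  each of the six projectors,
  \<open>\<Pi>(x - x0) = a y - (Q y \<bullet> y) N + o(\<epsilon>\<^sup>2)\<close> at distance at most \<open>2\<epsilon>\<close> with some constant \<open>a\<close>
  (and \<open>O(\<epsilon>\<^sup>3)\<close> in the \<open>C\<^sup>3\<close> case), while \<open>H(x0) = - tr(Q) N\<close>.
  On this scale the projection onto the tangent plane is bi-Lipschitz with constant \<open>1 + O(\<epsilon>\<^sup>2)\<close>, so it
  distorts Hausdorff measure by a factor \<open>1 + O(\<epsilon>\<^sup>2)\<close> only, and both integrals may be computed on the
  tangent plane. There the term \<open>a y\<close> vanishes by oddness, reflections reduce the quadratic term to its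
  trace, and the relation between the kernels cancels the remaining radial integral against the
  denominator. Neither the area formula nor the value of the normalising constant of Hausdorff measure
  is needed: the ratio only uses invariance under isometries, scaling, and that disks have positive
  finite measure; finiteness comes from that of \<open>M\<close>.\<close>

subsection \<open>Hausdorff measure\<close>

text \<open>The factor \<open>1 / \<epsilon>\<close> in front of the quotient sets the accuracy. The
  tangential term \<open>a y\<close>, multiplied by the kernel and divided by the distance, is
  merely bounded, so a relative error of order \<open>\<epsilon>\<close> in the measure would
  already change the limit. The distortion of the projection is of order \<open>\<epsilon>^2\<close>
  because heights are \<open>O(\<epsilon>)\<close> times distances and Pythagoras squares them. The
  six projectors share one normal term for the following reason. Put \<open>h = x - x0\<close>.
  Taylor expansion of \<open>g\<close> on \<open>M\<close> gives
  \<open>N \<bullet> h = - (Q h \<bullet> h) / 2\<close> to leading order, while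
  \<open>G x \<bullet> h\<close> exceeds \<open>N \<bullet> h\<close> by
  \<open>Q h \<bullet> h\<close>, hence equals \<open>+ (Q h \<bullet> h) / 2\<close>. Twice the
  identity and minus twice the normal projector at \<open>x\<close> therefore have the same normal
  part, the tangential projector is their average, and composing with the normal projector at
  \<open>x0\<close> only deletes the tangential term. The two regularity classes differ only in the
  remainder of \<open>G\<close>: \<open>o(\<epsilon>)\<close> for class 2,
  \<open>O(\<epsilon>^2)\<close> for class 3.\<close>

lemma hausdorff_size_empty [simp]: "hausdorff_size d {} = 0"
  by (simp add: hausdorff_size_def)

lemma hausdorff_pre_le:
  assumes "A \<subseteq> (\<Union>i. C i)" "\<And>i. bounded (C i)" "\<And>i. diameter (C i) \<le> \<delta>"
  shows "hausdorff_pre d \<delta> A \<le> (\<Sum>i. hausdorff_size d (C i))"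
  unfolding hausdorff_pre_def using assms by (intro INF_lower) auto

lemma hausdorff_pre_greatest:
  assumes "\<And>C. A \<subseteq> (\<Union>i. C i) \<Longrightarrow> (\<And>i. bounded (C i)) \<Longrightarrow> (\<And>i. diameter (C i) \<le> \<delta>) \<Longrightarrow>
             b \<le> (\<Sum>i. hausdorff_size d (C i))"
  shows "b \<le> hausdorff_pre d \<delta> A"
  unfolding hausdorff_pre_def using assms by (intro INF_greatest) auto

lemma hausdorff_pre_mono: "A \<subseteq> B \<Longrightarrow> hausdorff_pre d \<delta> A \<le> hausdorff_pre d \<delta> B"
  unfolding hausdorff_pre_def by (intro INF_superset_mono) auto

lemma hausdorff_pre_antimono: "\<delta> \<le> \<delta>' \<Longrightarrow> hausdorff_pre d \<delta>' A \<le> hausdorff_pre d \<delta> A"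
  unfolding hausdorff_pre_def by (intro INF_superset_mono) (auto intro: order_trans)

lemma hausdorff_outer_mono: "A \<subseteq> B \<Longrightarrow> hausdorff_outer d A \<le> hausdorff_outer d B"
  unfolding hausdorff_outer_def by (intro SUP_mono') (simp add: hausdorff_pre_mono)

lemma hausdorff_outer_ge: "\<delta> > 0 \<Longrightarrow> hausdorff_pre d \<delta> A \<le> hausdorff_outer d A"
  unfolding hausdorff_outer_def by (rule SUP_upper) auto

lemma hausdorff_outer_empty [simp]: "hausdorff_outer d {} = 0"
proof -
  have "hausdorff_pre d \<delta> ({}::'a set) = 0" if "\<delta> > 0" for \<delta>
    using hausdorff_pre_le[of "{}::'a set" "\<lambda>_. {}" \<delta> d] that by auto
  then show ?thesis
    unfolding hausdorff_outer_def by (auto simp: SUP_eq_iff)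
qed

lemma hausdorff_pre_countable_subadditive:
  fixes A :: "nat \<Rightarrow> 'a::metric_space set"
  shows "hausdorff_pre d \<delta> (\<Union>i. A i) \<le> (\<Sum>i. hausdorff_pre d \<delta> (A i))"
proof (rule ennreal_le_epsilon)
  fix e :: real
  assume fin: "(\<Sum>i. hausdorff_pre d \<delta> (A i)) < top" and e: "0 < e"
  have 1: "hausdorff_pre d \<delta> (A i) \<noteq> top" for i
    using fin by (metis ennreal_suminf_lessD less_irrefl)
  have 2: "\<exists>C. A i \<subseteq> (\<Union>j. C j) \<and> (\<forall>j. bounded (C j) \<and> diameter (C j) \<le> \<delta>) \<and>
      (\<Sum>j. hausdorff_size d (C j)) \<le> hausdorff_pre d \<delta> (A i) + ennreal (e * (1/2)^Suc i)" for i
  proof -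
    have "0 < e * (1/2)^Suc i" using e by simp
    moreover have "hausdorff_pre d \<delta> (A i) \<noteq> \<infinity>" using 1[of i] by simp
    ultimately have "\<exists>C\<in>{C. A i \<subseteq> (\<Union>j. C j) \<and> (\<forall>j. bounded (C j) \<and> diameter (C j) \<le> \<delta>)}.
        (\<Sum>j. hausdorff_size d (C j)) < hausdorff_pre d \<delta> (A i) + ennreal (e * (1/2)^Suc i)"
      by (rule INF_approx_ennreal[OF _ hausdorff_pre_def])
    then
    obtain C where "A i \<subseteq> (\<Union>j. C j)" "\<forall>j. bounded (C j) \<and> diameter (C j) \<le> \<delta>"
      "(\<Sum>j. hausdorff_size d (C j)) < hausdorff_pre d \<delta> (A i) + ennreal (e * (1/2)^Suc i)"
      by blast
    then show ?thesis by (intro exI[of _ C]) (auto intro: less_imp_le)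
  qed
  from choice[OF allI[OF 2]]
  obtain C where C': "\<forall>i. A i \<subseteq> (\<Union>j. C i j) \<and> (\<forall>j. bounded (C i j) \<and> diameter (C i j) \<le> \<delta>) \<and>
      (\<Sum>j. hausdorff_size d (C i j)) \<le> hausdorff_pre d \<delta> (A i) + ennreal (e * (1/2)^Suc i)"
    by (rule exE)
  then have C: "\<And>i. A i \<subseteq> (\<Union>j. C i j)" "\<And>i j. bounded (C i j)" "\<And>i j. diameter (C i j) \<le> \<delta>"
     "\<And>i. (\<Sum>j. hausdorff_size d (C i j)) \<le> hausdorff_pre d \<delta> (A i) + ennreal (e * (1/2)^Suc i)"
    by simp_all
  have "hausdorff_pre d \<delta> (\<Union>i. A i) \<le> (\<Sum>k. hausdorff_size d (case prod_decode k of (i, j) \<Rightarrow> C i j))"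
  proof (rule hausdorff_pre_le)
    show "\<Union> (range A) \<subseteq> (\<Union>k. case prod_decode k of (i, j) \<Rightarrow> C i j)"
    proof clarsimp
      fix x i assume "x \<in> A i"
      then obtain j where "x \<in> C i j" using C(1) by blast
      then show "\<exists>k. x \<in> (case prod_decode k of (i, j) \<Rightarrow> C i j)"
        by (intro exI[of _ "prod_encode (i, j)"]) auto
    qed
  qed (auto simp: C split: prod.split)
  also have "\<dots> = (\<Sum>k. (case_prod (\<lambda>i j. hausdorff_size d (C i j)) (prod_decode k)))"
    by (intro suminf_cong) (auto split: prod.split)
  also have "\<dots> = (\<Sum>i. \<Sum>j. hausdorff_size d (C i j))"
    using suminf_ennreal_2dimen[of "\<lambda>i. \<Sum>j. hausdorff_size d (C i j)" "case_prod (\<lambda>i j. hausdorff_size d (C i j))"]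
    by (simp add: o_def)
  also have "\<dots> \<le> (\<Sum>i. hausdorff_pre d \<delta> (A i) + ennreal (e * (1/2)^Suc i))"
    by (intro suminf_le C) auto
  also have "\<dots> = (\<Sum>i. hausdorff_pre d \<delta> (A i)) + (\<Sum>i. ennreal (e * (1/2)^Suc i))"
    by (intro suminf_add[symmetric]) auto
  also have "(\<Sum>i. ennreal (e * (1/2)^Suc i)) = ennreal e"
    using e sums_mult[OF power_half_series, of e] by (intro suminf_ennreal_eq) auto
  finally show "hausdorff_pre d \<delta> (\<Union>i. A i) \<le> (\<Sum>i. hausdorff_pre d \<delta> (A i)) + ennreal e" .
qed

lemma hausdorff_outer_countable_subadditive:
  fixes A :: "nat \<Rightarrow> 'a::metric_space set"
  shows "hausdorff_outer d (\<Union>i. A i) \<le> (\<Sum>i. hausdorff_outer d (A i))"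
  unfolding hausdorff_outer_def[of d "\<Union>i. A i"]
proof (rule SUP_least)
  fix \<delta> :: real assume "\<delta> \<in> {0<..}"
  then have "(\<Sum>i. hausdorff_pre d \<delta> (A i)) \<le> (\<Sum>i. hausdorff_outer d (A i))"
    by (intro suminf_le hausdorff_outer_ge) auto
  then show "hausdorff_pre d \<delta> (\<Union>i. A i) \<le> (\<Sum>i. hausdorff_outer d (A i))"
    using hausdorff_pre_countable_subadditive order_trans by blast
qed

lemma hausdorff_outer_Un: "hausdorff_outer d (A \<union> B) \<le> hausdorff_outer d A + hausdorff_outer d B"
proof -
  have eq: "(\<Union>i. if i = 0 then A else if i = Suc 0 then B else {}) = A \<union> B"
    by (auto split: if_splits)
  have "hausdorff_outer d (A \<union> B) \<le> (\<Sum>i. hausdorff_outer d (if i = 0 then A else if i = Suc 0 then B else {}))"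
    using hausdorff_outer_countable_subadditive[of d "\<lambda>i. if i = 0 then A else if i = Suc 0 then B else {}"]
    by (simp only: eq)
  also have "\<dots> = (\<Sum>i\<in>{0, Suc 0}. hausdorff_outer d (if i = 0 then A else if i = Suc 0 then B else {}))"
    by (rule suminf_finite) auto
  finally show ?thesis by simp
qed

section \<open>Caratheodory's criterion for metric outer measures\<close>

lemma hausdorff_outer_separated:
  fixes A B :: "'a::metric_space set"
  assumes e: "e > 0" and sep: "\<And>x y. x \<in> A \<Longrightarrow> y \<in> B \<Longrightarrow> e \<le> dist x y"
  shows "hausdorff_outer d A + hausdorff_outer d B \<le> hausdorff_outer d (A \<union> B)"
proof -
  have pre: "hausdorff_pre d \<delta> A + hausdorff_pre d \<delta> B \<le> hausdorff_pre d \<delta> (A \<union> B)"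
    if \<delta>: "0 < \<delta>" "\<delta> < e" for \<delta>
  proof (rule hausdorff_pre_greatest)
    fix C :: "nat \<Rightarrow> 'a set"
    assume C: "A \<union> B \<subseteq> (\<Union>i. C i)" "\<And>i. bounded (C i)" "\<And>i. diameter (C i) \<le> \<delta>"
    \<comment> \<open>Once the mesh is below \<open>e\<close>, no covering set meets both
      \<open>A\<close> and \<open>B\<close>. Discarding the sets that miss \<open>A\<close>,
      respectively \<open>B\<close>, splits one covering into two that use different
      indices.\<close>
    define D where "D S i = (if C i \<inter> S = {} then {} else C i)" for S i
    have D: "bounded (D S i)" "diameter (D S i) \<le> \<delta>" for S i
      using C \<delta> by (auto simp: D_def)
    have excl: "D A i = {} \<or> D B i = {}" for i
    proof (rule ccontr)
      assume "\<not> ?thesis"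
      then obtain x y where xy: "x \<in> C i" "x \<in> A" "y \<in> C i" "y \<in> B"
        by (auto simp: D_def split: if_splits)
      then have "dist x y \<le> \<delta>"
        using diameter_bounded_bound[OF C(2)] C(3) order_trans by blast
      with sep xy \<delta> show False by force
    qed
    have "hausdorff_pre d \<delta> A + hausdorff_pre d \<delta> B
        \<le> (\<Sum>i. hausdorff_size d (D A i)) + (\<Sum>i. hausdorff_size d (D B i))"
      by (intro add_mono hausdorff_pre_le D) (use C(1) in \<open>auto simp: D_def\<close>; blast)+
    also have "\<dots> = (\<Sum>i. hausdorff_size d (D A i) + hausdorff_size d (D B i))"
      by (intro suminf_add) auto
    also have "\<dots> \<le> (\<Sum>i. hausdorff_size d (C i))"
    proof (intro suminf_le)
      fix i show "hausdorff_size d (D A i) + hausdorff_size d (D B i) \<le> hausdorff_size d (C i)"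
        using excl[of i] by (cases "C i \<inter> A = {}"; cases "C i \<inter> B = {}") (auto simp: D_def)
    qed auto
    finally show "hausdorff_pre d \<delta> A + hausdorff_pre d \<delta> B \<le> (\<Sum>i. hausdorff_size d (C i))" .
  qed
  \<comment> \<open>Both quantities grow as the mesh shrinks, so the two suprema can be taken along
    a common mesh.\<close>
  have "hausdorff_outer d A + hausdorff_outer d B
      = (SUP \<delta>\<in>{0<..}. hausdorff_pre d \<delta> A + hausdorff_pre d \<delta> B)"
    unfolding hausdorff_outer_def
  proof (rule SUP_add_directed_ennreal[symmetric])
    fix i j :: real assume "i \<in> {0<..}" "j \<in> {0<..}"
    then show "\<exists>k\<in>{0<..}. hausdorff_pre d i A + hausdorff_pre d j B \<le> hausdorff_pre d k A + hausdorff_pre d k B"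
      by (intro bexI[of _ "min i j"] add_mono hausdorff_pre_antimono) auto
  qed
  also have "\<dots> \<le> hausdorff_outer d (A \<union> B)"
  proof (rule SUP_least)
    fix \<delta> :: real assume \<delta>: "\<delta> \<in> {0<..}"
    define \<delta>' where "\<delta>' = min \<delta> (e/2)"
    have "hausdorff_pre d \<delta> A + hausdorff_pre d \<delta> B \<le> hausdorff_pre d \<delta>' A + hausdorff_pre d \<delta>' B"
      by (intro add_mono hausdorff_pre_antimono) (auto simp: \<delta>'_def)
    also have "\<dots> \<le> hausdorff_pre d \<delta>' (A \<union> B)"
      using pre[of \<delta>'] \<delta> e by (auto simp: \<delta>'_def)
    also have "\<dots> \<le> hausdorff_outer d (A \<union> B)"
      using \<delta> e by (intro hausdorff_outer_ge) (auto simp: \<delta>'_def)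
    finally show "hausdorff_pre d \<delta> A + hausdorff_pre d \<delta> B \<le> hausdorff_outer d (A \<union> B)" .
  qed
  finally show ?thesis .
qed

text \<open>The even-indexed sets are mutually separated, and so are the odd-indexed ones.\<close>

lemma hausdorff_outer_layers:
  fixes R :: "nat \<Rightarrow> 'a::metric_space set"
  assumes sep: "\<And>i j. i + 2 \<le> j \<Longrightarrow> \<exists>e>0. \<forall>x\<in>R i. \<forall>y\<in>R j. e \<le> dist x y"
    and sub: "\<And>i. R i \<subseteq> A"
  shows "(\<Sum>i. hausdorff_outer d (R i)) \<le> 2 * hausdorff_outer d A"
proof -
  have step: "(\<Sum>i<n. hausdorff_outer d (R (2*i+c))) \<le> hausdorff_outer d (\<Union>i<n. R (2*i+c))" for n c
  proof (induction n)
    case (Suc n)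
    have "\<exists>e. e > 0 \<and> (\<forall>x\<in>R (2*i+c). \<forall>y\<in>R (2*n+c). e \<le> dist x y)" if "i < n" for i
      using sep[of "2*i+c" "2*n+c"] that by auto
    then obtain e where e: "\<And>i. i < n \<Longrightarrow> e i > 0"
        "\<And>i x y. i < n \<Longrightarrow> x \<in> R (2*i+c) \<Longrightarrow> y \<in> R (2*n+c) \<Longrightarrow> e i \<le> dist x y"
      by metis
    \<comment> \<open>The element 1 keeps the set nonempty for \<open>n = 0\<close>.\<close>
    define e' where "e' = Min (insert 1 (e ` {..<n}))"
    have "e' > 0" using e(1) by (auto simp: e'_def)
    moreover have "e' \<le> dist x y" if "i < n" "x \<in> R (2*i+c)" "y \<in> R (2*n+c)" for i x y
    proof -
      have "e' \<le> e i" using that by (auto simp: e'_def intro!: Min_le)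
      with e(2)[OF that] show ?thesis by simp
    qed
    ultimately
    have "hausdorff_outer d (\<Union>i<n. R (2*i+c)) + hausdorff_outer d (R (2*n+c))
        \<le> hausdorff_outer d ((\<Union>i<n. R (2*i+c)) \<union> R (2*n+c))"
      by (intro hausdorff_outer_separated[of e']) auto
    moreover have "(\<Union>i<n. R (2*i+c)) \<union> R (2*n+c) = (\<Union>i<Suc n. R (2*i+c))"
      by (auto simp: less_Suc_eq)
    ultimately show ?case using Suc.IH by (simp add: order_trans[OF add_right_mono])
  qed simp
  have half: "(\<Sum>i. hausdorff_outer d (R (2*i+c))) \<le> hausdorff_outer d A" for c
    using order_trans[OF step hausdorff_outer_mono] sub by (intro suminf_le_const) (auto simp: UN_subset_iff)
  have "(\<Sum>i<n. hausdorff_outer d (R i)) \<le> 2 * hausdorff_outer d A" for n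
  proof -
    have "(\<Sum>i<n. hausdorff_outer d (R i)) \<le> (\<Sum>i<2*n. hausdorff_outer d (R i))"
      by (intro sum_mono2) auto
    also have "\<dots> = (\<Sum>i<n. hausdorff_outer d (R (2*i+0))) + (\<Sum>i<n. hausdorff_outer d (R (2*i+1)))"
      by (induction n) (auto simp: ac_simps)
    also have "\<dots> \<le> hausdorff_outer d A + hausdorff_outer d A"
      by (intro add_mono order_trans[OF sum_le_suminf half]) auto
    finally show ?thesis by (simp add: mult_2)
  qed
  then show ?thesis by (intro suminf_le_const) auto
qed

text \<open>\<open>A - F\<close> is exhausted by its points at distance at least
  \<open>1 / (n + 1)\<close> from \<open>F\<close>, and these are separated from
  \<open>A \<inter> F\<close>. The points missed lie in shells whose sizes have sum at most
  \<open>2 * hausdorff_outer d A\<close>, so the tail of the series tends to zero.\<close>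

lemma hausdorff_outer_closed_split:
  fixes F :: "'a::metric_space set"
  assumes "closed F"
  shows "hausdorff_outer d (A \<inter> F) + hausdorff_outer d (A - F) \<le> hausdorff_outer d A"
\<comment> \<open>\<open>infdist\<close> to the empty set is 0, so shells make no sense there; an
  infinite right-hand side makes the claim trivial.\<close>
proof (cases "F = {} \<or> hausdorff_outer d A = \<infinity>")
  case False
  let ?R = "\<lambda>k. {x\<in>A. 1/(real k+2) \<le> infdist x F \<and> infdist x F < 1/(real k+1)}"
  define f where "f k = hausdorff_outer d (?R k)" for k
  define An where "An n = {x\<in>A. 1/(real n+1) \<le> infdist x F}" for n :: nat
  have lip: "infdist x F - infdist y F \<le> dist x y" for x y
    using infdist_triangle[of x F y] by (simp add: dist_commute)
  have "suminf f \<le> 2 * hausdorff_outer d A"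
    unfolding f_def
  proof (rule hausdorff_outer_layers)
    fix i j :: nat assume ij: "i + 2 \<le> j"
    have "1/(real j+1) < 1/(real i+2)" using ij by (intro divide_strict_left_mono) auto
    moreover have "1/(real i+2) - 1/(real j+1) \<le> dist x y"
      if "1/(real i+2) \<le> infdist x F" "infdist y F < 1/(real j+1)" for x y
      using lip[of x y] that by linarith
    ultimately show "\<exists>e>0. \<forall>x\<in>?R i.
        \<forall>y\<in>?R j. e \<le> dist x y"
      by (intro exI[of _ "1/(real i+2) - 1/(real j+1)"]) auto
  qed auto
  also have "\<dots> < top" using False by (simp add: ennreal_mult_less_top top.not_eq_extremum)
  finally have fin: "suminf f < top" .
  have tail: "hausdorff_outer d (A - F) \<le> hausdorff_outer d (An n) + (\<Sum>k. f (k + n))" for n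
  proof -
    have "A - F \<subseteq> An n \<union> (\<Union>k. ?R (k+n))"
    proof
      fix x assume x: "x \<in> A - F"
      then have pos: "infdist x F > 0"
        using assms False infdist_pos_not_in_closed by auto
      show "x \<in> An n \<union> (\<Union>k. ?R (k+n))"
      proof (cases "1/(real n+1) \<le> infdist x F")
        case False
        \<comment> \<open>The shell containing \<open>x\<close> has index \<open>m - 1\<close>,
          since the bound first holds at \<open>m\<close>. As \<open>m > n\<close>, this shell
          belongs to the tail.\<close>
        define m where "m = (LEAST m. 1/(real m+1) \<le> infdist x F)"
        obtain m0 where "inverse (real (Suc m0)) < infdist x F"
          using reals_Archimedean[OF pos] by blast
        then have m0: "1/(real m0+1) \<le> infdist x F" by (simp add: field_simps)
        have m: "1/(real m+1) \<le> infdist x F" unfolding m_def by (rule LeastI, rule m0)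
        have "m > n"
        proof (rule ccontr)
          assume "\<not> m > n"
          then have "1/(real n+1) \<le> 1/(real m+1)" by (intro divide_left_mono) auto
          with m False show False by linarith
        qed
        then have "\<not> 1/(real (m-1)+1) \<le> infdist x F"
          using not_less_Least[of "m-1" "\<lambda>m. 1/(real m+1) \<le> infdist x F"] by (auto simp: m_def)
        moreover have "real (m - 1 - n + n) + 2 = real m + 1" "real (m - 1 - n + n) + 1 = real (m-1)+1"
          using \<open>m > n\<close> by auto
        ultimately show ?thesis using m x
          by (intro UnI2 UN_I[of "m - 1 - n"]) (simp_all only: mem_Collect_eq, auto)
      qed (use x in \<open>auto simp: An_def\<close>)
    qed
    then have "hausdorff_outer d (A - F) \<le> hausdorff_outer d (An n \<union> (\<Union>k. ?R (k+n)))"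
      by (rule hausdorff_outer_mono)
    also have "\<dots> \<le> hausdorff_outer d (An n) + (\<Sum>k. f (k + n))"
      unfolding f_def by (intro order_trans[OF hausdorff_outer_Un] add_left_mono hausdorff_outer_countable_subadditive)
    finally show ?thesis .
  qed
  have sepA: "hausdorff_outer d (A \<inter> F) + hausdorff_outer d (An n) \<le> hausdorff_outer d A" for n
  proof -
    have "hausdorff_outer d (A \<inter> F) + hausdorff_outer d (An n) \<le> hausdorff_outer d ((A \<inter> F) \<union> An n)"
    proof (rule hausdorff_outer_separated[of "1/(real n+1)"])
      fix x y assume "x \<in> A \<inter> F" "y \<in> An n"
      then show "1/(real n+1) \<le> dist x y"
        using infdist_le[of x F y] by (auto simp: An_def dist_commute)
    qed auto
    also have "\<dots> \<le> hausdorff_outer d A" by (rule hausdorff_outer_mono) (auto simp: An_def)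
    finally show ?thesis .
  qed
  have "(\<lambda>n. \<Sum>k. f (k + n)) \<longlonglongrightarrow> 0"
  proof -
    have fk: "f k < top" for k using fin by (rule ennreal_suminf_lessD)
    define r where "r k = enn2real (f k)" for k
    have f: "f = (\<lambda>k. ennreal (r k))" using fk by (auto simp: r_def)
    have r: "r k \<ge> 0" for k by (simp add: r_def)
    have sm: "summable r" using fin r unfolding f by (intro summable_suminf_not_top) auto
    have "(\<lambda>n. ennreal (\<Sum>k. r (k + n))) \<longlonglongrightarrow> ennreal 0"
      by (intro tendsto_ennrealI suminf_exist_split2 sm)
    moreover have "(\<Sum>k. f (k + n)) = ennreal (\<Sum>k. r (k + n))" for n
      unfolding f using sm r by (intro suminf_ennreal2) (auto simp: summable_iff_shift)
    ultimately show ?thesis by simp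
  qed
  then have "(\<lambda>n. hausdorff_outer d A + (\<Sum>k. f (k + n))) \<longlonglongrightarrow> hausdorff_outer d A + 0"
    by (intro tendsto_add tendsto_const)
  moreover have "hausdorff_outer d (A \<inter> F) + hausdorff_outer d (A - F) \<le> hausdorff_outer d A + (\<Sum>k. f (k + n))" for n
  proof -
    have "hausdorff_outer d (A \<inter> F) + hausdorff_outer d (A - F)
       \<le> hausdorff_outer d (A \<inter> F) + (hausdorff_outer d (An n) + (\<Sum>k. f (k + n)))"
      by (intro add_left_mono tail)
    also have "\<dots> \<le> hausdorff_outer d A + (\<Sum>k. f (k + n))"
      using sepA[of n] by (simp add: add.assoc[symmetric] add_right_mono)
    finally show ?thesis .
  qed
  ultimately show ?thesis
    by (intro LIMSEQ_le_const[where X="\<lambda>n. hausdorff_outer d A + (\<Sum>k. f (k + n))"]) auto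
qed auto

lemma sets_hausdorff_measure [simp, measurable_cong]: "sets (hausdorff_measure d) = sets borel"
  unfolding hausdorff_measure_def by (metis sets.sigma_sets_eq sets.space_closed sets_measure_of space_borel)

lemma space_hausdorff_measure [simp]: "space (hausdorff_measure d) = UNIV"
  unfolding hausdorff_measure_def by (metis sets.space_closed space_borel space_measure_of)

text \<open>\<open>measure_of\<close> yields the zero measure unless its set function is a measure
  on the sigma-algebra, so nothing can be said of \<open>hausdorff_measure\<close> before this.
  Caratheodory's measurable sets form a sigma-algebra on which the outer measure is a measure, and
  it contains the closed sets.\<close>

lemma measure_space_hausdorff_outer:
  "measure_space (UNIV :: 'a::metric_space set) (sets borel) (hausdorff_outer d)"
proof -
  interpret P: sigma_algebra "UNIV :: 'a set" "Pow UNIV" by (rule sigma_algebra_Pow)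
  have om: "outer_measure_space (Pow (UNIV :: 'a set)) (hausdorff_outer d)"
    by (auto simp: outer_measure_space_def positive_def increasing_def countably_subadditive_def
          hausdorff_outer_mono hausdorff_outer_countable_subadditive)
  let ?L = "lambda_system (UNIV :: 'a set) (Pow UNIV) (hausdorff_outer d)"
  have L: "measure_space UNIV ?L (hausdorff_outer d)"
    by (rule P.caratheodory_lemma[OF om])
  have "F \<in> ?L" if "closed F" for F
    unfolding P.lambda_system_eq mem_Collect_eq
  proof safe
    fix A :: "'a set"
    have "hausdorff_outer d A \<le> hausdorff_outer d (A \<inter> F) + hausdorff_outer d (A - F)"
      using hausdorff_outer_Un[of d "A \<inter> F" "A - F"] by (simp add: Int_Diff_Un)
    then show "hausdorff_outer d (A \<inter> F) + hausdorff_outer d (A - F) = hausdorff_outer d A"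
      using hausdorff_outer_closed_split[OF that] by (auto intro: antisym)
  qed auto
  then have "sigma_sets UNIV {S :: 'a set. closed S} \<subseteq> ?L"
    using L by (intro sigma_algebra.sigma_sets_subset) (auto simp: measure_space_def)
  then have "sets (borel :: 'a measure) \<subseteq> ?L"
    by (simp add: borel_eq_closed)
  then show ?thesis
    using L sets.sigma_algebra_axioms[of "borel :: 'a measure"] by (auto intro: measure_down)
qed

lemma emeasure_hausdorff_measure:
  "A \<in> sets borel \<Longrightarrow> emeasure (hausdorff_measure d) A = hausdorff_outer d A"
  using measure_space_hausdorff_outer[of d]
  by (intro emeasure_measure_of[OF hausdorff_measure_def])
     (auto simp: measure_space_def)

section \<open>Images under Lipschitz maps, isometries and homotheties\<close>

lemma hausdorff_outer_lipschitz_image: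
  fixes f :: "'a::metric_space \<Rightarrow> 'b::metric_space"
  assumes L: "L > 0" and lip: "\<And>x y. x \<in> A \<Longrightarrow> y \<in> A \<Longrightarrow> dist (f x) (f y) \<le> L * dist x y"
  shows "hausdorff_outer d (f ` A) \<le> ennreal (L ^ d) * hausdorff_outer d A"
  unfolding hausdorff_outer_def[of d "f ` A"]
proof (rule SUP_least)
  fix \<delta> :: real assume "\<delta> \<in> {0<..}"
  then have \<delta>: "\<delta> > 0" by simp
  have Lz: "ennreal (L ^ d) \<noteq> 0" "ennreal (L ^ d) \<noteq> top" using L by auto
  \<comment> \<open>With \<open>L ^ d\<close> divided out, the right-hand side is a bare infimum, so
    a covering of \<open>A\<close> can be fixed.\<close>
  have "hausdorff_pre d \<delta> (f ` A) / ennreal (L ^ d) \<le> hausdorff_pre d (\<delta> / L) A"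
  proof (rule hausdorff_pre_greatest)
    fix C :: "nat \<Rightarrow> 'a set"
    assume C: "A \<subseteq> (\<Union>i. C i)" "\<And>i. bounded (C i)" "\<And>i. diameter (C i) \<le> \<delta> / L"
    have dist: "dist u v \<le> L * diameter (C i)" if u: "u \<in> f ` (A \<inter> C i)" and v: "v \<in> f ` (A \<inter> C i)" for u v i
    proof -
      obtain x y where "x \<in> A" "x \<in> C i" "y \<in> A" "y \<in> C i" and uv: "u = f x" "v = f y"
        using u v by auto
      then have "dist u v \<le> L * dist x y" using lip by auto
      also have "\<dots> \<le> L * diameter (C i)"
        using diameter_bounded_bound[OF C(2)] \<open>x \<in> C i\<close> \<open>y \<in> C i\<close> L by (intro mult_left_mono) auto
      finally show ?thesis .
    qed
    have dpos: "0 \<le> L * diameter (C i)" for i using L diameter_ge_0[OF C(2)[of i]] by simp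
    have bd: "bounded (f ` (A \<inter> C i))" for i
    proof (cases "A \<inter> C i = {}")
      case False
      then obtain x where "x \<in> A \<inter> C i" by blast
      then show ?thesis
        unfolding bounded_def using dist[of "f x" i] by blast
    qed auto
    have diam: "diameter (f ` (A \<inter> C i)) \<le> L * diameter (C i)" for i
      unfolding diameter_def[of "f ` (A \<inter> C i)"]
      using dpos by (auto intro!: cSUP_least dist simp del: image_Int)
    have "hausdorff_pre d \<delta> (f ` A) \<le> (\<Sum>i. hausdorff_size d (f ` (A \<inter> C i)))"
    proof (intro hausdorff_pre_le bd)
      fix i
      show "diameter (f ` (A \<inter> C i)) \<le> \<delta>"
        using diam[of i] C(3)[of i] L by (auto simp: field_simps)
    qed (use C(1) in blast)
    also have "\<dots> \<le> (\<Sum>i. ennreal (L ^ d) * hausdorff_size d (C i))"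
    proof (intro suminf_le)
      fix i
      show "hausdorff_size d (f ` (A \<inter> C i)) \<le> ennreal (L ^ d) * hausdorff_size d (C i)"
      \<comment> \<open>An empty image has size 0 by convention; otherwise both sets are nonempty
        and the power formula holds on both sides.\<close>
      proof (cases "A \<inter> C i = {}")
        case False
        have "(diameter (f ` (A \<inter> C i)) / 2) ^ d \<le> (L * (diameter (C i) / 2)) ^ d"
          using diam[of i] diameter_ge_0[OF bd] by (intro power_mono) auto
        from mult_left_mono[OF this, of "unit_ball_vol (real d)"]
        have "unit_ball_vol (real d) * (diameter (f ` (A \<inter> C i)) / 2) ^ d
            \<le> L ^ d * (unit_ball_vol (real d) * (diameter (C i) / 2) ^ d)"
          by (simp only: power_mult_distrib mult_ac unit_ball_vol_nonneg of_nat_0_le_iff)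
        then have "ennreal (unit_ball_vol (real d) * (diameter (f ` (A \<inter> C i)) / 2) ^ d)
            \<le> ennreal (L ^ d) * ennreal (unit_ball_vol (real d) * (diameter (C i) / 2) ^ d)"
          using L by (subst ennreal_mult'[symmetric]) (auto intro: ennreal_leI)
        moreover have "C i \<noteq> {}" "f ` (A \<inter> C i) \<noteq> {}" using False by auto
        ultimately show ?thesis
          by (simp only: hausdorff_size_def if_False)
      qed auto
    qed auto
    finally have "hausdorff_pre d \<delta> (f ` A) \<le> ennreal (L ^ d) * (\<Sum>i. hausdorff_size d (C i))"
      by simp
    then show "hausdorff_pre d \<delta> (f ` A) / ennreal (L ^ d) \<le> (\<Sum>i. hausdorff_size d (C i))"
      using Lz L by (intro divide_le_posI_ennreal) (auto simp: mult.commute)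
  qed
  also have "\<dots> \<le> hausdorff_outer d A" using \<delta> L by (intro hausdorff_outer_ge) auto
  finally have "ennreal (L ^ d) * (hausdorff_pre d \<delta> (f ` A) / ennreal (L ^ d)) \<le> ennreal (L ^ d) * hausdorff_outer d A"
    by (rule mult_left_mono) simp
  then show "hausdorff_pre d \<delta> (f ` A) \<le> ennreal (L ^ d) * hausdorff_outer d A"
    using Lz by (simp add: ennreal_times_divide mult.commute[of "ennreal (L ^ d)" "hausdorff_pre _ _ _"] ennreal_mult_divide_eq)
qed

text \<open>The lower bound makes \<open>f\<close> injective on \<open>A\<close>, and its inverse
  there is Lipschitz with constant \<open>L\<close>.\<close>

lemma hausdorff_outer_le_image:
  fixes f :: "'a::metric_space \<Rightarrow> 'b::metric_space"
  assumes L: "L > 0" and lip: "\<And>x y. x \<in> A \<Longrightarrow> y \<in> A \<Longrightarrow> dist x y \<le> L * dist (f x) (f y)"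
  shows "hausdorff_outer d A \<le> ennreal (L ^ d) * hausdorff_outer d (f ` A)"
proof -
  have inj: "inj_on f A"
    using lip by (fastforce simp: inj_on_def)
  have "hausdorff_outer d (inv_into A f ` f ` A) \<le> ennreal (L ^ d) * hausdorff_outer d (f ` A)"
    by (rule hausdorff_outer_lipschitz_image[OF L]) (auto simp: inj lip)
  moreover have "inv_into A f ` f ` A = A"
    using inj by (simp add: inv_into_image_cancel)
  ultimately show ?thesis by simp
qed

lemma hausdorff_outer_isometric_image:
  fixes f :: "'a::metric_space \<Rightarrow> 'b::metric_space"
  assumes "\<And>x y. x \<in> A \<Longrightarrow> y \<in> A \<Longrightarrow> dist (f x) (f y) = dist x y"
  shows "hausdorff_outer d (f ` A) = hausdorff_outer d A"
proof (rule antisym)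
  show "hausdorff_outer d (f ` A) \<le> hausdorff_outer d A"
    using hausdorff_outer_lipschitz_image[of 1 A f d] assms by simp
  show "hausdorff_outer d A \<le> hausdorff_outer d (f ` A)"
    using hausdorff_outer_le_image[of 1 A f d] assms by simp
qed

text \<open>For an involution the preimage of a set is its image, so invariance of the outer measure
  under isometric images suffices. The symmetries used later, the antipodal map and reflections, are
  all of this kind.\<close>

lemma distr_hausdorff_involution:
  fixes f :: "'a::metric_space \<Rightarrow> 'a"
  assumes iso: "\<And>x y. dist (f x) (f y) = dist x y" and inv: "\<And>x. f (f x) = x"
  shows "distr (hausdorff_measure d) borel f = hausdorff_measure d"
proof (rule measure_eqI)
  have f: "f \<in> borel_measurable borel"
    by (intro borel_measurable_continuous_onI) (unfold continuous_on_iff iso, blast)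
  fix A assume "A \<in> sets (distr (hausdorff_measure d) borel f)"
  then have A: "A \<in> sets borel" by simp
  have "f -` A = f ` A"
  proof safe
    fix x assume "f x \<in> A"
    then show "x \<in> f ` A" using imageI[of "f x" A f] by (simp add: inv)
  qed (simp add: inv)
  moreover have "f -` A \<in> sets borel" using f A by (metis measurable_sets_borel)
  ultimately show "emeasure (distr (hausdorff_measure d) borel f) A = emeasure (hausdorff_measure d) A"
    using A f by (simp add: emeasure_distr emeasure_hausdorff_measure hausdorff_outer_isometric_image iso)
qed auto

lemma hausdorff_outer_scaleR:
  fixes A :: "'a::real_normed_vector set"
  assumes "c > 0"
  shows "hausdorff_outer d ((*\<^sub>R) c ` A) = ennreal (c ^ d) * hausdorff_outer d A"
proof (rule antisym)
  have sc: "dist (c *\<^sub>R x) (c *\<^sub>R y) = c * dist x y" for x y :: 'a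
    using assms by (simp add: dist_norm flip: scaleR_diff_right)
  show "hausdorff_outer d ((*\<^sub>R) c ` A) \<le> ennreal (c ^ d) * hausdorff_outer d A"
    using assms by (intro hausdorff_outer_lipschitz_image) (auto simp: sc)
  have "hausdorff_outer d A \<le> ennreal ((1/c) ^ d) * hausdorff_outer d ((*\<^sub>R) c ` A)"
    using assms by (intro hausdorff_outer_le_image) (auto simp: sc)
  then have "ennreal (c ^ d) * hausdorff_outer d A
      \<le> ennreal (c ^ d) * (ennreal ((1/c) ^ d) * hausdorff_outer d ((*\<^sub>R) c ` A))"
    by (intro mult_left_mono) auto
  also have "\<dots> = hausdorff_outer d ((*\<^sub>R) c ` A)"
    using assms by (simp add: mult.assoc[symmetric] ennreal_mult'[symmetric] power_mult_distrib[symmetric])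
  finally show "ennreal (c ^ d) * hausdorff_outer d A \<le> hausdorff_outer d ((*\<^sub>R) c ` A)" .
qed

lemma distr_hausdorff_scaleR:
  fixes c :: real
  assumes "c > 0"
  shows "distr (hausdorff_measure d) borel (\<lambda>y::'a::real_normed_vector. y /\<^sub>R c)
       = scale_measure (ennreal (c ^ d)) (hausdorff_measure d)"
proof (rule measure_eqI)
  fix A assume "A \<in> sets (distr (hausdorff_measure d) borel (\<lambda>y::'a. y /\<^sub>R c))"
  then have A: "A \<in> sets borel" by simp
  have f: "(\<lambda>y::'a. y /\<^sub>R c) \<in> borel_measurable borel"
    by (intro borel_measurable_continuous_onI continuous_intros)
  have eq: "(\<lambda>y. y /\<^sub>R c) -` A = (*\<^sub>R) c ` A"
    using assms by (auto simp: image_iff intro!: bexI[of _ "_ /\<^sub>R c"])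
  have "(*\<^sub>R) c ` A \<in> sets borel"
    using f A unfolding eq[symmetric] by (metis measurable_sets_borel)
  then show "emeasure (distr (hausdorff_measure d) borel (\<lambda>y::'a. y /\<^sub>R c)) A
      = emeasure (scale_measure (ennreal (c ^ d)) (hausdorff_measure d)) A"
    using A f assms
    by (simp add: emeasure_distr eq emeasure_hausdorff_measure hausdorff_outer_scaleR)
qed auto

section \<open>Points are null, disks in a hyperplane are not\<close>

lemma hausdorff_outer_singleton:
  assumes "d > 0"
  shows "hausdorff_outer d {x} = 0"
proof -
  have "hausdorff_pre d \<delta> {x} \<le> 0" if "\<delta> > 0" for \<delta>
  proof -
    have "hausdorff_pre d \<delta> {x} \<le> (\<Sum>i. hausdorff_size d {x})"
      using that by (intro hausdorff_pre_le) auto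
    also have "hausdorff_size d {x} = 0" using assms by (simp add: hausdorff_size_def)
    finally show ?thesis by simp
  qed
  then show ?thesis unfolding hausdorff_outer_def by (auto simp: SUP_eq_iff)
qed

text \<open>Each covering set is thickened to a box of unit height, and the boxes cover the unit cube.\<close>

lemma hausdorff_outer_coordinate_cube:
  fixes k :: "'n::finite"
  assumes "CARD('n) \<ge> 2"
  shows "hausdorff_outer (CARD('n) - 1) {x :: real^'n. x $ k = 0 \<and> (\<forall>j. 0 \<le> x $ j \<and> x $ j \<le> 1)} > 0"
    (is "hausdorff_outer ?d ?Q > 0")
proof -
  \<comment> \<open>Chosen so that the volume \<open>(2 * r) ^ ?d\<close> of a box of half-width
    \<open>r\<close> and height 1 is \<open>c\<close> times the Hausdorff size of a set of diameter
    \<open>r\<close>.\<close>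
  define c where "c = 4 ^ ?d / unit_ball_vol (real ?d)"
  have v: "unit_ball_vol (real ?d) > 0" by (rule unit_ball_vol_pos) (rule of_nat_0_le_iff)
  then have c: "c > 0" unfolding c_def by (intro divide_pos_pos) simp_all
  have cbox: "emeasure lborel (cbox a b) = ennreal (measure lborel (cbox a b))" for a b :: "real^'n"
    using emeasure_lborel_cbox_finite[of a b] by (intro emeasure_eq_ennreal_measure) auto
  have "ennreal (1 / c) \<le> hausdorff_pre ?d 1 ?Q"
  proof (rule hausdorff_pre_greatest)
    fix C :: "nat \<Rightarrow> (real^'n) set"
    assume C: "?Q \<subseteq> (\<Union>i. C i)" "\<And>i. bounded (C i)" "\<And>i. diameter (C i) \<le> 1"
    \<comment> \<open>Any point of \<open>C i\<close> serves as centre: with half-width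
      \<open>diameter (C i)\<close> around it, every coordinate of the set is covered.\<close>
    define a where "a i = (SOME x. x \<in> C i)" for i
    define r where "r i = diameter (C i)" for i
    have r: "r i \<ge> 0" for i using diameter_ge_0[OF C(2)] by (simp add: r_def)
    define B where "B i = (if C i = {} then {} else
        cbox (\<chi> j. if j = k then 0 else a i $ j - r i) (\<chi> j. if j = k then 1 else a i $ j + r i))" for i
    have B_size: "emeasure lborel (B i) \<le> ennreal c * hausdorff_size ?d (C i)" for i
    proof (cases "C i = {}")
      case False
      let ?l = "\<chi> j. if j = k then 0 else a i $ j - r i" and ?u = "\<chi> j. if j = k then 1 else a i $ j + r i"
      have ne: "cbox ?l ?u \<noteq> {}"
        using r[of i] by (auto simp: interval_ne_empty_cart)
      have "measure lborel (cbox ?l ?u) = (\<Prod>j\<in>UNIV. ?u $ j - ?l $ j)"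
        by (rule content_cbox_cart[OF ne])
      also have "\<dots> = (\<Prod>j\<in>UNIV - {k}. 2 * r i)"
        by (subst prod.remove[of UNIV k]) (auto intro!: prod.cong)
      also have "\<dots> = (2 * r i) ^ ?d" by (simp add: card_Diff_singleton)
      also have "\<dots> = c * (unit_ball_vol (real ?d) * (r i / 2) ^ ?d)"
      proof -
        have "(2 * r i) ^ ?d = (4 * (r i / 2)) ^ ?d" by simp
        also have "\<dots> = 4 ^ ?d * (r i / 2) ^ ?d" by (rule power_mult_distrib)
        also have "4 ^ ?d = c * unit_ball_vol (real ?d)"
          unfolding c_def using v by (metis nonzero_divide_eq_eq less_irrefl)
        finally show ?thesis by (simp only: mult.assoc)
      qed
      finally have "emeasure lborel (B i) = ennreal (c * (unit_ball_vol (real ?d) * (r i / 2) ^ ?d))"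
        using False by (simp only: B_def cbox if_False)
      also have "\<dots> = ennreal c * hausdorff_size ?d (C i)"
        using False c by (simp add: hausdorff_size_def r_def ennreal_mult')
      finally show ?thesis by simp
    qed (simp add: B_def)
    have cover: "cbox 0 1 \<subseteq> (\<Union>i. B i)"
    proof
      fix x :: "real^'n" assume x: "x \<in> cbox 0 1"
      \<comment> \<open>The foot of \<open>x\<close> in the coordinate hyperplane. A set covering
        the foot has a box that contains \<open>x\<close>.\<close>
      define x' where "x' = (\<chi> j. if j = k then 0 else x $ j)"
      have "x' \<in> ?Q" using x by (auto simp: x'_def mem_box_cart)
      then obtain i where i: "x' \<in> C i" using C(1) by blast
      have bd: "\<bar>x' $ j - a i $ j\<bar> \<le> r i" for j
      proof -
        have "a i \<in> C i" using i unfolding a_def by (rule someI)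
        then have "dist x' (a i) \<le> r i"
          unfolding r_def using diameter_bounded_bound[OF C(2)] i by blast
        moreover have "\<bar>(x' - a i) $ j\<bar> \<le> norm (x' - a i)" by (rule component_le_norm_cart)
        ultimately show ?thesis by (simp add: dist_norm)
      qed
      have "(if j = k then 0 else a i $ j - r i) \<le> x $ j \<and>
          x $ j \<le> (if j = k then 1 else a i $ j + r i)" for j
        using bd[of j] x by (auto simp: x'_def mem_box_cart abs_le_iff)
      then have "x \<in> B i"
        using i by (auto simp: B_def mem_box_cart)
      then show "x \<in> (\<Union>i. B i)" by blast
    qed
    have Bs: "B i \<in> sets lborel" for i by (auto simp: B_def)
    have "measure lborel (cbox (0::real^'n) 1) = 1"
      by (subst content_cbox_cart) (auto simp: interval_ne_empty_cart)
    then have "1 = emeasure lborel (cbox (0::real^'n) 1)"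
      by (simp add: cbox)
    also have "\<dots> \<le> emeasure lborel (\<Union>i. B i)"
      using Bs by (intro emeasure_mono cover) auto
    also have "\<dots> \<le> (\<Sum>i. emeasure lborel (B i))"
      using Bs by (intro emeasure_subadditive_countably) auto
    also have "\<dots> \<le> (\<Sum>i. ennreal c * hausdorff_size ?d (C i))"
      by (intro suminf_le B_size) auto
    finally have "1 \<le> ennreal c * (\<Sum>i. hausdorff_size ?d (C i))" by simp
    then have "ennreal (1/c) * 1 \<le> ennreal (1/c) * (ennreal c * (\<Sum>i. hausdorff_size ?d (C i)))"
      by (rule mult_left_mono) simp
    then show "ennreal (1 / c) \<le> (\<Sum>i. hausdorff_size ?d (C i))"
      using c by (simp add: mult.assoc[symmetric] ennreal_mult'[symmetric])
  qed
  also have "\<dots> \<le> hausdorff_outer ?d ?Q" by (rule hausdorff_outer_ge) simp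
  finally have "ennreal (1 / c) \<le> hausdorff_outer ?d ?Q" .
  moreover have "0 < ennreal (1 / c)" using c by simp
  ultimately show ?thesis by (rule less_le_trans[rotated])
qed

text \<open>An orthogonal map carries a coordinate hyperplane to the given one. The radius is the l1
  bound on the norm of points of the unit cube.\<close>

lemma hausdorff_outer_hyperplane_pos:
  fixes N :: "real^'n"
  assumes "CARD('n) \<ge> 2" and N: "norm N = 1"
  obtains R where "R > 0" "hausdorff_outer (CARD('n) - 1) {y. N \<bullet> y = 0 \<and> norm y \<le> R} > 0"
proof -
  define k :: 'n where "k = undefined"
  obtain f where f: "orthogonal_transformation f" "f (axis k (1::real)) = N"
    by (rule orthogonal_transformation_exists_1[of "axis k (1::real)" N]) (simp_all add: N)
  let ?Q = "{x :: real^'n. x $ k = 0 \<and> (\<forall>j. 0 \<le> x $ j \<and> x $ j \<le> 1)}"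
  have sub: "f ` ?Q \<subseteq> {y. N \<bullet> y = 0 \<and> norm y \<le> real CARD('n)}"
  proof clarsimp
    fix x :: "real^'n" assume x: "x $ k = 0" "\<forall>j. 0 \<le> x $ j \<and> x $ j \<le> 1"
    have "N \<bullet> f x = axis k 1 \<bullet> x"
      using f unfolding orthogonal_transformation_def by metis
    then have "N \<bullet> f x = 0" using x by (simp add: inner_axis')
    moreover have "norm (f x) = norm x" using f by (simp add: orthogonal_transformation)
    moreover have "norm x \<le> (\<Sum>j\<in>UNIV. \<bar>x $ j\<bar>)" by (rule norm_le_l1_cart)
    moreover have "(\<Sum>j\<in>UNIV. \<bar>x $ j\<bar>) \<le> (\<Sum>j\<in>(UNIV::'n set). 1)"
      using x by (intro sum_mono) auto
    ultimately show "N \<bullet> f x = 0 \<and> norm (f x) \<le> real CARD('n)" by simp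
  qed
  have "0 < hausdorff_outer (CARD('n) - 1) ?Q"
    by (rule hausdorff_outer_coordinate_cube[OF assms(1)])
  also have "\<dots> = hausdorff_outer (CARD('n) - 1) (f ` ?Q)"
    using f by (subst hausdorff_outer_isometric_image)
      (auto simp: orthogonal_transformation_isometry)
  also have "\<dots> \<le> hausdorff_outer (CARD('n) - 1) {y. N \<bullet> y = 0 \<and> norm y \<le> real CARD('n)}"
    by (rule hausdorff_outer_mono[OF sub])
  finally show ?thesis by (intro that[of "real CARD('n)"]) auto
qed

section \<open>Integrals against comparable measures\<close>

lemma integral_comparable_measures:
  fixes f :: "'a \<Rightarrow> real"
  assumes fin: "finite_measure \<mu>" "finite_measure \<nu>" and sets: "sets \<nu> = sets \<mu>"
    and le: "\<And>X. X \<in> sets \<mu> \<Longrightarrow> emeasure \<mu> X \<le> emeasure \<nu> X"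
    and ge: "\<And>X. X \<in> sets \<mu> \<Longrightarrow> emeasure \<nu> X \<le> ennreal c * emeasure \<mu> X"
    and f[measurable]: "f \<in> borel_measurable \<mu>" and b: "\<And>x. \<bar>f x\<bar> \<le> b" and c: "c \<ge> 0"
  shows "\<bar>(\<integral>x. f x \<partial>\<nu>) - (\<integral>x. f x \<partial>\<mu>)\<bar> \<le> (c - 1) * (2 * b) * measure \<mu> (space \<mu>)"
proof -
  interpret m: finite_measure \<mu> by fact
  interpret n: finite_measure \<nu> by fact
  have sp: "space \<nu> = space \<mu>" by (rule sets_eq_imp_space_eq[OF sets])
  have fn[measurable]: "f \<in> borel_measurable \<nu>" using f sets by (simp cong: measurable_cong_sets)
  have im: "integrable \<mu> f" by (rule m.integrable_const_bound[of _ b]) (use b in auto)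
  have inu: "integrable \<nu> f" by (rule n.integrable_const_bound[of _ b]) (use b in auto)
  \<comment> \<open>Adding \<open>b\<close> makes the integrand nonnegative, so the comparison of
    measures passes to the integrals. The shift itself costs the difference of the total masses, and
    the two contributions together give the factor \<open>2 * b\<close>.\<close>
  have g: "f x + b \<ge> 0" for x using b[of x] by (simp add: abs_le_iff)
  have Im: "(\<integral>\<^sup>+x. ennreal (f x + b) \<partial>\<mu>) = ennreal ((\<integral>x. f x \<partial>\<mu>) + b * measure \<mu> (space \<mu>))"
    using im g by (subst nn_integral_eq_integral) (auto simp: mult.commute)
  have In: "(\<integral>\<^sup>+x. ennreal (f x + b) \<partial>\<nu>) = ennreal ((\<integral>x. f x \<partial>\<nu>) + b * measure \<nu> (space \<mu>))"
    using inu g by (subst nn_integral_eq_integral) (auto simp: mult.commute sp)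
  have pm: "(\<integral>x. f x \<partial>\<mu>) + b * measure \<mu> (space \<mu>) \<ge> 0"
    using Bochner_Integration.integral_nonneg[of \<mu> "\<lambda>x. f x + b"] g im by (simp add: mult.commute)
  have pn: "(\<integral>x. f x \<partial>\<nu>) + b * measure \<nu> (space \<mu>) \<ge> 0"
    using Bochner_Integration.integral_nonneg[of \<nu> "\<lambda>x. f x + b"] g inu by (simp add: mult.commute sp)
  have "\<mu> \<le> \<nu>" using le sets sp
    by (auto simp: le_measure_iff le_fun_def) (metis emeasure_notin_sets order_refl)
  then have "(\<integral>\<^sup>+x. ennreal (f x + b) \<partial>\<mu>) \<le> (\<integral>\<^sup>+x. ennreal (f x + b) \<partial>\<nu>)"
    by (intro nn_integral_mono_measure) (simp_all add: sets)
  then have 1: "(\<integral>x. f x \<partial>\<mu>) + b * measure \<mu> (space \<mu>) \<le> (\<integral>x. f x \<partial>\<nu>) + b * measure \<nu> (space \<mu>)"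
    unfolding Im In using pn by (simp add: ennreal_le_iff)
  have "\<nu> \<le> scale_measure (ennreal c) \<mu>" using ge sets sp
    by (auto simp: le_measure_iff le_fun_def space_scale_measure) (metis emeasure_notin_sets mult_zero_right order_refl)
  then have "(\<integral>\<^sup>+x. ennreal (f x + b) \<partial>\<nu>) \<le> (\<integral>\<^sup>+x. ennreal (f x + b) \<partial>scale_measure (ennreal c) \<mu>)"
    by (intro nn_integral_mono_measure) (simp_all add: sets)
  also have "\<dots> = ennreal c * (\<integral>\<^sup>+x. ennreal (f x + b) \<partial>\<mu>)"
    by (intro nn_integral_scale_measure) simp
  finally have 2: "(\<integral>x. f x \<partial>\<nu>) + b * measure \<nu> (space \<mu>) \<le> c * ((\<integral>x. f x \<partial>\<mu>) + b * measure \<mu> (space \<mu>))"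
    unfolding Im In using pm c by (simp add: ennreal_mult'[symmetric] ennreal_le_iff)
  have "ennreal (measure \<mu> (space \<mu>)) \<le> ennreal (measure \<nu> (space \<mu>))"
    using le[of "space \<mu>"] by (metis m.emeasure_eq_measure n.emeasure_eq_measure sets.top)
  then have 3: "measure \<mu> (space \<mu>) \<le> measure \<nu> (space \<mu>)" by (simp add: ennreal_le_iff)
  have "ennreal (measure \<nu> (space \<mu>)) \<le> ennreal c * ennreal (measure \<mu> (space \<mu>))"
    using ge[of "space \<mu>"] by (metis m.emeasure_eq_measure n.emeasure_eq_measure sets.top)
  then have 4: "measure \<nu> (space \<mu>) \<le> c * measure \<mu> (space \<mu>)"
    using c by (simp add: ennreal_mult'[symmetric] ennreal_le_iff)
  have b0: "b \<ge> 0" using b by (meson abs_ge_zero order_trans)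
  have "\<bar>\<integral>x. f x \<partial>\<mu>\<bar> \<le> (\<integral>x. \<bar>f x\<bar> \<partial>\<mu>)" by (rule integral_abs_bound)
  also have "\<dots> \<le> (\<integral>x. b \<partial>\<mu>)" using im b by (intro integral_mono) auto
  finally have 5: "\<bar>\<integral>x. f x \<partial>\<mu>\<bar> \<le> b * measure \<mu> (space \<mu>)" by (simp add: mult.commute)
  have 6: "b * measure \<mu> (space \<mu>) \<le> b * measure \<nu> (space \<mu>)"
    "b * measure \<nu> (space \<mu>) \<le> b * (c * measure \<mu> (space \<mu>))"
    using 3 4 b0 by (auto intro: mult_left_mono)
  show ?thesis
  \<comment> \<open>If \<open>\<mu>\<close> has no mass, nothing forces \<open>c \<ge> 1\<close>,
    but then both integrals vanish.\<close>
  proof (cases "measure \<mu> (space \<mu>) = 0")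
    case True
    then show ?thesis using 1 2 5 6 by auto
  next
    case False
    then have "c \<ge> 1" using 3 4 by (metis less_eq_real_def measure_nonneg mult_le_cancel_right1 order_trans not_less)
    then have "(c - 1) * (\<integral>x. f x \<partial>\<mu>) \<le> (c - 1) * (b * measure \<mu> (space \<mu>))"
      using 5 by (intro mult_left_mono) auto
    moreover have "0 \<le> (c - 1) * (b * measure \<mu> (space \<mu>))"
      using \<open>c \<ge> 1\<close> b0 by (intro mult_nonneg_nonneg) auto
    ultimately show ?thesis using 1 2 6 by (simp add: algebra_simps abs_le_iff)
  qed
qed

lemma integral_density_indicator:
  fixes h :: "'a::metric_space \<Rightarrow> real"
  assumes [measurable]: "S \<in> sets borel" "h \<in> borel_measurable borel"
  shows "(\<integral>x. h x \<partial>density (hausdorff_measure d) (indicator S)) = (\<integral>x. indicator S x * h x \<partial>hausdorff_measure d)"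
proof -
  have [measurable]: "S \<in> sets (hausdorff_measure d)" "h \<in> borel_measurable (hausdorff_measure d)"
    by (simp_all cong: measurable_cong_sets)
  have eq: "density (hausdorff_measure d) (indicator S) = density (hausdorff_measure d) (\<lambda>x. ennreal (indicator S x))"
    by (simp add: ennreal_indicator)
  show ?thesis unfolding eq by (subst integral_density) auto
qed

text \<open>The Hausdorff measure on \<open>A\<close>, pushed forward by \<open>p\<close>, lies
  between the Hausdorff measure on the image and \<open>L ^ d\<close> times it. Both bounds come
  from applying the Lipschitz estimates to the part of \<open>A\<close> lying over a Borel
  set.\<close>

lemma integral_hausdorff_bilipschitz:
  fixes p :: "'a::metric_space \<Rightarrow> 'b::metric_space" and f :: "'b \<Rightarrow> real"
  assumes A[measurable]: "A \<in> sets borel" and p[measurable]: "p \<in> borel_measurable borel"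
    and B[measurable]: "p ` A \<in> sets borel" and fin: "emeasure (hausdorff_measure d) A < \<infinity>"
    and lip: "\<And>x y. x \<in> A \<Longrightarrow> y \<in> A \<Longrightarrow> dist (p x) (p y) \<le> dist x y"
    and colip: "\<And>x y. x \<in> A \<Longrightarrow> y \<in> A \<Longrightarrow> dist x y \<le> L * dist (p x) (p y)" and L: "L > 0"
    and f[measurable]: "f \<in> borel_measurable borel" and b: "\<And>y. y \<in> p ` A \<Longrightarrow> \<bar>f y\<bar> \<le> b" "b \<ge> 0"
  shows "\<bar>(\<integral>x. indicator A x * f (p x) \<partial>hausdorff_measure d) - (\<integral>y. indicator (p ` A) y * f y \<partial>hausdorff_measure d)\<bar>
      \<le> (L ^ d - 1) * (2 * b) * measure (hausdorff_measure d) (p ` A)"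
proof -
  define \<mu> where "\<mu> = density (hausdorff_measure d) (indicator (p ` A))"
  define \<kappa> where "\<kappa> = density (hausdorff_measure d) (indicator A)"
  define \<nu> where "\<nu> = distr \<kappa> borel p"
  have [measurable]: "f \<in> borel_measurable (hausdorff_measure d)" "p \<in> borel_measurable (hausdorff_measure d)"
    "A \<in> sets (hausdorff_measure d)" "p ` A \<in> sets (hausdorff_measure d)"
    by (simp_all cong: measurable_cong_sets)
  have [simp]: "sets \<mu> = sets borel" "sets \<nu> = sets borel" "space \<mu> = UNIV" "sets \<kappa> = sets borel"
    by (auto simp: \<mu>_def \<nu>_def \<kappa>_def)
  have \<mu>: "emeasure \<mu> X = hausdorff_outer d (p ` A \<inter> X)" if "X \<in> sets borel" for X
    using that B by (simp add: \<mu>_def emeasure_restricted emeasure_hausdorff_measure)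
  have \<nu>: "emeasure \<nu> X = hausdorff_outer d (A \<inter> p -` X)" if X: "X \<in> sets borel" for X
  proof -
    have "p -` X \<in> sets borel" using X p by (metis measurable_sets_borel)
    then show ?thesis
      using that A by (simp add: \<nu>_def \<kappa>_def emeasure_distr emeasure_restricted emeasure_hausdorff_measure)
  qed
  have im: "p ` A \<inter> X = p ` (A \<inter> p -` X)" for X by auto
  have le: "emeasure \<mu> X \<le> emeasure \<nu> X" if "X \<in> sets \<mu>" for X
    using that hausdorff_outer_lipschitz_image[of 1 "A \<inter> p -` X" p d] lip by (simp add: \<mu> \<nu> im)
  have ge: "emeasure \<nu> X \<le> ennreal (L ^ d) * emeasure \<mu> X" if "X \<in> sets \<mu>" for X
    using that hausdorff_outer_le_image[OF L, of "A \<inter> p -` X" p d] colip by (simp add: \<mu> \<nu> im)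
  have "emeasure \<nu> UNIV < \<infinity>" using fin A by (simp add: \<nu> emeasure_hausdorff_measure)
  then have n: "finite_measure \<nu>" by (intro finite_measureI) (auto simp: \<nu>_def)
  have "emeasure \<mu> UNIV < \<infinity>" using le[of UNIV] \<open>emeasure \<nu> UNIV < \<infinity>\<close> by (auto intro: le_less_trans)
  then have m: "finite_measure \<mu>" by (intro finite_measureI) auto
  \<comment> \<open>\<open>f\<close> is bounded on the image of \<open>A\<close> only, whereas the
    comparison of measures wants a global bound. Cutting off changes neither integral.\<close>
  define g where "g y = indicator (p ` A) y * f y" for y
  have g[measurable]: "g \<in> borel_measurable borel" unfolding g_def by measurable
  have "\<bar>(\<integral>x. g x \<partial>\<nu>) - (\<integral>x. g x \<partial>\<mu>)\<bar> \<le> (L ^ d - 1) * (2 * b) * measure \<mu> (space \<mu>)"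
    using le ge m n L b by (intro integral_comparable_measures)
      (auto simp: g_def indicator_def cong: measurable_cong_sets)
  moreover have "(\<integral>x. g x \<partial>\<nu>) = (\<integral>x. g (p x) \<partial>\<kappa>)"
    unfolding \<nu>_def by (rule integral_distr) (auto cong: measurable_cong_sets)
  moreover have "(\<integral>x. indicator A x * g (p x) \<partial>hausdorff_measure d) = (\<integral>x. indicator A x * f (p x) \<partial>hausdorff_measure d)"
    by (intro Bochner_Integration.integral_cong) (auto simp: g_def indicator_def)
  moreover have "(\<integral>x. indicator (p ` A) x * g x \<partial>hausdorff_measure d) = (\<integral>x. indicator (p ` A) x * f x \<partial>hausdorff_measure d)"
    by (intro Bochner_Integration.integral_cong) (auto simp: g_def indicator_def)
  moreover have "measure \<mu> (space \<mu>) = measure (hausdorff_measure d) (p ` A)"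
    using \<mu>[of UNIV] B by (simp add: measure_def emeasure_hausdorff_measure)
  ultimately show ?thesis
    using integral_density_indicator[of A "\<lambda>x. g (p x)"] integral_density_indicator[of "p ` A" g] by (simp add: \<mu>_def \<kappa>_def)
qed

subsection \<open>Integrals over disks in a hyperplane\<close>

definition disk :: "'a::real_inner \<Rightarrow> real \<Rightarrow> 'a set" where
  "disk N \<epsilon> = {y. N \<bullet> y = 0 \<and> norm y \<le> \<epsilon>}"

lemma closed_disk: "closed (disk N \<epsilon>)"
  unfolding disk_def by (intro closed_Collect_conj closed_Collect_eq closed_Collect_le continuous_intros)

lemma disk_borel [measurable]: "disk N \<epsilon> \<in> sets borel"
  by (rule borel_closed[OF closed_disk])

lemma disk_scale:
  assumes "\<epsilon> > 0"
  shows "disk N (\<epsilon> * r) = (*\<^sub>R) \<epsilon> ` disk N r"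
proof safe
  fix y assume "y \<in> disk N (\<epsilon> * r)"
  then show "y \<in> (*\<^sub>R) \<epsilon> ` disk N r"
    using assms by (intro image_eqI[of _ _ "y /\<^sub>R \<epsilon>"]) (auto simp: disk_def field_simps)
qed (use assms in \<open>auto simp: disk_def\<close>)

lemma emeasure_disk_scale:
  assumes "\<epsilon> > 0"
  shows "emeasure (hausdorff_measure d) (disk N (\<epsilon> * r)) = ennreal (\<epsilon> ^ d) * emeasure (hausdorff_measure d) (disk N r)"
  using hausdorff_outer_scaleR[OF assms, of d "disk N r"]
  by (simp add: emeasure_hausdorff_measure flip: disk_scale[OF assms])

text \<open>Since \<open>\<xi>\<close> is nonnegative, the computation can run through
  \<open>nn_integral\<close>, from which the factor of a scaled measure pulls out.\<close>

lemma integral_disk_scale: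
  fixes N :: "'a::euclidean_space" and \<xi> :: "real \<Rightarrow> real"
  assumes \<epsilon>: "\<epsilon> > 0" and [measurable]: "\<xi> \<in> borel_measurable borel" and nn: "\<And>s. \<xi> s \<ge> 0"
  shows "(\<integral>y. indicator (disk N \<epsilon>) y * \<xi> (norm y / \<epsilon>) \<partial>hausdorff_measure d)
       = \<epsilon> ^ d * (\<integral>y. indicator (disk N 1) y * \<xi> (norm y) \<partial>hausdorff_measure d)"
proof -
  let ?H = "hausdorff_measure d :: 'a measure"
  define g where "g y = indicator (disk N 1) y * \<xi> (norm y)" for y
  have g[measurable]: "g \<in> borel_measurable borel" unfolding g_def by measurable
  have g0: "g y \<ge> 0" for y using nn by (simp add: g_def)
  have g': "g \<in> borel_measurable ?H" by (simp cong: measurable_cong_sets)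
  have gs: "(\<lambda>y. g (y /\<^sub>R \<epsilon>)) \<in> borel_measurable ?H"
    by (simp cong: measurable_cong_sets)
  have eq: "indicator (disk N \<epsilon>) y * \<xi> (norm y / \<epsilon>) = g (y /\<^sub>R \<epsilon>)" for y
  proof -
    have n: "norm (y /\<^sub>R \<epsilon>) = norm y / \<epsilon>" using \<epsilon> by (simp add: divide_inverse mult.commute)
    have "y /\<^sub>R \<epsilon> \<in> disk N 1 \<longleftrightarrow> y \<in> disk N \<epsilon>"
      unfolding disk_def mem_Collect_eq n using \<epsilon> by simp
    then show ?thesis unfolding g_def n by (simp add: indicator_def)
  qed
  have "(\<integral>\<^sup>+y. ennreal (g (y /\<^sub>R \<epsilon>)) \<partial>?H) = (\<integral>\<^sup>+y. ennreal (g y) \<partial>distr ?H borel (\<lambda>y. y /\<^sub>R \<epsilon>))"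
    by (intro nn_integral_distr[symmetric]) (auto cong: measurable_cong_sets)
  also have "\<dots> = ennreal (\<epsilon> ^ d) * (\<integral>\<^sup>+y. ennreal (g y) \<partial>?H)"
    unfolding distr_hausdorff_scaleR[OF \<epsilon>] using g' by (intro nn_integral_scale_measure) auto
  finally have "(\<integral>y. g (y /\<^sub>R \<epsilon>) \<partial>?H) = \<epsilon> ^ d * (\<integral>y. g y \<partial>?H)"
    using g0 g' gs \<epsilon> by (simp add: integral_eq_nn_integral enn2real_mult)
  then show ?thesis by (simp only: eq) (simp add: g_def)
qed

text \<open>If the integral vanished, a punctured half disk would be null, hence the half disk,
  because points are null for positive \<open>d\<close>, hence by scaling every disk, contrary to
  \<open>hausdorff_outer_hyperplane_pos\<close>.\<close>

lemma integral_disk_pos: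
  fixes N :: "real^'n" and \<xi> :: "real \<Rightarrow> real"
  assumes n: "CARD('n) \<ge> 2" and N: "norm N = 1"
    and fin: "emeasure (hausdorff_measure (CARD('n) - 1)) (disk N 1) < \<infinity>"
    and \<xi>[measurable]: "\<xi> \<in> borel_measurable borel" and nn: "\<And>s. \<xi> s \<ge> 0" and bd: "\<And>s. \<xi> s \<le> b"
    and pos: "\<And>s. s \<in> {0<..<1} \<Longrightarrow> \<xi> s > 0"
  shows "(\<integral>y. indicator (disk N 1) y * \<xi> (norm y) \<partial>hausdorff_measure (CARD('n) - 1)) > 0"
    (is "?I > 0")
proof -
  let ?d = "CARD('n) - 1"
  let ?H = "hausdorff_measure ?d :: (real^'n) measure"
  have d: "?d > 0" using n by simp
  have "integrable ?H (\<lambda>y. indicator (disk N 1) y *\<^sub>R \<xi> (norm y))"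
    using fin nn bd by (intro integrableI_bounded_set_indicator[of _ _ _ b]) (auto cong: measurable_cong_sets)
  then have int: "integrable ?H (\<lambda>y. indicator (disk N 1) y * \<xi> (norm y))" by simp
  have "?I \<noteq> 0"
  proof
    assume "?I = 0"
    then have "AE y in ?H. indicator (disk N 1) y * \<xi> (norm y) = 0"
      using integral_nonneg_eq_0_iff_AE[OF int] nn by simp
    \<comment> \<open>The origin is removed because positivity of \<open>\<xi>\<close> is assumed on
      the open interval only.\<close>
    then have "AE y in ?H. y \<notin> disk N (1/2) - {0}"
    proof eventually_elim
      case (elim y)
      show ?case
      proof
        assume y: "y \<in> disk N (1/2) - {0}"
        then have "\<xi> (norm y) > 0" by (intro pos) (auto simp: disk_def)
        with elim y show False by (auto simp: disk_def indicator_def split: if_splits)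
      qed
    qed
    then have "emeasure ?H (disk N (1/2) - {0}) = 0"
      by (subst (asm) AE_iff_measurable[of "disk N (1/2) - {0}"]) auto
    then have "hausdorff_outer ?d (disk N (1/2) - {0}) = 0"
      by (simp add: emeasure_hausdorff_measure)
    moreover have "hausdorff_outer ?d (disk N (1/2)) \<le> hausdorff_outer ?d (disk N (1/2) - {0} \<union> {0})"
      by (rule hausdorff_outer_mono) auto
    moreover note hausdorff_outer_Un[of ?d "disk N (1/2) - {0}" "{0}"] hausdorff_outer_singleton[OF d, of "0 :: real^'n"]
    ultimately have "hausdorff_outer ?d (disk N (1/2)) = 0"
      by simp
    then have z: "emeasure ?H (disk N (1/2)) = 0" by (simp add: emeasure_hausdorff_measure)
    obtain R where R: "R > 0" "hausdorff_outer ?d (disk N R) > 0"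
      by (rule hausdorff_outer_hyperplane_pos[OF n N]) (simp add: disk_def)
    have "emeasure ?H (disk N (2 * R * (1/2))) = 0"
      using R z by (subst emeasure_disk_scale) auto
    then show False using R by (simp add: emeasure_hausdorff_measure)
  qed
  moreover have "?I \<ge> 0" using nn by (intro Bochner_Integration.integral_nonneg) auto
  ultimately show ?thesis by simp
qed

section \<open>Symmetries of the disk\<close>

lemma integral_hausdorff_involution:
  fixes s :: "'a::metric_space \<Rightarrow> 'a" and f :: "'a \<Rightarrow> 'b::{banach, second_countable_topology}"
  assumes iso: "\<And>x y. dist (s x) (s y) = dist x y" and inv: "\<And>x. s (s x) = x"
    and f: "f \<in> borel_measurable borel"
  shows "(\<integral>x. f (s x) \<partial>hausdorff_measure d) = (\<integral>x. f x \<partial>hausdorff_measure d)"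
proof -
  have "s \<in> borel_measurable borel"
    by (intro borel_measurable_continuous_onI) (unfold continuous_on_iff iso, blast)
  then have "s \<in> borel_measurable (hausdorff_measure d)" by (simp cong: measurable_cong_sets)
  from integral_distr[OF this f] show ?thesis
    by (simp add: distr_hausdorff_involution[OF iso inv])
qed

lemma integral_disk_odd:
  fixes N :: "'a::euclidean_space"
  assumes [measurable]: "w \<in> borel_measurable borel"
  shows "(\<integral>y. indicator (disk N \<epsilon>) y *\<^sub>R (w (norm y) *\<^sub>R y) \<partial>hausdorff_measure d) = 0"
proof -
  let ?f = "\<lambda>y. indicator (disk N \<epsilon>) y *\<^sub>R (w (norm y) *\<^sub>R y)"
  have [measurable]: "?f \<in> borel_measurable borel" by measurable
  have "(\<integral>y. ?f (- y) \<partial>hausdorff_measure d) = (\<integral>y. ?f y \<partial>hausdorff_measure d)"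
    using integral_hausdorff_involution[of uminus ?f d] by (simp add: dist_minus)
  moreover have "(\<integral>y. ?f (- y) \<partial>hausdorff_measure d) = (\<integral>y. - ?f y \<partial>hausdorff_measure d)"
    by (intro Bochner_Integration.integral_cong) (simp_all add: disk_def indicator_def)
  ultimately have "- (\<integral>y. ?f y \<partial>hausdorff_measure d) = (\<integral>y. ?f y \<partial>hausdorff_measure d)"
    by (simp only: Bochner_Integration.integral_minus)
  moreover have "v = 0" if "- v = v" for v :: 'a
    using arg_cong[OF that, of "\<lambda>z. z + v"] by (simp flip: scaleR_2)
  ultimately show ?thesis by blast
qed

text \<open>Dividing by \<open>e \<bullet> e\<close> admits vectors of any length, in particular the
  difference of two orthonormal vectors, whose reflection exchanges the two.\<close>

definition reflect :: "'a::real_inner \<Rightarrow> 'a \<Rightarrow> 'a" where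
  "reflect e y = y - (2 * (y \<bullet> e) / (e \<bullet> e)) *\<^sub>R e"

lemma reflect_isometry:
  assumes "e \<noteq> 0"
  shows "dist (reflect e x) (reflect e y) = dist x y" "reflect e (reflect e x) = x"
    "norm (reflect e x) = norm x"
proof -
  have n: "norm (reflect e x) = norm x" for x
  proof -
    have "reflect e x \<bullet> reflect e x = x \<bullet> x"
      using assms by (simp add: reflect_def inner_diff_left inner_diff_right inner_commute field_simps)
    then show ?thesis by (simp add: norm_eq_sqrt_inner)
  qed
  then show "norm (reflect e x) = norm x" .
  have "reflect e x - reflect e y = reflect e (x - y)"
    by (simp add: reflect_def algebra_simps inner_diff_left diff_divide_distrib)
  then show "dist (reflect e x) (reflect e y) = dist x y" using n by (simp add: dist_norm)
  show "reflect e (reflect e x) = x"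
    using assms by (simp add: reflect_def inner_diff_left algebra_simps)
qed

lemma integral_disk_reflect:
  fixes N :: "'a::euclidean_space" and f :: "'a \<Rightarrow> real"
  assumes e: "e \<noteq> 0" "N \<bullet> e = 0" and [measurable]: "f \<in> borel_measurable borel"
  shows "(\<integral>y. indicator (disk N \<epsilon>) y * f (reflect e y) \<partial>hausdorff_measure d)
       = (\<integral>y. indicator (disk N \<epsilon>) y * f y \<partial>hausdorff_measure d)"
proof -
  have "N \<bullet> reflect e y = N \<bullet> y" for y using e by (simp add: reflect_def inner_diff_right)
  then have "indicator (disk N \<epsilon>) (reflect e y) = (indicator (disk N \<epsilon>) y :: real)" for y
    using reflect_isometry(3)[OF e(1)] by (simp add: disk_def indicator_def)
  then show ?thesis
    using integral_hausdorff_involution[of "reflect e" "\<lambda>y. indicator (disk N \<epsilon>) y * f y" d] reflect_isometry[OF e(1)]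
    by simp
qed

lemma orthonormal_basis_hyperplane:
  fixes N :: "real^'n"
  assumes B: "orthonormal_basis {y. N \<bullet> y = 0} B" and N: "N \<noteq> 0"
  shows "finite B" "card B = CARD('n) - 1" "\<And>b. b \<in> B \<Longrightarrow> N \<bullet> b = 0"
    "\<And>b. b \<in> B \<Longrightarrow> b \<bullet> b = 1" "\<And>b c. b \<in> B \<Longrightarrow> c \<in> B \<Longrightarrow> b \<noteq> c \<Longrightarrow> b \<bullet> c = 0"
    "\<And>y. N \<bullet> y = 0 \<Longrightarrow> (\<Sum>b\<in>B. (y \<bullet> b) *\<^sub>R b) = y"
proof -
  have B': "pairwise orthogonal B" "\<And>b. b \<in> B \<Longrightarrow> norm b = 1" "span B = {y. N \<bullet> y = 0}"
    using B by (auto simp: orthonormal_basis_def)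
  have ind: "independent B"
    using B' by (intro pairwise_orthogonal_independent) (auto dest: B'(2))
  then show fin: "finite B" by (rule independent_imp_finite)
  have "card B = dim (span B)" using ind by (metis dim_span dim_eq_card_independent)
  then show "card B = CARD('n) - 1" using N by (simp add: B' dim_hyperplane)
  show "N \<bullet> b = 0" if "b \<in> B" for b using span_base[OF that] B'(3) by auto
  show "b \<bullet> b = 1" if "b \<in> B" for b using B'(2)[OF that] by (simp add: norm_eq_1)
  show "b \<bullet> c = 0" if "b \<in> B" "c \<in> B" "b \<noteq> c" for b c
    using B'(1) that by (auto simp: pairwise_def orthogonal_def)
  show "(\<Sum>b\<in>B. (y \<bullet> b) *\<^sub>R b) = y" if "N \<bullet> y = 0" for y
    using that B' fin by (intro orthonormal_basis_expand) auto
qed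

text \<open>Reflections in the coordinate hyperplanes kill the mixed second moments, and reflections
  exchanging two basis vectors equate the pure ones.\<close>

lemma integral_disk_quadratic:
  fixes N :: "real^'n" and w :: "real \<Rightarrow> real"
  assumes B: "orthonormal_basis {y. N \<bullet> y = 0} B" and N: "N \<noteq> 0" and n: "CARD('n) \<ge> 2"
    and w[measurable]: "w \<in> borel_measurable borel" and W: "\<And>t. \<bar>w t\<bar> \<le> W"
    and fin: "emeasure (hausdorff_measure d) (disk N \<epsilon>) < \<infinity>" and Q: "linear Q"
  shows "(\<integral>y. indicator (disk N \<epsilon>) y * (w (norm y) * (Q y \<bullet> y)) \<partial>hausdorff_measure d)
       = (\<Sum>b\<in>B. Q b \<bullet> b) / real (CARD('n) - 1) *
         (\<integral>y. indicator (disk N \<epsilon>) y * (w (norm y) * (norm y)\<^sup>2) \<partial>hausdorff_measure d)"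
proof -
  let ?H = "hausdorff_measure d :: (real^'n) measure"
  let ?i = "\<lambda>y. indicator (disk N \<epsilon>) y :: real"
  let ?q = "\<lambda>b c y. w (norm y) * ((y \<bullet> b) * (y \<bullet> c))"
  note ob = orthonormal_basis_hyperplane[OF B N]
  define J where "J b c = (\<integral>y. ?i y * ?q b c y \<partial>?H)" for b c
  have int: "integrable ?H (\<lambda>y. ?i y * ?q b c y)"
    if "b \<in> B" "c \<in> B" for b c
  proof -
    have nb: "norm b = 1" "norm c = 1" using ob(4) that by (simp_all add: norm_eq_1)
    have "\<bar>?q b c y\<bar> \<le> W * (\<epsilon> * \<epsilon>)" if "y \<in> disk N \<epsilon>" for y
    proof -
      have "\<bar>y \<bullet> b\<bar> \<le> \<epsilon>" "\<bar>y \<bullet> c\<bar> \<le> \<epsilon>"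
        using Cauchy_Schwarz_ineq2[of y b] Cauchy_Schwarz_ineq2[of y c] nb that by (auto simp: disk_def)
      then have "\<bar>y \<bullet> b\<bar> * \<bar>y \<bullet> c\<bar> \<le> \<epsilon> * \<epsilon>" by (intro mult_mono) auto
      then show ?thesis using W[of "norm y"] unfolding abs_mult
        by (intro mult_mono[of _ W]) (auto intro: order_trans[OF abs_ge_zero])
    qed
    then have "integrable ?H (\<lambda>y. ?i y *\<^sub>R ?q b c y)"
      using fin by (intro integrableI_bounded_set_indicator[of _ _ _ "W * (\<epsilon> * \<epsilon>)"]) (auto cong: measurable_cong_sets)
    then show ?thesis by simp
  qed
  have off: "J b c = 0" if bc: "b \<in> B" "c \<in> B" "b \<noteq> c" for b c
  proof -
    have b: "b \<noteq> 0" "N \<bullet> b = 0" "b \<bullet> b = 1" "b \<bullet> c = 0"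
      using ob(4)[OF bc(1)] ob(3)[OF bc(1)] ob(5)[OF bc] by auto
    have "J b c = (\<integral>y. ?i y * (w (norm (reflect b y)) * ((reflect b y \<bullet> b) * (reflect b y \<bullet> c))) \<partial>?H)"
      unfolding J_def using b by (subst integral_disk_reflect[where f="\<lambda>y. ?q b c y"]) auto
    also have "\<dots> = (\<integral>y. - (?i y * ?q b c y) \<partial>?H)"
      using b by (intro Bochner_Integration.integral_cong) (simp_all add: reflect_isometry(3), simp add: reflect_def inner_diff_left)
    also have "\<dots> = - J b c" by (simp add: J_def)
    finally show ?thesis by simp
  qed
  have diag: "J b b = J c c" if bc: "b \<in> B" "c \<in> B" for b c
  proof (cases "b = c")
    case False
    have b: "b - c \<noteq> 0" "N \<bullet> (b - c) = 0" "b \<bullet> b = 1" "c \<bullet> c = 1" "b \<bullet> c = 0" "c \<bullet> b = 0"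
      using ob(3)[OF bc(1)] ob(3)[OF bc(2)] ob(4)[OF bc(1)] ob(4)[OF bc(2)] ob(5)[OF bc False] False
      by (simp_all add: inner_diff_right inner_commute)
    then have "(b - c) \<bullet> (b - c) = 2" by (simp add: inner_diff_left inner_diff_right)
    then have "reflect (b - c) y = y - (y \<bullet> b - y \<bullet> c) *\<^sub>R (b - c)" for y
      by (simp add: reflect_def inner_diff_right)
    then have r: "reflect (b - c) y \<bullet> b = y \<bullet> c" for y
      using b by (simp add: inner_diff_left inner_diff_right)
    have "J b b = (\<integral>y. ?i y * (w (norm (reflect (b - c) y)) * ((reflect (b - c) y \<bullet> b) * (reflect (b - c) y \<bullet> b))) \<partial>?H)"
      unfolding J_def using b by (subst integral_disk_reflect[where f="\<lambda>y. w (norm y) * ((y \<bullet> b) * (y \<bullet> b))"]) auto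
    also have "\<dots> = J c c"
      unfolding J_def using b(1) by (simp add: reflect_isometry(3) r)
    finally show ?thesis .
  qed simp
  have card: "card B \<noteq> 0" using ob(2) n by simp
  then obtain b0 where b0: "b0 \<in> B" by (metis card.empty ex_in_conv)
  \<comment> \<open>Stated for an arbitrary linear map because it is used twice: for
    \<open>Q\<close>, and for the identity, whose trace \<open>card B\<close> evaluates the common
    second moment \<open>J b0 b0\<close>.\<close>
  have quad: "(\<integral>y. ?i y * (w (norm y) * (R y \<bullet> y)) \<partial>?H) = (\<Sum>b\<in>B. R b \<bullet> b) * J b0 b0"
    if R: "linear R" for R :: "real^'n \<Rightarrow> real^'n"
  proof -
    have exp: "R y \<bullet> y = (\<Sum>b\<in>B. \<Sum>c\<in>B. (R b \<bullet> c) * ((y \<bullet> b) * (y \<bullet> c)))" if "N \<bullet> y = 0" for y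
    proof -
      have y: "y = (\<Sum>b\<in>B. (y \<bullet> b) *\<^sub>R b)" using ob(6)[OF that] by simp
      have "R y \<bullet> y = R (\<Sum>b\<in>B. (y \<bullet> b) *\<^sub>R b) \<bullet> (\<Sum>c\<in>B. (y \<bullet> c) *\<^sub>R c)" by (simp flip: y)
      also have "\<dots> = (\<Sum>b\<in>B. \<Sum>c\<in>B. (R b \<bullet> c) * ((y \<bullet> b) * (y \<bullet> c)))"
        unfolding linear_sum[OF R] linear_scale[OF R] inner_sum_left inner_sum_right
        by (subst sum.swap) (simp add: mult_ac)
      finally show ?thesis .
    qed
    have "(\<integral>y. ?i y * (w (norm y) * (R y \<bullet> y)) \<partial>?H)
        = (\<integral>y. (\<Sum>b\<in>B. \<Sum>c\<in>B. (R b \<bullet> c) * (?i y * ?q b c y)) \<partial>?H)"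
    proof (intro Bochner_Integration.integral_cong refl)
      fix y
      show "?i y * (w (norm y) * (R y \<bullet> y)) = (\<Sum>b\<in>B. \<Sum>c\<in>B. (R b \<bullet> c) * (?i y * ?q b c y))"
      proof (cases "y \<in> disk N \<epsilon>")
        case True
        then have "N \<bullet> y = 0" by (simp add: disk_def)
        from exp[OF this] True show ?thesis by (simp add: sum_distrib_left mult_ac)
      qed simp
    qed
    also have "\<dots> = (\<Sum>b\<in>B. \<Sum>c\<in>B. (R b \<bullet> c) * J b c)"
      unfolding J_def using int by simp
    also have "\<dots> = (\<Sum>b\<in>B. (R b \<bullet> b) * J b0 b0)"
    proof (intro sum.cong refl)
      fix b assume b: "b \<in> B"
      have "(\<Sum>c\<in>B. (R b \<bullet> c) * J b c) = (\<Sum>c\<in>B. if c = b then (R b \<bullet> b) * J b0 b0 else 0)"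
        using b off diag[OF b b0] by (intro sum.cong) auto
      then show "(\<Sum>c\<in>B. (R b \<bullet> c) * J b c) = (R b \<bullet> b) * J b0 b0"
        using b ob(1) by simp
    qed
    finally show ?thesis by (simp add: sum_distrib_right)
  qed
  have "(\<integral>y. ?i y * (w (norm y) * (norm y)\<^sup>2) \<partial>?H) = real (card B) * J b0 b0"
    using quad[of "\<lambda>y. y"] ob(4) by (simp add: power2_norm_eq_inner linear_iff)
  then show ?thesis using quad[OF Q] ob(2) card by simp
qed

subsection \<open>Defining functions and mean curvature\<close>

lemma oproj_eqI:
  assumes S: "subspace S" and p: "p \<in> S" "v - p \<in> S\<^sup>\<bottom>"
  shows "oproj S v = p"
  unfolding oproj_def
proof (rule the_equality)
  fix q assume q: "q \<in> S \<and> v - q \<in> S\<^sup>\<bottom>"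
  have "p - q \<in> S" using S p q by (auto intro: subspace_diff)
  moreover have "(v - q) - (v - p) \<in> S\<^sup>\<bottom>"
    by (rule subspace_diff[OF subspace_orthogonal_comp]) (use p q in auto)
  ultimately have "orthogonal (p - q) (p - q)" by (auto simp: orthogonal_comp_def)
  then show "q = p" by (simp add: orthogonal_self)
qed (use p in auto)

lemma oproj_works:
  assumes "subspace S"
  shows "oproj S v \<in> S" "v - oproj S v \<in> S\<^sup>\<bottom>"
proof -
  obtain y z where yz: "y \<in> span S" "\<And>w. w \<in> span S \<Longrightarrow> orthogonal z w" "v = y + z"
    using orthogonal_subspace_decomp_exists by blast
  have "span S = S" using assms by (simp add: span_eq_iff)
  note yz = yz[unfolded this]
  have "y \<in> S" "v - y \<in> S\<^sup>\<bottom>"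
    using yz by (auto simp: orthogonal_comp_def orthogonal_commute)
  with oproj_eqI[OF assms this] show "oproj S v \<in> S" "v - oproj S v \<in> S\<^sup>\<bottom>" by simp_all
qed

lemma linear_oproj:
  assumes "subspace S"
  shows "linear (oproj S)"
proof (rule linearI)
  fix v w c
  note P = oproj_works[OF assms]
  have "(v + w) - (oproj S v + oproj S w) = (v - oproj S v) + (w - oproj S w)" by simp
  also have "\<dots> \<in> S\<^sup>\<bottom>" by (intro subspace_add subspace_orthogonal_comp P)
  finally show "oproj S (v + w) = oproj S v + oproj S w"
    by (intro oproj_eqI assms subspace_add P)
  have "c *\<^sub>R v - c *\<^sub>R oproj S v = c *\<^sub>R (v - oproj S v)" by (simp add: scaleR_diff_right)
  also have "\<dots> \<in> S\<^sup>\<bottom>" by (intro subspace_scale subspace_orthogonal_comp P)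
  finally show "oproj S (c *\<^sub>R v) = c *\<^sub>R oproj S v"
    by (intro oproj_eqI assms subspace_scale P)
qed

lemma oproj_orthogonal_comp:
  assumes "subspace S"
  shows "oproj (S\<^sup>\<bottom>) v = v - oproj S v"
  using oproj_works[OF assms, of v]
  by (intro oproj_eqI subspace_orthogonal_comp) (auto simp: orthogonal_comp_def orthogonal_commute)

lemma oproj_hyperplane:
  assumes "G \<noteq> 0"
  shows "oproj {v. G \<bullet> v = 0} v = v - (G \<bullet> v / (G \<bullet> G)) *\<^sub>R G"
    and "oproj ({v. G \<bullet> v = 0}\<^sup>\<bottom>) v = (G \<bullet> v / (G \<bullet> G)) *\<^sub>R G"
proof -
  show *: "oproj {v. G \<bullet> v = 0} v = v - (G \<bullet> v / (G \<bullet> G)) *\<^sub>R G"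
    using assms by (intro oproj_eqI subspace_hyperplane)
      (auto simp: inner_diff_right orthogonal_comp_def orthogonal_def inner_commute)
  show "oproj ({v. G \<bullet> v = 0}\<^sup>\<bottom>) v = (G \<bullet> v / (G \<bullet> G)) *\<^sub>R G"
    by (simp add: oproj_orthogonal_comp subspace_hyperplane *)
qed

lemma subspace_codim_1_hyperplane:
  fixes L :: "(real^'n) set"
  assumes "subspace L" "dim L = CARD('n) - 1"
  obtains a where "a \<noteq> 0" "L = {x. a \<bullet> x = 0}"
proof -
  have "dim L < DIM(real^'n)" using assms(2) by simp
  from orthogonal_to_subspace_exists[OF this]
  obtain a where a: "a \<noteq> 0" "\<And>y. y \<in> span L \<Longrightarrow> orthogonal a y" by metis
  have "L \<subseteq> {x. a \<bullet> x = 0}" using a(2) span_base by (fastforce simp: orthogonal_def)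
  then have "L = {x. a \<bullet> x = 0}"
    using assms a(1) by (intro subspace_dim_equal subspace_hyperplane) (simp_all add: dim_hyperplane)
  with a(1) show ?thesis by (rule that)
qed

text \<open>\<open>DG\<close> plays the Hessian of \<open>g\<close>. Third-order regularity is
  recorded as differentiability in \<open>x\<close> of \<open>DG x w\<close> for each fixed
  \<open>w\<close>; by the mean value inequality this suffices for a quadratic remainder of
  \<open>G\<close>.\<close>

definition defining_function ::
  "nat \<Rightarrow> (real^'n) set \<Rightarrow> (real^'n) set \<Rightarrow> (real^'n \<Rightarrow> real) \<Rightarrow> (real^'n \<Rightarrow> real^'n) \<Rightarrow> (real^'n \<Rightarrow> real^'n \<Rightarrow> real^'n) \<Rightarrow> bool" where
  "defining_function k M U g G DG \<longleftrightarrow>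
     open U \<and>
     (\<forall>x\<in>U. (g has_derivative (\<lambda>h. G x \<bullet> h)) (at x)) \<and>
     (\<forall>x\<in>U. x \<in> M \<longleftrightarrow> g x = 0) \<and>
     (\<forall>x\<in>U. G x \<noteq> 0) \<and>
     (\<forall>x\<in>U. (G has_derivative DG x) (at x)) \<and>
     (k = 3 \<longrightarrow> (\<forall>x\<in>U. \<forall>w. (\<lambda>x. DG x w) differentiable (at x))) \<and>
     (\<forall>x\<in>U. x \<in> M \<longrightarrow> tangent_space M x = {v. G x \<bullet> v = 0})"

lemma defining_functionD:
  assumes "defining_function k M U g G DG"
  shows "open U" "\<And>x. x \<in> U \<Longrightarrow> (g has_derivative (\<lambda>h. G x \<bullet> h)) (at x)"
    "\<And>x. x \<in> U \<Longrightarrow> x \<in> M \<longleftrightarrow> g x = 0" "\<And>x. x \<in> U \<Longrightarrow> G x \<noteq> 0"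
    "\<And>x. x \<in> U \<Longrightarrow> (G has_derivative DG x) (at x)"
    "\<And>x w. k = 3 \<Longrightarrow> x \<in> U \<Longrightarrow> (\<lambda>x. DG x w) differentiable (at x)"
    "\<And>x. x \<in> U \<Longrightarrow> x \<in> M \<Longrightarrow> tangent_space M x = {v. G x \<bullet> v = 0}"
  using assms unfolding defining_function_def by simp_all

text \<open>Composing the flattening diffeomorphism with the linear functional defining the hyperplane
  presents the submanifold as the zero set of a function with nonvanishing gradient.\<close>

lemma submanifold_defining_function:
  fixes M :: "(real^'n) set"
  assumes M: "submanifold k (CARD('n) - 1) M" and k: "k = 2 \<or> k = 3" and x0: "x0 \<in> M"
  obtains U g G DG where "defining_function k M U g G DG" "x0 \<in> U"
proof -
  obtain U W L \<phi> \<psi> where U: "x0 \<in> U" and L: "subspace L" "dim L = CARD('n) - 1"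
    and Ck: "Ck_diffeo k U (W :: (real^'n) set) \<phi> \<psi>" and im: "\<phi> ` (M \<inter> U) = W \<inter> L"
    using M x0 unfolding submanifold_def by metis
  have oU: "open U" and oW: "open W" and hom: "homeomorphism U W \<phi> \<psi>" and C\<phi>: "Ck_on k \<phi> U" and C\<psi>: "Ck_on k \<psi> W"
    using Ck by (auto simp: Ck_diffeo_def)
  have \<psi>\<phi>: "\<psi> (\<phi> x) = x" "\<phi> x \<in> W" if "x \<in> U" for x
    using hom that by (auto simp: homeomorphism_def)
  have \<phi>\<psi>: "\<phi> (\<psi> y) = y" "\<psi> y \<in> U" if "y \<in> W" for y
    using hom that by (auto simp: homeomorphism_def)
  define D1 where "D1 x = frechet_derivative \<phi> (at x)" for x
  define E1 where "E1 y = frechet_derivative \<psi> (at y)" for y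
  define D2 where "D2 b x = frechet_derivative (\<lambda>x. D1 x b) (at x)" for b x
  have dsc: "continuous_on S f" if "\<forall>x\<in>S. f differentiable (at x)" for S and f :: "real^'n \<Rightarrow> real^'n"
    using that by (meson continuous_at_imp_continuous_on differentiable_imp_continuous_within)
  have D1: "(\<phi> has_derivative D1 x) (at x)" if "x \<in> U" for x
    using C\<phi> k that unfolding D1_def
    by (auto simp: numeral_2_eq_2 numeral_3_eq_3 frechet_derivative_works)
  have E1: "(\<psi> has_derivative E1 y) (at y)" if "y \<in> W" for y
    using C\<psi> k that unfolding E1_def
    by (auto simp: numeral_2_eq_2 numeral_3_eq_3 frechet_derivative_works)
  have E1c: "continuous_on W (\<lambda>y. E1 y w)" for w
    using C\<psi> k unfolding E1_def by (intro dsc) (auto simp: numeral_2_eq_2 numeral_3_eq_3)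
  have D2: "((\<lambda>x. D1 x b) has_derivative D2 b x) (at x)" if "x \<in> U" for x b
    using C\<phi> k that unfolding D1_def D2_def
    by (auto simp: numeral_2_eq_2 numeral_3_eq_3 frechet_derivative_works)
  have D3: "(\<lambda>x. D2 b x w) differentiable (at x)" if "k = 3" "x \<in> U" for x b w
    using C\<phi> that unfolding D1_def D2_def by (auto simp: numeral_3_eq_3)
  obtain a where a: "a \<noteq> 0" "L = {x. a \<bullet> x = 0}"
    using subspace_codim_1_hyperplane[OF L] .
  define g where "g x = a \<bullet> \<phi> x" for x
  \<comment> \<open>The transpose of \<open>D1 x\<close> applied to \<open>a\<close>, written in
    coordinates.\<close>
  define G where "G x = (\<Sum>b\<in>Basis. (a \<bullet> D1 x b) *\<^sub>R b)" for x
  define DG where "DG x w = (\<Sum>b\<in>Basis. (a \<bullet> D2 b x w) *\<^sub>R b)" for x w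
  have G: "G x \<bullet> h = a \<bullet> D1 x h" if "x \<in> U" for x h
  proof -
    have lin: "linear (D1 x)" using D1[OF that] by (rule has_derivative_linear)
    have "G x \<bullet> h = (\<Sum>b\<in>Basis. (h \<bullet> b) * (a \<bullet> D1 x b))"
      unfolding G_def inner_sum_left by (simp add: inner_commute[of h] mult.commute)
    also have "\<dots> = a \<bullet> D1 x (\<Sum>b\<in>Basis. (h \<bullet> b) *\<^sub>R b)"
      by (simp add: linear_sum[OF lin] linear_scale[OF lin] inner_sum_right)
    finally show ?thesis by (simp add: euclidean_representation)
  qed
  have gd: "(g has_derivative (\<lambda>h. G x \<bullet> h)) (at x)" if "x \<in> U" for x
    unfolding g_def G[OF that] using D1[OF that] by (rule has_derivative_inner_right)
  have gM: "x \<in> M \<longleftrightarrow> g x = 0" if "x \<in> U" for x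
  proof
    assume "x \<in> M"
    then have "\<phi> x \<in> L" using im that by blast
    then show "g x = 0" using a by (simp add: g_def)
  next
    assume "g x = 0"
    then have "\<phi> x \<in> \<phi> ` (M \<inter> U)" using a im \<psi>\<phi>[OF that] by (simp add: g_def)
    then obtain m where "m \<in> M" "m \<in> U" "\<phi> x = \<phi> m" by blast
    moreover have "m = \<psi> (\<phi> x)" unfolding \<open>\<phi> x = \<phi> m\<close> by (rule \<psi>\<phi>(1)[OF \<open>m \<in> U\<close>, symmetric])
    ultimately show "x \<in> M" unfolding \<psi>\<phi>(1)[OF that] by blast
  qed
  have DGd: "(G has_derivative DG x) (at x)" if "x \<in> U" for x
    unfolding G_def DG_def
    by (intro has_derivative_sum has_derivative_scaleR_left has_derivative_inner_right D2 that)
  \<comment> \<open>Both compositions are the identity, so the differentials invert each other. In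
    particular \<open>D1 x\<close> is onto and the gradient cannot vanish.\<close>
  have id1: "E1 (\<phi> x) (D1 x v) = v" "D1 x (E1 (\<phi> x) v) = v" if x: "x \<in> U" for x v
  proof -
    have "(\<psi> \<circ> \<phi> has_derivative E1 (\<phi> x) \<circ> D1 x) (at x)"
      using D1[OF x] E1[OF \<psi>\<phi>(2)[OF x]] by (rule diff_chain_at)
    then have "((\<lambda>x. x) has_derivative E1 (\<phi> x) \<circ> D1 x) (at x)"
      by (rule has_derivative_transform_within_open[OF _ oU x]) (simp add: \<psi>\<phi>)
    from has_derivative_unique[OF this has_derivative_ident] show "E1 (\<phi> x) (D1 x v) = v"
      by (metis comp_apply)
    have "(\<phi> \<circ> \<psi> has_derivative D1 x \<circ> E1 (\<phi> x)) (at (\<phi> x))"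
      using E1[OF \<psi>\<phi>(2)[OF x]] D1[OF x] \<psi>\<phi>(1)[OF x] by (intro diff_chain_at) simp_all
    then have "((\<lambda>x. x) has_derivative D1 x \<circ> E1 (\<phi> x)) (at (\<phi> x))"
      by (rule has_derivative_transform_within_open[OF _ oW \<psi>\<phi>(2)[OF x]]) (simp add: \<phi>\<psi>)
    from has_derivative_unique[OF this has_derivative_ident] show "D1 x (E1 (\<phi> x) v) = v"
      by (metis comp_apply)
  qed
  have Gn: "G x \<noteq> 0" if x: "x \<in> U" for x
  proof
    assume "G x = 0"
    then have "a \<bullet> D1 x (E1 (\<phi> x) a) = 0" using G[OF x] by (metis inner_zero_left)
    then show False using id1[OF x] a by simp
  qed
  have DG3: "(\<lambda>x. DG x w) differentiable (at x)" if "k = 3" "x \<in> U" for w x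
  proof -
    have "((\<lambda>x. DG x w) has_derivative (\<lambda>h. \<Sum>b\<in>Basis. (a \<bullet> frechet_derivative (\<lambda>x. D2 b x w) (at x) h) *\<^sub>R b)) (at x)"
      unfolding DG_def
      using D3[OF that] by (intro has_derivative_sum has_derivative_scaleR_left has_derivative_inner_right)
        (simp add: frechet_derivative_works)
    then show ?thesis unfolding differentiable_def by blast
  qed
  \<comment> \<open>A curve in \<open>M\<close> stays in the zero set of \<open>g\<close>, so its
    velocity is orthogonal to the gradient. Conversely, \<open>\<psi>\<close> maps a straight
    segment in \<open>L\<close> to a curve in \<open>M\<close> with the prescribed velocity.\<close>
  have tan: "tangent_space M x = {v. G x \<bullet> v = 0}" if x: "x \<in> U" "x \<in> M" for x
  proof (intro subset_antisym subsetI)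
    fix v assume "v \<in> tangent_space M x"
    then obtain \<gamma> \<delta> where \<delta>: "\<delta> > 0" "\<gamma> ` {-\<delta><..<\<delta>} \<subseteq> M" "\<gamma> 0 = x"
      and \<gamma>: "(\<gamma> has_vector_derivative v) (at 0)"
      unfolding tangent_space_def by blast
    have "isCont \<gamma> 0" using \<gamma> by (rule has_vector_derivative_continuous)
    then have "\<forall>\<^sub>F t in at 0. \<gamma> t \<in> U"
      using topological_tendstoD[OF _ oU] \<delta>(3) x(1) by (auto simp: isCont_def)
    moreover have "\<forall>\<^sub>F t in at 0. t \<in> {-\<delta><..<\<delta>}"
      using \<delta>(1) by (intro eventually_at_in_open') auto
    ultimately have ev: "\<forall>\<^sub>F t in at 0. 0 = (g \<circ> \<gamma>) t"
      by eventually_elim (use \<delta>(2) gM in force)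
    have "(g \<circ> \<gamma> has_derivative (\<lambda>h. G x \<bullet> h) \<circ> (\<lambda>t. t *\<^sub>R v)) (at 0)"
      using \<gamma> gd[OF x(1)] \<delta>(3) by (intro diff_chain_at) (auto simp: has_vector_derivative_def)
    moreover have "(g \<circ> \<gamma> has_derivative (\<lambda>t. 0)) (at 0)"
      by (rule has_derivative_transform_eventually[OF has_derivative_const ev])
         (use \<delta>(3) gM x in auto)
    ultimately have "(\<lambda>h. G x \<bullet> h) \<circ> (\<lambda>t. t *\<^sub>R v) = (\<lambda>t. 0)"
      by (rule has_derivative_unique)
    then have "G x \<bullet> (1 *\<^sub>R v) = 0" by (metis comp_apply)
    then show "v \<in> {v. G x \<bullet> v = 0}" by simp
  next
    fix v assume "v \<in> {v. G x \<bullet> v = 0}"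
    then have aw: "a \<bullet> D1 x v = 0" using G[OF x(1)] by simp
    have ax: "a \<bullet> \<phi> x = 0" using gM[OF x(1)] x(2) by (simp add: g_def)
    define w where "w = D1 x v"
    define l where "l t = \<phi> x + t *\<^sub>R w" for t :: real
    have lc: "continuous_on UNIV l" unfolding l_def by (intro continuous_intros)
    have "open (l -` W)" using oW lc by (simp add: open_vimage)
    moreover have "0 \<in> l -` W" using \<psi>\<phi>[OF x(1)] by (simp add: l_def)
    ultimately obtain \<delta> where \<delta>: "\<delta> > 0" "ball 0 \<delta> \<subseteq> l -` W" by (meson openE)
    then have lW: "l t \<in> W" if "t \<in> {-\<delta><..<\<delta>}" for t
      using that by (auto simp: dist_real_def subset_iff)
    have ld: "(l has_vector_derivative w) (at t)" for t
      unfolding l_def by (auto intro!: derivative_eq_intros)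
    have \<gamma>: "(\<psi> \<circ> l has_vector_derivative E1 (l t) w) (at t)" if "t \<in> {-\<delta><..<\<delta>}" for t
    proof -
      have "(\<psi> \<circ> l has_derivative E1 (l t) \<circ> (\<lambda>s. s *\<^sub>R w)) (at t)"
        using ld[of t] E1[OF lW[OF that]] by (intro diff_chain_at) (auto simp: has_vector_derivative_def)
      moreover have "E1 (l t) \<circ> (\<lambda>s. s *\<^sub>R w) = (\<lambda>s. s *\<^sub>R E1 (l t) w)"
        using linear_scale[OF has_derivative_linear[OF E1[OF lW[OF that]]]] by auto
      ultimately show ?thesis by (simp add: has_vector_derivative_def)
    qed
    have "continuous_on {-\<delta><..<\<delta>} ((\<lambda>y. E1 y w) \<circ> l)"
      using lW by (intro continuous_on_compose continuous_on_subset[OF lc] continuous_on_subset[OF E1c]) auto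
    then have "\<psi> \<circ> l C1_differentiable_on {-\<delta><..<\<delta>}"
      unfolding C1_differentiable_on_def using \<gamma> by (intro exI[of _ "\<lambda>t. E1 (l t) w"]) (auto simp: o_def)
    moreover have "(\<psi> \<circ> l) ` {-\<delta><..<\<delta>} \<subseteq> M"
    proof clarsimp
      fix t assume "- \<delta> < t" "t < \<delta>"
      then have W: "l t \<in> W" by (simp add: lW)
      have "g (\<psi> (l t)) = 0"
        using \<phi>\<psi>[OF W] ax aw by (simp add: g_def l_def w_def inner_add_right)
      then show "\<psi> (l t) \<in> M" using gM \<phi>\<psi>[OF W] by simp
    qed
    moreover have "(\<psi> \<circ> l) 0 = x" using \<psi>\<phi>[OF x(1)] by (simp add: l_def)
    moreover have "(\<psi> \<circ> l has_vector_derivative v) (at 0)"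
      using \<gamma>[of 0] \<delta>(1) id1[OF x(1)] by (simp add: l_def w_def)
    ultimately show "v \<in> tangent_space M x"
      unfolding tangent_space_def using \<delta>(1) by blast
  qed
  show ?thesis
  proof (rule that[OF _ U])
    show "defining_function k M U g G DG"
      unfolding defining_function_def using oU gd gM Gn DGd DG3 tan by blast
  qed
qed

text \<open>The function \<open>Y \<bullet> G\<close> vanishes along \<open>M\<close> near
  \<open>x\<close>. Differentiating it along a curve with velocity \<open>v\<close> expresses the
  normal part of \<open>Y' v\<close> through \<open>DG v\<close>, independently of the field
  \<open>Y\<close>.\<close>

lemma second_fundamental_form_level_set:
  fixes M :: "(real^'n) set"
  assumes U: "open U" "x \<in> U" and x: "x \<in> M"
    and G: "(G has_derivative DG) (at x)" "G x \<noteq> 0"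
    and T: "\<And>y. y \<in> U \<Longrightarrow> y \<in> M \<Longrightarrow> tangent_space M y = {v. G y \<bullet> v = 0}"
    and v: "G x \<bullet> v = 0" and w: "G x \<bullet> w = 0"
  shows "second_fundamental_form M x v w = - ((w \<bullet> DG v) / (G x \<bullet> G x)) *\<^sub>R G x"
  unfolding second_fundamental_form_def
proof (rule the_equality)
  have cont: "(G \<longlongrightarrow> G x) (at x)"
    using has_derivative_continuous[OF G(1)] by (simp add: isCont_def)
  have Gx: "G x \<bullet> G x \<noteq> 0" using G(2) by simp
  have proj: "oproj ((tangent_space M x)\<^sup>\<bottom>) z = (G x \<bullet> z / (G x \<bullet> G x)) *\<^sub>R G x" for z
    by (simp add: T[OF U(2) x] oproj_hyperplane G(2))
  show "\<exists>Y Y'. (Y has_derivative Y') (at x) \<and> Y x = w \<and>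
        (\<forall>\<^sub>F y in at x within M. Y y \<in> tangent_space M y) \<and>
        - ((w \<bullet> DG v) / (G x \<bullet> G x)) *\<^sub>R G x = oproj ((tangent_space M x)\<^sup>\<bottom>) (Y' v)"
  proof -
    \<comment> \<open>The field \<open>w - c y *\<^sub>R G y\<close> projects the constant vector
      \<open>w\<close> onto the tangent spaces; at \<open>x\<close> it equals \<open>w\<close> since
      \<open>c x = 0\<close>.\<close>
    define c where "c y = (w \<bullet> G y) / (G y \<bullet> G y)" for y
    define c' where "c' h = (w \<bullet> DG h) / (G x \<bullet> G x)" for h
    have cx: "c x = 0" using w by (simp add: c_def inner_commute)
    have "(c has_derivative (\<lambda>h. ((w \<bullet> DG h) * (G x \<bullet> G x) - (w \<bullet> G x) * (G x \<bullet> DG h + DG h \<bullet> G x)) / ((G x \<bullet> G x) * (G x \<bullet> G x)))) (at x)"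
      unfolding c_def by (rule has_derivative_divide'[OF has_derivative_inner_right[OF G(1)] has_derivative_inner[OF G(1) G(1)] Gx])
    moreover have "(\<lambda>h. ((w \<bullet> DG h) * (G x \<bullet> G x) - (w \<bullet> G x) * (G x \<bullet> DG h + DG h \<bullet> G x)) / ((G x \<bullet> G x) * (G x \<bullet> G x))) = c'"
      using w Gx by (simp add: c'_def inner_commute fun_eq_iff)
    ultimately have c: "(c has_derivative c') (at x)" by simp
    have Y: "((\<lambda>y. w - c y *\<^sub>R G y) has_derivative (\<lambda>h. 0 - (c x *\<^sub>R DG h + c' h *\<^sub>R G x))) (at x)"
      by (intro has_derivative_diff has_derivative_const has_derivative_scaleR c G)
    have "\<forall>\<^sub>F y in at x. G y \<noteq> 0"
      using tendsto_imp_eventually_ne[OF cont G(2)] .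
    moreover have "\<forall>\<^sub>F y in at x. y \<in> U" using U by (rule eventually_at_in_open')
    ultimately have "\<forall>\<^sub>F y in at x. G y \<noteq> 0 \<and> y \<in> U" by eventually_elim auto
    then have "\<forall>\<^sub>F y in at x within M. (G y \<noteq> 0 \<and> y \<in> U) \<and> y \<in> M"
      by (auto simp: eventually_at_filter elim: eventually_mono)
    then have ev: "\<forall>\<^sub>F y in at x within M. w - c y *\<^sub>R G y \<in> tangent_space M y"
    proof eventually_elim
      case (elim y)
      then show ?case by (simp add: T inner_diff_right c_def inner_commute)
    qed
    show ?thesis
      using Y ev cx w Gx
      by (intro exI[of _ "\<lambda>y. w - c y *\<^sub>R G y"] exI[of _ "\<lambda>h. 0 - (c x *\<^sub>R DG h + c' h *\<^sub>R G x)"])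
         (simp add: proj c'_def)
  qed
  fix z
  assume "\<exists>Y Y'. (Y has_derivative Y') (at x) \<and> Y x = w \<and>
        (\<forall>\<^sub>F y in at x within M. Y y \<in> tangent_space M y) \<and>
        z = oproj ((tangent_space M x)\<^sup>\<bottom>) (Y' v)"
  then obtain Y Y' where Y: "(Y has_derivative Y') (at x)" "Y x = w"
      and ev: "\<forall>\<^sub>F y in at x within M. Y y \<in> tangent_space M y"
      and z: "z = oproj ((tangent_space M x)\<^sup>\<bottom>) (Y' v)" by blast
  have "v \<in> tangent_space M x" using v T[OF U(2) x] by simp
  then obtain \<gamma> \<delta> where \<delta>: "\<delta> > 0" "\<gamma> ` {-\<delta><..<\<delta>} \<subseteq> M" "\<gamma> 0 = x"
    and \<gamma>: "(\<gamma> has_vector_derivative v) (at 0)"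
    unfolding tangent_space_def by blast
  define f where "f y = Y y \<bullet> G y" for y
  have f: "(f has_derivative (\<lambda>h. Y x \<bullet> DG h + Y' h \<bullet> G x)) (at x)"
    unfolding f_def by (rule has_derivative_inner[OF Y(1) G(1)])
  have "(f \<circ> \<gamma> has_derivative (\<lambda>h. Y x \<bullet> DG h + Y' h \<bullet> G x) \<circ> (\<lambda>t. t *\<^sub>R v)) (at 0)"
    using \<gamma> f \<delta>(3) by (intro diff_chain_at) (auto simp: has_vector_derivative_def)
  moreover have "(f \<circ> \<gamma> has_derivative (\<lambda>t. 0)) (at 0)"
  proof -
    have "\<forall>\<^sub>F y in at x within M. y \<in> U"
      using eventually_at_in_open'[OF U] by (rule filter_leD[OF at_le, rotated]) simp
    with ev have "\<forall>\<^sub>F y in at x within M. y \<in> M \<longrightarrow> f y = 0"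
      by eventually_elim (auto simp: f_def T inner_commute)
    \<comment> \<open>The curve may return to \<open>x\<close>, which the punctured filter excludes.
      At \<open>x\<close> itself \<open>f\<close> vanishes because \<open>w\<close> is
      tangent.\<close>
    then have "\<forall>\<^sub>F y in nhds x. y \<in> M \<longrightarrow> f y = 0"
      unfolding eventually_at_filter
      by eventually_elim (use Y(2) w in \<open>auto simp: f_def inner_commute\<close>)
    moreover have "(\<gamma> \<longlongrightarrow> x) (at 0)"
      using has_vector_derivative_continuous[OF \<gamma>] \<delta>(3) by (simp add: isCont_def)
    ultimately have "\<forall>\<^sub>F t in at 0. \<gamma> t \<in> M \<longrightarrow> f (\<gamma> t) = 0"
      by (rule eventually_compose_filterlim)
    moreover have "\<forall>\<^sub>F t in at 0. t \<in> {-\<delta><..<\<delta>}"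
      using \<delta>(1) by (intro eventually_at_in_open') auto
    ultimately have "\<forall>\<^sub>F t in at 0. 0 = (f \<circ> \<gamma>) t"
      by eventually_elim (use \<delta>(2) in \<open>auto simp: image_subset_iff\<close>)
    then show ?thesis
      by (rule has_derivative_transform_eventually[OF has_derivative_const])
         (use \<delta>(3) Y(2) w in \<open>auto simp: f_def inner_commute\<close>)
  qed
  ultimately have "(\<lambda>h. Y x \<bullet> DG h + Y' h \<bullet> G x) \<circ> (\<lambda>t. t *\<^sub>R v) = (\<lambda>t. 0)"
    by (rule has_derivative_unique)
  then have "Y x \<bullet> DG (1 *\<^sub>R v) + Y' (1 *\<^sub>R v) \<bullet> G x = 0" by (metis comp_apply)
  then have "G x \<bullet> Y' v = - (w \<bullet> DG v)" using Y(2) by (simp add: inner_commute)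
  then show "z = - ((w \<bullet> DG v) / (G x \<bullet> G x)) *\<^sub>R G x" by (simp add: z proj)
qed

text \<open>The basis returned is the very one selected by \<open>trace_on\<close>, so the trace
  occurring in the estimates below is literally the one in \<open>mean_curvature\<close>.\<close>

lemma mean_curvature_level_set:
  fixes M :: "(real^'n) set"
  assumes U: "open U" "x \<in> U" and x: "x \<in> M"
    and G: "(G has_derivative DG) (at x)" "G x \<noteq> 0"
    and T: "\<And>y. y \<in> U \<Longrightarrow> y \<in> M \<Longrightarrow> tangent_space M y = {v. G y \<bullet> v = 0}"
  obtains B where "orthonormal_basis {v. G x \<bullet> v = 0} B"
    "mean_curvature M x = - ((\<Sum>b\<in>B. DG b \<bullet> b) / (G x \<bullet> G x)) *\<^sub>R G x"
proof -
  define B where "B = (SOME B. orthonormal_basis {v. G x \<bullet> v = 0} B)"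
  have "\<exists>B. orthonormal_basis {v. G x \<bullet> v = 0} B"
    using orthonormal_basis_subspace[OF subspace_hyperplane[of "G x"]] unfolding orthonormal_basis_def by metis
  then have B: "orthonormal_basis {v. G x \<bullet> v = 0} B" unfolding B_def by (rule someI_ex)
  have "mean_curvature M x = (\<Sum>b\<in>B. second_fundamental_form M x b b)"
    by (simp add: mean_curvature_def trace_on_def T[OF U(2) x] B_def)
  also have "\<dots> = (\<Sum>b\<in>B. - ((b \<bullet> DG b) / (G x \<bullet> G x)) *\<^sub>R G x)"
    using orthonormal_basis_hyperplane(3)[OF B G(2)]
    by (intro sum.cong refl second_fundamental_form_level_set[OF U x G T]) auto
  also have "\<dots> = - ((\<Sum>b\<in>B. DG b \<bullet> b) / (G x \<bullet> G x)) *\<^sub>R G x"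
    by (simp add: sum_negf sum_divide_distrib scaleR_sum_left inner_commute)
  finally show ?thesis using B that by blast
qed

subsection \<open>Comparison with the tangent plane\<close>

text \<open>\<open>Q\<close> stands for the derivative of \<open>G\<close> at \<open>x0\<close>; how well it approximates \<open>G\<close> only enters through
  \<open>linear_error\<close>, so that one estimate serves both regularity classes.\<close>

locale hypersurface_chart =
  fixes M :: "(real^'n) set" and x0 :: "real^'n" and g :: "real^'n \<Rightarrow> real"
    and G Q :: "real^'n \<Rightarrow> real^'n" and r K :: real
  assumes r: "r > 0" and K: "K \<ge> 0" "K * r \<le> 1/4" and x0: "x0 \<in> M"
    and g: "\<And>x. x \<in> cball x0 r \<Longrightarrow> (g has_derivative (\<lambda>h. G x \<bullet> h)) (at x)"
    and M_iff: "\<And>x. x \<in> cball x0 r \<Longrightarrow> x \<in> M \<longleftrightarrow> g x = 0"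
    and N1: "norm (G x0) = 1"
    and G_lip: "\<And>x. x \<in> cball x0 r \<Longrightarrow> norm (G x - G x0) \<le> K * norm (x - x0)"
    and Q: "linear Q" "\<And>h. norm (Q h) \<le> K * norm h"
    and tangent: "\<And>x. x \<in> cball x0 r \<Longrightarrow> x \<in> M \<Longrightarrow> tangent_space M x = {v. G x \<bullet> v = 0}"
begin

abbreviation N :: "real^'n" where "N \<equiv> G x0"

text \<open>Normalised by \<open>s\<close>, so that \<open>\<eta>\<close> can be a fixed small
  number for class 2 and a multiple of \<open>s\<close> for class 3. The ball of radius
  \<open>2 * s\<close> is the one that contains \<open>piece s\<close>.\<close>

abbreviation linear_error :: "real \<Rightarrow> real \<Rightarrow> bool" where
  "linear_error s \<eta> \<equiv> \<forall>z\<in>cball x0 (2 * s). norm (G z - N - Q (z - x0)) \<le> \<eta> * s"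

abbreviation model :: "real \<Rightarrow> real^'n \<Rightarrow> real^'n" where
  "model a y \<equiv> a *\<^sub>R y - (Q y \<bullet> y) *\<^sub>R N"

text \<open>The worst of the projectors is minus twice the one onto the normal line at
  \<open>x\<close>. Its estimate produces \<open>8 * \<eta> + 24 * \<eta> * (K * s)\<close>, where
  \<open>K * s \<le> 1/8\<close>, and \<open>16 + 9\<close> multiples of
  \<open>K\<^sup>2 * s\<close>.\<close>

abbreviation model_error :: "real \<Rightarrow> real \<Rightarrow> real" where
  "model_error s \<eta> \<equiv> (11 * \<eta> + 25 * K\<^sup>2 * s) * s\<^sup>2"

definition pr :: "real^'n \<Rightarrow> real^'n" where
  "pr x = (x - x0) - (N \<bullet> (x - x0)) *\<^sub>R N"

text \<open>Bounding the projection by \<open>\<epsilon>\<close> makes the image exactly a disk, and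
  the ball of radius \<open>2 * \<epsilon>\<close> keeps the set inside the chart, where
  \<open>pr\<close> is injective. A point of \<open>M\<close> outside the piece is farther than
  \<open>\<epsilon>\<close> from \<open>x0\<close>, where both kernels vanish.\<close>

definition piece :: "real \<Rightarrow> (real^'n) set" where
  "piece \<epsilon> = {x \<in> M. norm (x - x0) \<le> 2 * \<epsilon> \<and> norm (pr x) \<le> \<epsilon>}"

section \<open>A small piece of M as a nearly isometric graph over a disk\<close>

lemma NN: "N \<bullet> N = 1" using N1 by (simp add: norm_eq_1)

lemma N_pr: "N \<bullet> pr x = 0" by (simp add: pr_def inner_diff_right NN)

lemma pr_diff: "pr x - pr y = (x - y) - (N \<bullet> (x - y)) *\<^sub>R N"
  by (simp add: pr_def inner_diff_right algebra_simps)

lemma norm_pr_diff: "(norm (x - y))\<^sup>2 = (norm (pr x - pr y))\<^sup>2 + (N \<bullet> (x - y))\<^sup>2"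
  unfolding pr_diff power2_norm_eq_inner
  by (simp add: inner_diff_left inner_diff_right NN inner_commute power2_eq_square algebra_simps)

lemma norm_pr_diff_le: "norm (pr x - pr y) \<le> norm (x - y)"
proof (rule power2_le_imp_le)
  show "(norm (pr x - pr y))\<^sup>2 \<le> (norm (x - y))\<^sup>2"
    unfolding norm_pr_diff[of x y] by (rule le_add_same_cancel1[THEN iffD2, OF zero_le_power2])
qed (rule norm_ge_zero)

lemma pr_x0: "pr x0 = 0" by (simp add: pr_def)

lemma norm_pr_le: "norm (pr x) \<le> norm (x - x0)"
  using norm_pr_diff_le[of x x0] by (simp add: pr_x0)

lemma Ke: "2 * \<epsilon> \<le> r \<Longrightarrow> K * \<epsilon> \<le> 1/8"
  using K mult_left_mono[of "2 * \<epsilon>" r K] by linarith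

text \<open>After subtraction of its linear part, \<open>g\<close> has gradient
  \<open>G z - N\<close>, of norm at most \<open>K * s\<close> on the ball; the mean value
  inequality does the rest.\<close>

lemma g_linear:
  assumes "s \<le> r" "x \<in> cball x0 s" "y \<in> cball x0 s"
  shows "\<bar>g x - g y - N \<bullet> (x - y)\<bar> \<le> K * s * norm (x - y)"
proof -
  have "norm ((g x - N \<bullet> x) - (g y - N \<bullet> y)) \<le> K * s * norm (x - y)"
  proof (rule differentiable_bound[where S="cball x0 s" and f'="\<lambda>z h. G z \<bullet> h - N \<bullet> h"])
    fix z assume z: "z \<in> cball x0 s"
    then have zr: "z \<in> cball x0 r" using assms by auto
    show "((\<lambda>z. g z - N \<bullet> z) has_derivative (\<lambda>h. G z \<bullet> h - N \<bullet> h)) (at z within cball x0 s)"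
      by (intro has_derivative_diff has_derivative_at_withinI[OF g[OF zr]] has_derivative_inner_right has_derivative_ident)
    show "onorm (\<lambda>h. G z \<bullet> h - N \<bullet> h) \<le> K * s"
    proof (rule onorm_bound)
      show "0 \<le> K * s" using K z by (intro mult_nonneg_nonneg) (auto intro: order_trans[OF zero_le_dist])
      fix h
      have "norm (G z \<bullet> h - N \<bullet> h) \<le> norm (G z - N) * norm h"
        by (metis Cauchy_Schwarz_ineq2 inner_diff_left real_norm_def)
      also have "\<dots> \<le> (K * norm (z - x0)) * norm h"
        using G_lip[OF zr] by (rule mult_right_mono) simp
      also have "\<dots> \<le> (K * s) * norm h"
        using z K by (intro mult_right_mono mult_left_mono) (auto simp: dist_norm norm_minus_commute)
      finally show "norm (G z \<bullet> h - N \<bullet> h) \<le> K * s * norm h" .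
    qed
  qed (use assms in auto)
  then show ?thesis by (simp add: inner_diff_right algebra_simps)
qed

lemma M_flat:
  assumes "s \<le> r" "x \<in> cball x0 s" "y \<in> cball x0 s" "x \<in> M" "y \<in> M"
  shows "\<bar>N \<bullet> (x - y)\<bar> \<le> K * s * norm (x - y)"
proof -
  have "x \<in> cball x0 r" "y \<in> cball x0 r" using assms by auto
  then have "g x = 0" "g y = 0" using assms M_iff by auto
  then show ?thesis using g_linear[OF assms(1-3)] by simp
qed

text \<open>On the normal line over \<open>y\<close>, \<open>g\<close> differs from the height
  \<open>t\<close> by at most \<open>s\<close>, so it has a zero between the heights
  \<open>-s\<close> and \<open>s\<close>.\<close>

lemma pr_surj:
  assumes s: "s > 0" "2 * s \<le> r" and y: "N \<bullet> y = 0" "norm y \<le> s"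
  obtains x where "x \<in> piece s" "pr x = y"
proof -
  define l where "l t = x0 + y + t *\<^sub>R N" for t
  have ln: "norm (l t - x0) \<le> 2 * s" if "\<bar>t\<bar> \<le> s" for t
  proof -
    have "norm (y + t *\<^sub>R N) \<le> norm y + norm (t *\<^sub>R N)" by (rule norm_triangle_ineq)
    then show ?thesis using that y N1 by (simp add: l_def algebra_simps)
  qed
  then have lc: "l t \<in> cball x0 (2 * s)" if "\<bar>t\<bar> \<le> s" for t
    using that by (simp add: dist_norm norm_minus_commute)
  then have lr: "l t \<in> cball x0 r" if "\<bar>t\<bar> \<le> s" for t using that s by fastforce
  have g0: "g x0 = 0" using M_iff[of x0] x0 r by simp
  have gl: "\<bar>g (l t) - t\<bar> \<le> s" if t: "\<bar>t\<bar> \<le> s" for t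
  proof -
    have "N \<bullet> (l t - x0) = t" using y by (simp add: l_def inner_add_right NN)
    then have "\<bar>g (l t) - t\<bar> \<le> K * (2 * s) * norm (l t - x0)"
      using g_linear[of "2 * s" "l t" x0] lc[OF t] s g0 by simp
    also have "\<dots> \<le> K * (2 * s) * (2 * s)"
      using K s ln[OF t] by (intro mult_left_mono) auto
    also have "\<dots> = (4 * (K * s)) * s" by simp
    also have "\<dots> \<le> 1 * s" using Ke[OF s(2)] s by (intro mult_right_mono) auto
    finally show ?thesis by simp
  qed
  have "continuous_on {-s..s} (\<lambda>t. g (l t))"
  proof (rule continuous_on_compose2[where g=g and t="cball x0 r"])
    show "continuous_on (cball x0 r) g"
      by (intro continuous_at_imp_continuous_on ballI has_derivative_continuous[OF g])
    show "continuous_on {-s..s} l" unfolding l_def by (intro continuous_intros)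
  qed (use lr in auto)
  moreover have "g (l (-s)) \<le> 0" "0 \<le> g (l s)" using gl[of s] gl[of "-s"] s by (auto simp: abs_le_iff)
  ultimately obtain t where t: "-s \<le> t" "t \<le> s" "g (l t) = 0"
    using IVT'[of "\<lambda>t. g (l t)" "-s" 0 s] s by auto
  then have ts: "\<bar>t\<bar> \<le> s" by auto
  have "pr (l t) = y" using y by (simp add: pr_def l_def inner_add_right NN)
  moreover have "l t \<in> M" using M_iff[OF lr[OF ts]] t by simp
  ultimately show ?thesis using ln[OF ts] y by (intro that[of "l t"]) (auto simp: piece_def)
qed

lemma pr_image_piece:
  assumes "s > 0" "2 * s \<le> r"
  shows "pr ` piece s = disk N s"
proof (intro subset_antisym subsetI)
  fix y assume "y \<in> disk N s"
  then obtain x where "x \<in> piece s" "pr x = y"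
    using pr_surj[OF assms, of y] by (auto simp: disk_def)
  then show "y \<in> pr ` piece s" by auto
qed (auto simp: piece_def disk_def N_pr)

lemma piece_cball: "x \<in> piece s \<Longrightarrow> x \<in> cball x0 (2 * s)"
  by (simp add: piece_def dist_norm norm_minus_commute)

text \<open>Chords of \<open>M\<close> are tangent up to a factor of order \<open>K * s\<close>.
  Pythagoras squares this factor, so the distortion of lengths is of second order.\<close>

lemma piece_lipschitz:
  assumes s: "s > 0" "2 * s \<le> r" and x: "x \<in> piece s" "y \<in> piece s"
  shows "\<bar>N \<bullet> (x - y)\<bar> \<le> 2 * K * s * norm (x - y)"
    and "norm (x - y) \<le> (1 + 8 * (K * s)\<^sup>2) * norm (pr x - pr y)"
proof -
  show *: "\<bar>N \<bullet> (x - y)\<bar> \<le> 2 * K * s * norm (x - y)"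
    using M_flat[OF s(2) piece_cball[OF x(1)] piece_cball[OF x(2)]] x by (simp add: piece_def mult_ac)
  define \<kappa> where "\<kappa> = 2 * K * s"
  define t where "t = \<kappa>\<^sup>2"
  have \<kappa>: "0 \<le> \<kappa>" "\<kappa> \<le> 1/4" using K s Ke[OF s(2)] by (auto simp: \<kappa>_def)
  have t: "0 \<le> t" "t \<le> 1/16"
    using power_mono[OF \<kappa>(2) \<kappa>(1), of 2] by (auto simp: t_def power2_eq_square)
  have "\<bar>N \<bullet> (x - y)\<bar> \<le> \<bar>\<kappa> * norm (x - y)\<bar>"
    using *[folded \<kappa>_def] \<kappa>(1) by (simp add: abs_mult)
  then have "(N \<bullet> (x - y))\<^sup>2 \<le> (\<kappa> * norm (x - y))\<^sup>2"
    by (rule abs_le_square_iff[THEN iffD1])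
  then have "(1 - t) * (norm (x - y))\<^sup>2 \<le> (norm (pr x - pr y))\<^sup>2"
    using norm_pr_diff[of x y] by (simp add: t_def power_mult_distrib algebra_simps)
  \<comment> \<open>The inequality \<open>1 / sqrt (1 - t) \<le> 1 + 2 * t\<close> freed of its root
    and denominator.\<close>
  moreover have "1 \<le> (1 + 2 * t)\<^sup>2 * (1 - t)"
  proof -
    have "t * t \<le> (1/16) * (1/16)" using t by (intro mult_mono) auto
    then have "0 \<le> t * (3 - 4 * (t * t))" using t by (intro mult_nonneg_nonneg) auto
    moreover have "(1 + 2 * t)\<^sup>2 * (1 - t) - 1 = t * (3 - 4 * (t * t))"
      by (simp add: power2_eq_square algebra_simps)
    ultimately show ?thesis by linarith
  qed
  then have "1 * (norm (x - y))\<^sup>2 \<le> ((1 + 2 * t)\<^sup>2 * (1 - t)) * (norm (x - y))\<^sup>2"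
    by (rule mult_right_mono) simp
  ultimately have "(norm (x - y))\<^sup>2 \<le> (1 + 2 * t)\<^sup>2 * (norm (pr x - pr y))\<^sup>2"
    using mult_left_mono[of "(1 - t) * (norm (x - y))\<^sup>2" "(norm (pr x - pr y))\<^sup>2" "(1 + 2 * t)\<^sup>2"]
    by (simp add: mult.assoc)
  then have "(norm (x - y))\<^sup>2 \<le> ((1 + 2 * t) * norm (pr x - pr y))\<^sup>2"
    by (simp add: power_mult_distrib)
  then have "norm (x - y) \<le> (1 + 2 * t) * norm (pr x - pr y)"
    by (rule power2_le_imp_le) (use t in simp)
  moreover have "1 + 2 * t = 1 + 8 * (K * s)\<^sup>2"
    by (simp add: t_def \<kappa>_def power_mult_distrib)
  ultimately show "norm (x - y) \<le> (1 + 8 * (K * s)\<^sup>2) * norm (pr x - pr y)" by simp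
qed

lemma x0_piece: "s > 0 \<Longrightarrow> x0 \<in> piece s"
  using x0 by (simp add: piece_def pr_x0)

lemma piece_radial:
  assumes s: "s > 0" "2 * s \<le> r" and x: "x \<in> piece s"
  shows "norm (x - x0) - norm (pr x) \<le> 8 * (K * s)\<^sup>2 * norm (pr x)"
  using piece_lipschitz(2)[OF s x x0_piece[OF s(1)]] by (simp add: pr_x0 algebra_simps)

text \<open>Working along the segment from \<open>x0\<close> avoids having to know that \<open>Q\<close> is symmetric.\<close>

lemma g_taylor:
  assumes s: "s \<le> r" and R: "\<And>z. z \<in> cball x0 s \<Longrightarrow> norm (G z - N - Q (z - x0)) \<le> e"
    and x: "x \<in> cball x0 s" "x \<in> M"
  shows "\<bar>N \<bullet> (x - x0) + Q (x - x0) \<bullet> (x - x0) / 2\<bar> \<le> e * norm (x - x0)"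
proof -
  define h where "h = x - x0"
  define f where "f t = g (x0 + t *\<^sub>R h) - t * (N \<bullet> h) - t\<^sup>2 * (Q h \<bullet> h / 2)" for t
  let ?R = "\<lambda>t. G (x0 + t *\<^sub>R h) - N - Q (t *\<^sub>R h)"
  have z: "x0 + t *\<^sub>R h \<in> cball x0 s" if "t \<in> {0..1}" for t
  proof -
    have "norm (t *\<^sub>R h) \<le> 1 * norm h" using that by (simp add: mult_left_le_one_le)
    also have "\<dots> \<le> s" using x by (simp add: h_def dist_norm norm_minus_commute)
    finally show ?thesis by (simp add: dist_norm)
  qed
  have "norm (f 1 - f 0) \<le> (e * norm h) * norm (1 - 0 :: real)"
  proof (rule differentiable_bound[where S="{0..1}" and f'="\<lambda>t u. u * (?R t \<bullet> h)"])
    fix t :: real assume t: "t \<in> {0..1}"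
    have zr: "x0 + t *\<^sub>R h \<in> cball x0 r" using z[OF t] s by auto
    have d1: "((\<lambda>t. g (x0 + t *\<^sub>R h)) has_derivative (\<lambda>u. G (x0 + t *\<^sub>R h) \<bullet> (u *\<^sub>R h))) (at t within {0..1})"
      by (rule has_derivative_compose[of "\<lambda>t. x0 + t *\<^sub>R h" "\<lambda>u. u *\<^sub>R h" t "{0..1}" g "\<lambda>v. G (x0 + t *\<^sub>R h) \<bullet> v"])
         (auto intro!: derivative_eq_intros g[OF zr])
    have d2: "((\<lambda>t. t * (N \<bullet> h)) has_derivative (\<lambda>u. u * (N \<bullet> h))) (at t within {0..1})"
      by (rule has_derivative_mult_left[OF has_derivative_ident])
    have "((\<lambda>t::real. t\<^sup>2) has_derivative (\<lambda>u. 2 * t * u)) (at t within {0..1})"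
      by (auto intro!: derivative_eq_intros)
    then have d3: "((\<lambda>t. t\<^sup>2 * (Q h \<bullet> h / 2)) has_derivative (\<lambda>u. 2 * t * u * (Q h \<bullet> h / 2))) (at t within {0..1})"
      by (rule has_derivative_mult_left)
    have "(\<lambda>u. u * (?R t \<bullet> h)) =
        (\<lambda>u. G (x0 + t *\<^sub>R h) \<bullet> (u *\<^sub>R h) - u * (N \<bullet> h) - 2 * t * u * (Q h \<bullet> h / 2))"
      by (simp add: fun_eq_iff linear_scale[OF Q(1)] inner_diff_left right_diff_distrib)
    then show "(f has_derivative (\<lambda>u. u * (?R t \<bullet> h))) (at t within {0..1})"
      unfolding f_def using has_derivative_diff[OF has_derivative_diff[OF d1 d2] d3] by simp
    have "norm (u * (?R t \<bullet> h)) \<le> (e * norm h) * norm u" for u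
    proof -
      have "\<bar>?R t \<bullet> h\<bar> \<le> norm (?R t) * norm h"
        by (rule Cauchy_Schwarz_ineq2)
      also have "\<dots> \<le> e * norm h" using R[OF z[OF t]] by (intro mult_right_mono) auto
      finally show ?thesis by (simp add: abs_mult mult.commute mult_left_mono)
    qed
    moreover have "0 \<le> e" using R[OF z[OF t]] norm_ge_zero order_trans by blast
    ultimately show "onorm (\<lambda>u. u * (?R t \<bullet> h)) \<le> e * norm h"
      by (intro onorm_bound) auto
  qed auto
  moreover have "x \<in> cball x0 r" using x s by auto
  then have "g x = 0" "g x0 = 0" using M_iff[of x] M_iff[of x0] x x0 r by auto
  then have "f 1 - f 0 = - (N \<bullet> h + Q h \<bullet> h / 2)" by (simp add: f_def h_def)
  ultimately show ?thesis by (simp add: h_def)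
qed

section \<open>Second-order expansion of the projectors\<close>

lemma quadratic_piece:
  assumes s: "s > 0" "2 * s \<le> r" and x: "x \<in> piece s"
  shows "\<bar>Q (x - x0) \<bullet> (x - x0) - Q (pr x) \<bullet> pr x\<bar> \<le> 16 * K\<^sup>2 * s ^ 3"
proof -
  define h where "h = x - x0"
  define y where "y = pr x"
  have h: "norm h \<le> 2 * s" and y: "norm y \<le> s"
    using x by (auto simp: h_def y_def piece_def)
  have hy: "norm (h - y) \<le> 2 * K * s * norm h"
  proof -
    have "h - y = (N \<bullet> h) *\<^sub>R N" by (simp add: h_def y_def pr_def)
    then show ?thesis using piece_lipschitz(1)[OF s x x0_piece[OF s(1)]] N1 by (simp add: h_def)
  qed
  also have "\<dots> \<le> 2 * K * s * (2 * s)" using h K s by (intro mult_left_mono) auto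
  finally have hy: "norm (h - y) \<le> 4 * K * s\<^sup>2" by (simp add: power2_eq_square)
  have Qb: "\<bar>Q v \<bullet> w\<bar> \<le> K * norm v * norm w" for v w
    using Cauchy_Schwarz_ineq2[of "Q v" w] Q(2)[of v] mult_right_mono[of "norm (Q v)" "K * norm v" "norm w"]
    by simp
  \<comment> \<open>This grouping is valid for every bilinear form, symmetric or not.\<close>
  have "Q h \<bullet> h - Q y \<bullet> y = Q (h - y) \<bullet> h + Q y \<bullet> (h - y)"
    by (simp add: linear_diff[OF Q(1)] inner_diff_left inner_diff_right)
  also have "\<bar>\<dots>\<bar> \<le> K * norm (h - y) * norm h + K * norm y * norm (h - y)"
    using Qb[of "h - y" h] Qb[of y "h - y"] by linarith
  also have "\<dots> = K * norm (h - y) * (norm h + norm y)" by (simp add: algebra_simps)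
  also have "\<dots> \<le> K * (4 * K * s\<^sup>2) * (2 * s + s)"
    using hy h y K s by (intro mult_mono mult_left_mono add_mono) auto
  also have "\<dots> \<le> 16 * K\<^sup>2 * s ^ 3"
    using K s by (simp add: power2_eq_square power3_eq_cube)
  finally show ?thesis by (simp add: h_def y_def)
qed

text \<open>With \<open>h = x - x0\<close> of norm at most \<open>2 * s\<close>, the Taylor bound
  and the linearisation of \<open>G x\<close> cost \<open>2 * \<eta> * s\<^sup>2\<close> each. The
  first estimate doubles one of them, the second estimate doubles both. Replacing \<open>h\<close>
  by its projection in the quadratic term costs the multiple of \<open>s ^ 3\<close>.\<close>

lemma piece_second_order:
  assumes s: "s > 0" "2 * s \<le> r" and x: "x \<in> piece s"
    and R: "\<And>z. z \<in> cball x0 (2 * s) \<Longrightarrow> norm (G z - N - Q (z - x0)) \<le> \<eta> * s"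
  shows "\<bar>2 * (N \<bullet> (x - x0)) + Q (pr x) \<bullet> pr x\<bar> \<le> (4 * \<eta> + 16 * K\<^sup>2 * s) * s\<^sup>2"
    and "\<bar>2 * (G x \<bullet> (x - x0)) - Q (pr x) \<bullet> pr x\<bar> \<le> (8 * \<eta> + 16 * K\<^sup>2 * s) * s\<^sup>2"
proof -
  define h where "h = x - x0"
  have h: "norm h \<le> 2 * s" and xc: "x \<in> cball x0 (2 * s)" "x \<in> M"
    using x piece_cball[OF x] by (auto simp: h_def piece_def)
  have "0 \<le> norm (G x - N - Q (x - x0))" by simp
  also have "\<dots> \<le> \<eta> * s" by (rule R[OF xc(1)])
  finally have \<eta>s: "0 \<le> \<eta> * s" .
  have "\<eta> * s * norm h \<le> \<eta> * s * (2 * s)" using h \<eta>s by (rule mult_left_mono)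
  then have e: "\<eta> * s * norm h \<le> 2 * \<eta> * s\<^sup>2" by (simp add: power2_eq_square)
  have 1: "\<bar>N \<bullet> h + Q h \<bullet> h / 2\<bar> \<le> 2 * \<eta> * s\<^sup>2"
    using g_taylor[OF s(2) R xc] e by (simp add: h_def)
  have "G x \<bullet> h - N \<bullet> h - Q h \<bullet> h = (G x - N - Q h) \<bullet> h" by (simp add: inner_diff_left)
  also have "\<bar>\<dots>\<bar> \<le> norm (G x - N - Q h) * norm h" by (rule Cauchy_Schwarz_ineq2)
  also have "\<dots> \<le> \<eta> * s * norm h" using R[OF xc(1)] by (intro mult_right_mono) (auto simp: h_def)
  finally have 2: "\<bar>G x \<bullet> h - N \<bullet> h - Q h \<bullet> h\<bar> \<le> 2 * \<eta> * s\<^sup>2" using e by simp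
  have 3: "\<bar>Q h \<bullet> h - Q (pr x) \<bullet> pr x\<bar> \<le> 16 * K\<^sup>2 * s ^ 3"
    using quadratic_piece[OF s x] by (simp add: h_def)
  have r1: "(4 * \<eta> + 16 * K\<^sup>2 * s) * s\<^sup>2 = 2 * (2 * \<eta> * s\<^sup>2) + 16 * K\<^sup>2 * s ^ 3"
    "(8 * \<eta> + 16 * K\<^sup>2 * s) * s\<^sup>2 = 4 * (2 * \<eta> * s\<^sup>2) + 16 * K\<^sup>2 * s ^ 3"
    by (simp_all add: algebra_simps power2_eq_square power3_eq_cube)
  show "\<bar>2 * (N \<bullet> (x - x0)) + Q (pr x) \<bullet> pr x\<bar> \<le> (4 * \<eta> + 16 * K\<^sup>2 * s) * s\<^sup>2"
    "\<bar>2 * (G x \<bullet> (x - x0)) - Q (pr x) \<bullet> pr x\<bar> \<le> (8 * \<eta> + 16 * K\<^sup>2 * s) * s\<^sup>2"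
    unfolding r1 h_def[symmetric] using 1 2 3 by arith+
qed

lemma G_normalized:
  assumes s: "s > 0" "2 * s \<le> r" and x: "x \<in> cball x0 (2 * s)"
  shows "G x \<noteq> 0" "norm ((1 / (G x \<bullet> G x)) *\<^sub>R G x - N) \<le> 3 * K * s"
proof -
  have xr: "x \<in> cball x0 r" using x s by auto
  have "norm (G x - N) \<le> K * norm (x - x0)" by (rule G_lip[OF xr])
  also have "\<dots> \<le> K * (2 * s)" using x K by (intro mult_left_mono) (auto simp: dist_norm norm_minus_commute)
  finally have d: "norm (G x - N) \<le> 2 * (K * s)" by simp
  have a: "3/4 \<le> norm (G x)" using d Ke[OF s(2)] N1 norm_triangle_ineq3[of "G x" N] by linarith
  show "G x \<noteq> 0"
  proof
    assume "G x = 0"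
    with a show False by simp
  qed
  define A where "A = norm (G x)"
  have A: "A > 0" unfolding A_def using a by linarith
  have GG: "G x \<bullet> G x = A\<^sup>2" by (simp add: A_def power2_norm_eq_inner)
  \<comment> \<open>Inversion in the unit sphere fixes the unit vector \<open>N\<close> and divides
    the distance to it by \<open>norm (G x)\<close>.\<close>
  have "(norm ((1 / (G x \<bullet> G x)) *\<^sub>R G x - N))\<^sup>2 = (norm (G x - N) / A)\<^sup>2"
    unfolding power_divide power2_norm_eq_inner using A
    by (simp add: inner_diff_left inner_diff_right NN GG inner_commute field_simps power2_eq_square)
  then have "norm ((1 / (G x \<bullet> G x)) *\<^sub>R G x - N) = norm (G x - N) / A"
    by (rule power2_eq_imp_eq) (use A in simp_all)
  also have "\<dots> \<le> (2 * (K * s)) / (3/4)"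
    using d a K s by (intro frac_le) (auto simp: A_def)
  also have "\<dots> \<le> 3 * K * s" using K s by simp
  finally show "norm ((1 / (G x \<bullet> G x)) *\<^sub>R G x - N) \<le> 3 * K * s" .
qed

text \<open>\<open>a\<close> depends on the projector alone: 2 for twice the identity, 1 for the
  tangential projector, 0 for the other four. Only twice the identity and the normal projector at
  \<open>x\<close> need estimates; averaging and projecting onto \<open>N\<close> yield the
  rest.\<close>

lemma projections_second_order:
  assumes P: "P \<in> projection_choices M x0"
  shows "\<exists>a. 0 \<le> a \<and> a \<le> 2 \<and> (\<forall>s \<eta> x. s > 0 \<longrightarrow> 2 * s \<le> r \<longrightarrow> x \<in> piece s \<longrightarrow>
      linear_error s \<eta> \<longrightarrow>
      norm (P x (tangent_space M x) (x - x0) - model a (pr x)) \<le> model_error s \<eta>)"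
proof -
  define good where "good a f \<longleftrightarrow> (\<forall>s \<eta> x. s > 0 \<longrightarrow> 2 * s \<le> r \<longrightarrow> x \<in> piece s \<longrightarrow>
      linear_error s \<eta> \<longrightarrow>
      norm (f x - model a (pr x)) \<le> model_error s \<eta>)"
    for a and f :: "real^'n \<Rightarrow> real^'n"
  have tan: "tangent_space M x0 = {v. N \<bullet> v = 0}" using tangent[of x0] x0 r by simp
  have N0: "N \<noteq> 0" using N1 by auto
  let ?N = "oproj ((tangent_space M x0)\<^sup>\<bottom>)"
  have Nproj: "?N v = (N \<bullet> v) *\<^sub>R N" for v by (simp add: tan oproj_hyperplane N0 NN)
  have goodN: "good 0 (\<lambda>x. ?N (f x))" if "good a f" for a f
    unfolding good_def
  proof (intro allI impI)
    fix s \<eta> x assume A: "s > 0" "2 * s \<le> r" "x \<in> piece s" "linear_error s \<eta>"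
    let ?v = "f x - model a (pr x)"
    have "?N (f x) - model 0 (pr x) = (N \<bullet> ?v) *\<^sub>R N"
      by (simp add: Nproj inner_diff_right NN N_pr algebra_simps)
    also have "norm \<dots> \<le> norm ?v"
      using Cauchy_Schwarz_ineq2[of N ?v] N1 by simp
    also have "\<dots> \<le> model_error s \<eta>" using that A unfolding good_def by blast
    finally show "norm (?N (f x) - model 0 (pr x)) \<le> model_error s \<eta>" .
  qed
  have goodI: "good 2 (\<lambda>x. 2 *\<^sub>R (x - x0))"
    unfolding good_def
  proof (intro allI impI)
    fix s \<eta> x assume A: "s > 0" "2 * s \<le> r" "x \<in> piece s" "linear_error s \<eta>"
    \<comment> \<open>At \<open>z = x0\<close> the left side of \<open>linear_error\<close>
      vanishes, which reveals that \<open>\<eta> \<ge> 0\<close>.\<close>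
    have "norm (G x0 - N - Q (x0 - x0)) \<le> \<eta> * s" using A(1) A(4)[rule_format, of x0] by simp
    then have \<eta>: "0 \<le> \<eta>" using A(1) by (simp add: linear_0[OF Q(1)] zero_le_mult_iff)
    have "2 *\<^sub>R (x - x0) - model 2 (pr x) = (2 * (N \<bullet> (x - x0)) + Q (pr x) \<bullet> pr x) *\<^sub>R N"
      by (simp add: pr_def algebra_simps)
    also have "norm \<dots> \<le> (4 * \<eta> + 16 * K\<^sup>2 * s) * s\<^sup>2"
      using piece_second_order(1)[OF A(1-3) bspec[OF A(4)]] N1 by simp
    also have "\<dots> \<le> model_error s \<eta>"
      using \<eta> K A(1) by (intro mult_right_mono add_mono) auto
    finally show "norm (2 *\<^sub>R (x - x0) - model 2 (pr x)) \<le> model_error s \<eta>" .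
  qed
  have tx: "G x \<noteq> 0" "tangent_space M x = {v. G x \<bullet> v = 0}" if "s > 0" "2 * s \<le> r" "x \<in> piece s" for s x
  proof -
    show "G x \<noteq> 0" by (rule G_normalized[OF that(1,2) piece_cball[OF that(3)]])
    have "x \<in> cball x0 r" using piece_cball[OF that(3)] that(2) by auto
    then show "tangent_space M x = {v. G x \<bullet> v = 0}" using that(3) by (intro tangent) (auto simp: piece_def)
  qed
  have goodP: "good 0 (\<lambda>x. - 2 *\<^sub>R oproj ((tangent_space M x)\<^sup>\<bottom>) (x - x0))"
    unfolding good_def
  proof (intro allI impI)
    fix s \<eta> x assume A: "s > 0" "2 * s \<le> r" "x \<in> piece s" "linear_error s \<eta>"
    have "norm (G x0 - N - Q (x0 - x0)) \<le> \<eta> * s" using A(1) A(4)[rule_format, of x0] by simp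
    then have \<eta>: "0 \<le> \<eta>" using A(1) by (simp add: linear_0[OF Q(1)] zero_le_mult_iff)
    define c where "c = G x \<bullet> (x - x0)"
    define q where "q = Q (pr x) \<bullet> pr x"
    have proj: "oproj ((tangent_space M x)\<^sup>\<bottom>) (x - x0) = c *\<^sub>R ((1 / (G x \<bullet> G x)) *\<^sub>R G x)"
      using tx[OF A(1-3)] by (simp add: oproj_hyperplane c_def)
    have c: "\<bar>2 * c - q\<bar> \<le> (8 * \<eta> + 16 * K\<^sup>2 * s) * s\<^sup>2"
      using piece_second_order(2)[OF A(1-3) bspec[OF A(4)]] by (simp add: c_def q_def)
    have "\<bar>q\<bar> \<le> K * s\<^sup>2"
    proof -
      have y: "norm (pr x) \<le> s" using A(3) by (simp add: piece_def)
      have "\<bar>q\<bar> \<le> norm (Q (pr x)) * norm (pr x)" unfolding q_def by (rule Cauchy_Schwarz_ineq2)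
      also have "\<dots> \<le> (K * s) * s"
        using y K A(1) order_trans[OF Q(2) mult_left_mono[OF y K(1)]] by (intro mult_mono) auto
      finally show ?thesis by (simp add: power2_eq_square)
    qed
    then have "\<bar>2 * c\<bar> \<le> K * s\<^sup>2 + (8 * \<eta> + 16 * K\<^sup>2 * s) * s\<^sup>2" using c by linarith
    \<comment> \<open>A crude bound is enough, since \<open>c\<close> is about to be multiplied by a
      deviation that is itself of order \<open>K * s\<close>.\<close>
    also have "\<dots> \<le> K * s\<^sup>2 + (8 * \<eta> + 2 * K) * s\<^sup>2"
    proof -
      have "16 * K\<^sup>2 * s = 16 * K * (K * s)" by (simp add: power2_eq_square)
      also have "\<dots> \<le> 16 * K * (1/8)" using Ke[OF A(2)] K by (intro mult_left_mono) auto
      finally show ?thesis by (intro add_left_mono mult_right_mono) auto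
    qed
    finally have c2: "\<bar>2 * c\<bar> \<le> (8 * \<eta> + 3 * K) * s\<^sup>2" by (simp add: algebra_simps)
    have "- 2 *\<^sub>R oproj ((tangent_space M x)\<^sup>\<bottom>) (x - x0) - (0 *\<^sub>R pr x - q *\<^sub>R N)
        = - ((2 * c - q) *\<^sub>R N) - (2 * c) *\<^sub>R ((1 / (G x \<bullet> G x)) *\<^sub>R G x - N)"
      unfolding proj by (simp add: algebra_simps)
    also have "norm \<dots> \<le> \<bar>2 * c - q\<bar> + \<bar>2 * c\<bar> * norm ((1 / (G x \<bullet> G x)) *\<^sub>R G x - N)"
      by (rule order_trans[OF norm_triangle_ineq4]) (simp add: N1)
    also have "\<dots> \<le> (8 * \<eta> + 16 * K\<^sup>2 * s) * s\<^sup>2 + ((8 * \<eta> + 3 * K) * s\<^sup>2) * (3 * K * s)"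
      using c c2 G_normalized(2)[OF A(1,2) piece_cball[OF A(3)]] by (intro add_mono mult_mono) auto
    also have "\<dots> = (8 * \<eta> + 25 * K\<^sup>2 * s + 24 * \<eta> * (K * s)) * s\<^sup>2"
      by (simp add: algebra_simps power2_eq_square)
    also have "\<dots> \<le> model_error s \<eta>"
    proof -
      have "24 * \<eta> * (K * s) \<le> 24 * \<eta> * (1/8)" using Ke[OF A(2)] \<eta> by (intro mult_left_mono) auto
      then show ?thesis by (intro mult_right_mono) auto
    qed
    finally show "norm (- 2 *\<^sub>R oproj ((tangent_space M x)\<^sup>\<bottom>) (x - x0) - model 0 (pr x)) \<le> model_error s \<eta>"
      by (simp add: q_def)
  qed
  have goodS: "good 1 (\<lambda>x. oproj (tangent_space M x) (x - x0))"
    unfolding good_def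
  proof (intro allI impI)
    fix s \<eta> x assume A: "s > 0" "2 * s \<le> r" "x \<in> piece s" "linear_error s \<eta>"
    let ?u = "2 *\<^sub>R (x - x0) - model 2 (pr x)"
    let ?v = "- 2 *\<^sub>R oproj ((tangent_space M x)\<^sup>\<bottom>) (x - x0) - model 0 (pr x)"
    let ?w = "oproj (tangent_space M x) (x - x0) - model 1 (pr x)"
    have "oproj ((tangent_space M x)\<^sup>\<bottom>) (x - x0) = (x - x0) - oproj (tangent_space M x) (x - x0)"
      unfolding tx(2)[OF A(1-3)] by (rule oproj_orthogonal_comp[OF subspace_hyperplane])
    then have *: "oproj (tangent_space M x) (x - x0) = (x - x0) - oproj ((tangent_space M x)\<^sup>\<bottom>) (x - x0)"
      by simp
    have "2 *\<^sub>R ?w = ?u + ?v" unfolding * by (simp add: vec_eq_iff algebra_simps)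
    then have "2 * norm ?w \<le> norm ?u + norm ?v" by (metis abs_numeral norm_scaleR norm_triangle_ineq)
    moreover have "norm ?u \<le> model_error s \<eta>" "norm ?v \<le> model_error s \<eta>"
      using goodI goodP A unfolding good_def by blast+
    ultimately show "norm ?w \<le> model_error s \<eta>" by linarith
  qed
  have "\<exists>a. 0 \<le> a \<and> a \<le> 2 \<and> good a (\<lambda>x. P x (tangent_space M x) (x - x0))"
  proof -
    have lin: "- 2 *\<^sub>R ?N v = ?N (- 2 *\<^sub>R v)" "2 *\<^sub>R ?N v = ?N (2 *\<^sub>R v)" for v
      by (simp_all add: Nproj)
    from P consider "P = (\<lambda>x S v. oproj S v)" | "P = (\<lambda>x S v. - 2 *\<^sub>R oproj (S\<^sup>\<bottom>) v)"
      | "P = (\<lambda>x S v. 2 *\<^sub>R v)" | "P = (\<lambda>x S v. ?N (oproj S v))"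
      | "P = (\<lambda>x S v. - 2 *\<^sub>R ?N (oproj (S\<^sup>\<bottom>) v))" | "P = (\<lambda>x S v. 2 *\<^sub>R ?N v)"
      unfolding projection_choices_def Let_def by blast
    then show ?thesis
    proof cases
      case 1 then show ?thesis using goodS by (intro exI[of _ 1]) simp
    next
      case 2 then show ?thesis using goodP by (intro exI[of _ 0]) simp
    next
      case 3 then show ?thesis using goodI by (intro exI[of _ 2]) simp
    next
      case 4 then show ?thesis using goodN[OF goodS] by (intro exI[of _ 0]) simp
    next
      case 5 then show ?thesis using goodN[OF goodP] by (intro exI[of _ 0]) (simp only: lin, simp)
    next
      case 6 then show ?thesis using goodN[OF goodI] by (intro exI[of _ 0]) (simp only: lin, simp)
    qed
  qed
  then show ?thesis unfolding good_def .
qed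

end

text \<open>The right-hand side is the chord of the convex function \<open>(1 + t) ^ d\<close> over
  the unit interval. It makes the distortion of the measure linear in the excess \<open>t\<close> of
  the Lipschitz constant.\<close>

lemma one_plus_power_le:
  fixes t :: real
  assumes "0 \<le> t" "t \<le> 1"
  shows "(1 + t) ^ d \<le> 1 + (2 ^ d - 1) * t"
proof (induction d)
  case (Suc d)
  have c: "(1::real) \<le> 2 ^ d" by simp
  have "(1 + t) ^ Suc d \<le> (1 + t) * (1 + (2 ^ d - 1) * t)"
    using Suc assms by (auto intro: mult_left_mono)
  also have "\<dots> = 1 + t * (1 + (2 ^ d - 1) * (1 + t))" by (simp add: algebra_simps)
  also have "\<dots> \<le> 1 + t * (1 + (2 ^ d - 1) * 2)"
    using assms c by (intro add_left_mono mult_left_mono) auto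
  finally show ?case by (simp add: algebra_simps)
qed simp

section \<open>Transfer of integrals from M to the tangent plane\<close>

context hypersurface_chart
begin

lemma continuous_pr: "continuous_on UNIV pr"
  unfolding pr_def by (intro continuous_intros)

lemma pr_borel [measurable]: "pr \<in> borel_measurable borel"
  by (intro borel_measurable_continuous_onI continuous_pr)

lemma piece_borel [measurable]:
  assumes [measurable]: "M \<in> sets borel"
  shows "piece s \<in> sets borel"
proof -
  have "piece s = M \<inter> {x. norm (x - x0) \<le> 2 * s \<and> norm (pr x) \<le> s}" by (auto simp: piece_def)
  moreover have "closed {x. norm (x - x0) \<le> 2 * s \<and> norm (pr x) \<le> s}"
    by (intro closed_Collect_conj closed_Collect_le continuous_intros continuous_pr)
  ultimately show ?thesis by (simp add: borel_closed)
qed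

lemma emeasure_piece:
  assumes M[measurable]: "M \<in> sets borel" and s: "s > 0" "2 * s \<le> r"
  shows "emeasure (hausdorff_measure d) (disk N s) \<le> emeasure (hausdorff_measure d) (piece s)"
    and "emeasure (hausdorff_measure d) (piece s) \<le> ennreal ((1 + 8 * (K * s)\<^sup>2) ^ d) * emeasure (hausdorff_measure d) (disk N s)"
proof -
  have L: "1 + 8 * (K * s)\<^sup>2 > 0" using zero_le_power2[of "K * s"] by linarith
  show "emeasure (hausdorff_measure d) (disk N s) \<le> emeasure (hausdorff_measure d) (piece s)"
    using hausdorff_outer_lipschitz_image[of 1 "piece s" pr d] norm_pr_diff_le
    by (simp add: emeasure_hausdorff_measure pr_image_piece[OF s] dist_norm)
  have "hausdorff_outer d (piece s) \<le> ennreal ((1 + 8 * (K * s)\<^sup>2) ^ d) * hausdorff_outer d (pr ` piece s)"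
    by (rule hausdorff_outer_le_image[OF L]) (simp add: dist_norm piece_lipschitz(2)[OF s])
  then show "emeasure (hausdorff_measure d) (piece s) \<le> ennreal ((1 + 8 * (K * s)\<^sup>2) ^ d) * emeasure (hausdorff_measure d) (disk N s)"
    by (simp add: emeasure_hausdorff_measure pr_image_piece[OF s])
qed

text \<open>The disk of radius \<open>r / 2\<close> is a 1-Lipschitz image of a part of
  \<open>M\<close>; homotheties give the other radii.\<close>

lemma emeasure_disk_finite:
  assumes M: "M \<in> sets borel" and fin: "emeasure (hausdorff_measure d) M < \<infinity>" and s: "s > 0"
  shows "emeasure (hausdorff_measure d) (disk N s) < \<infinity>"
proof -
  have r2: "r / 2 > 0" "2 * (r / 2) \<le> r" using r by auto
  have "emeasure (hausdorff_measure d) (disk N (r/2)) \<le> emeasure (hausdorff_measure d) (piece (r/2))"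
    by (rule emeasure_piece(1)[OF M r2])
  also have "\<dots> \<le> emeasure (hausdorff_measure d) M"
    using M by (intro emeasure_mono) (auto simp: piece_def)
  also have "\<dots> < \<infinity>" by (rule fin)
  finally have "ennreal ((2 * s / r) ^ d) * emeasure (hausdorff_measure d) (disk N (r/2)) < \<infinity>"
    by (simp add: ennreal_mult_less_top)
  moreover have "disk N ((2 * s / r) * (r / 2)) = disk N s" using r by simp
  ultimately show ?thesis
    using emeasure_disk_scale[of "2 * s / r" d N "r / 2"] s r by simp
qed

text \<open>The projection \<open>pr\<close> changes Hausdorff measure only by a factor \<open>1 + O(s\<^sup>2)\<close>.\<close>

lemma integral_compare:
  fixes f f0 :: "real^'n \<Rightarrow> 'b::euclidean_space"
  assumes M[measurable]: "M \<in> sets borel" and fin: "emeasure (hausdorff_measure d) M < \<infinity>"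
    and s: "s > 0" "2 * s \<le> r"
    and f: "(\<lambda>x. indicator M x *\<^sub>R f x) \<in> borel_measurable borel" and f0[measurable]: "f0 \<in> borel_measurable borel"
    and close: "\<And>x. x \<in> piece s \<Longrightarrow> norm (f x - f0 (pr x)) \<le> e"
    and zero: "\<And>x. x \<in> M \<Longrightarrow> x \<notin> piece s \<Longrightarrow> f x = 0"
    and bound: "\<And>y. y \<in> disk N s \<Longrightarrow> norm (f0 y) \<le> b" and b: "b \<ge> 0" and e: "e \<ge> 0"
  shows "norm ((\<integral>x. indicator M x *\<^sub>R f x \<partial>hausdorff_measure d) - (\<integral>y. indicator (disk N s) y *\<^sub>R f0 y \<partial>hausdorff_measure d))
     \<le> 2 ^ d * (e + 16 * (K * s)\<^sup>2 * b) * measure (hausdorff_measure d) (disk N s)"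
proof -
  let ?H = "hausdorff_measure d :: (real^'n) measure"
  let ?A = "piece s"
  let ?D = "disk N s"
  define L where "L = 1 + 8 * (K * s)\<^sup>2"
  have [measurable]: "?A \<in> sets borel" by (rule piece_borel[OF M])
  have Ks: "0 \<le> K * s" "K * s \<le> 1/8" using K s Ke[OF s(2)] by auto
  have t: "8 * (K * s)\<^sup>2 \<le> 1" using power_mono[OF Ks(2,1), of 2] by (simp add: power2_eq_square)
  have L: "L > 0" using zero_le_power2[of "K * s"] unfolding L_def by linarith
  have "L ^ d \<le> 1 + (2 ^ d - 1) * (8 * (K * s)\<^sup>2)"
    unfolding L_def using t by (intro one_plus_power_le) auto
  also have "\<dots> \<le> 1 + 2 ^ d * (8 * (K * s)\<^sup>2)" by (intro add_left_mono mult_right_mono) auto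
  finally have Ld1: "L ^ d - 1 \<le> 2 ^ d * (8 * (K * s)\<^sup>2)" by simp
  have Ld2: "L ^ d \<le> 2 ^ d" using t L by (intro power_mono) (auto simp: L_def)
  have Dfin: "emeasure ?H ?D < \<infinity>" by (rule emeasure_disk_finite[OF M fin s(1)])
  have Afin: "emeasure ?H ?A < \<infinity>"
    using fin M by (intro le_less_trans[OF emeasure_mono[of ?A M]]) (auto simp: piece_def)
  have mA: "measure ?H ?A \<le> 2 ^ d * measure ?H ?D"
  proof -
    have "ennreal (measure ?H ?A) \<le> ennreal (L ^ d) * ennreal (measure ?H ?D)"
      using emeasure_piece(2)[OF M s, of d] Afin Dfin by (simp add: emeasure_eq_ennreal_measure L_def)
    then have "measure ?H ?A \<le> L ^ d * measure ?H ?D"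
      using L by (simp add: ennreal_mult'[symmetric] ennreal_le_iff)
    also have "\<dots> \<le> 2 ^ d * measure ?H ?D" using Ld2 by (intro mult_right_mono) auto
    finally show ?thesis .
  qed
  have prD: "pr x \<in> ?D" if "x \<in> ?A" for x using that pr_image_piece[OF s] by blast
  have fA: "indicator M x *\<^sub>R f x = indicator ?A x *\<^sub>R (indicator M x *\<^sub>R f x)" for x
    using zero[of x] by (auto simp: indicator_def piece_def)
  have f': "(\<lambda>x. indicator M x *\<^sub>R f x) \<in> borel_measurable ?H" using f by (simp cong: measurable_cong_sets)
  have if1: "integrable ?H (\<lambda>x. indicator ?A x *\<^sub>R (indicator M x *\<^sub>R f x))"
  proof (rule integrableI_bounded_set_indicator[of _ _ _ "e + b"])
    show "AE x in ?H. x \<in> ?A \<longrightarrow> norm (indicator M x *\<^sub>R f x) \<le> e + b"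
    proof (intro AE_I2 impI)
      fix x assume x: "x \<in> ?A"
      have "norm (f x) \<le> norm (f x - f0 (pr x)) + norm (f0 (pr x))" by norm
      then show "norm (indicator M x *\<^sub>R f x) \<le> e + b"
        using close[OF x] bound[OF prD[OF x]] b e by (auto simp: indicator_def)
    qed
  qed (use f' Afin in auto)
  have if2: "integrable ?H (\<lambda>x. indicator ?A x *\<^sub>R f0 (pr x))"
    using bound prD Afin by (intro integrableI_bounded_set_indicator[of _ _ _ b]) (auto cong: measurable_cong_sets)
  have if3: "integrable ?H (\<lambda>y. indicator ?D y *\<^sub>R f0 y)"
    using bound Dfin by (intro integrableI_bounded_set_indicator[of _ _ _ b]) (auto cong: measurable_cong_sets)
  have "(\<integral>x. indicator M x *\<^sub>R f x \<partial>?H) = (\<integral>x. indicator ?A x *\<^sub>R (indicator M x *\<^sub>R f x) \<partial>?H)"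
    using fA by (rule Bochner_Integration.integral_cong[OF refl])
  \<comment> \<open>First \<open>f\<close> is replaced by \<open>f0\<close> composed with
    \<open>pr\<close>, at the price of \<open>e\<close> per unit of measure; the change of measure
    follows.\<close>
  then have "norm ((\<integral>x. indicator M x *\<^sub>R f x \<partial>?H) - (\<integral>x. indicator ?A x *\<^sub>R f0 (pr x) \<partial>?H))
      = norm (\<integral>x. indicator ?A x *\<^sub>R (indicator M x *\<^sub>R f x) - indicator ?A x *\<^sub>R f0 (pr x) \<partial>?H)"
    using if1 if2 by simp
  also have "\<dots> \<le> (\<integral>x. norm (indicator ?A x *\<^sub>R (indicator M x *\<^sub>R f x) - indicator ?A x *\<^sub>R f0 (pr x)) \<partial>?H)"
    by (rule integral_norm_bound)
  also have "\<dots> \<le> (\<integral>x. indicator ?A x *\<^sub>R e \<partial>?H)"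
  proof (rule integral_mono)
    show "integrable ?H (\<lambda>x. norm (indicator ?A x *\<^sub>R (indicator M x *\<^sub>R f x) - indicator ?A x *\<^sub>R f0 (pr x)))"
      using if1 if2 by simp
    show "integrable ?H (\<lambda>x. indicator ?A x *\<^sub>R e)"
      using Afin by (intro integrableI_bounded_set_indicator[of _ _ _ e]) (auto simp: e)
    fix x show "norm (indicator ?A x *\<^sub>R (indicator M x *\<^sub>R f x) - indicator ?A x *\<^sub>R f0 (pr x)) \<le> indicator ?A x *\<^sub>R e"
      using close[of x] by (auto simp: indicator_def piece_def)
  qed
  also have "\<dots> = e * measure ?H ?A" using Afin by simp
  also have "\<dots> \<le> e * (2 ^ d * measure ?H ?D)" using mA e by (rule mult_left_mono)
  finally have 1: "norm ((\<integral>x. indicator M x *\<^sub>R f x \<partial>?H) - (\<integral>x. indicator ?A x *\<^sub>R f0 (pr x) \<partial>?H)) \<le> 2 ^ d * e * measure ?H ?D"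
    by (simp only: mult_ac)
  define v where "v = (\<integral>x. indicator ?A x *\<^sub>R f0 (pr x) \<partial>?H) - (\<integral>y. indicator ?D y *\<^sub>R f0 y \<partial>?H)"
  \<comment> \<open>Pairing with the direction of the difference reduces the vector-valued estimate
    to the scalar comparison.\<close>
  define w where "w = sgn v"
  have w: "norm w \<le> 1" by (simp add: w_def norm_sgn)
  have "norm v = v \<bullet> w"
    by (cases "v = 0") (auto simp: w_def sgn_div_norm power2_norm_eq_inner[symmetric] power2_eq_square)
  also have "\<dots> = (\<integral>x. indicator ?A x * (f0 (pr x) \<bullet> w) \<partial>?H) - (\<integral>y. indicator ?D y * (f0 y \<bullet> w) \<partial>?H)"
    using if2 if3 by (simp add: v_def inner_diff_left flip: integral_inner_left)
  also have "\<dots> \<le> (L ^ d - 1) * (2 * b) * measure ?H ?D"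
  proof -
    have "\<bar>(\<integral>x. indicator ?A x * (f0 (pr x) \<bullet> w) \<partial>?H) - (\<integral>y. indicator (pr ` ?A) y * (f0 y \<bullet> w) \<partial>?H)\<bar>
        \<le> (L ^ d - 1) * (2 * b) * measure ?H (pr ` ?A)"
    proof (rule integral_hausdorff_bilipschitz)
      fix y assume "y \<in> pr ` ?A"
      then have "norm (f0 y) \<le> b" using bound pr_image_piece[OF s] by blast
      then have "norm (f0 y) * norm w \<le> b * 1" using w b by (intro mult_mono) auto
      then show "\<bar>f0 y \<bullet> w\<bar> \<le> b" using Cauchy_Schwarz_ineq2[of "f0 y" w] by simp
    next
      fix x y assume "x \<in> ?A" "y \<in> ?A"
      then show "dist x y \<le> L * dist (pr x) (pr y)" "dist (pr x) (pr y) \<le> dist x y"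
        using piece_lipschitz(2)[OF s] norm_pr_diff_le by (simp_all add: dist_norm L_def)
    qed (use Afin L b in \<open>simp_all add: pr_image_piece[OF s]\<close>)
    then show ?thesis by (simp add: pr_image_piece[OF s])
  qed
  also have "\<dots> \<le> (2 ^ d * (8 * (K * s)\<^sup>2)) * (2 * b) * measure ?H ?D"
    using Ld1 b by (intro mult_right_mono) auto
  finally have 2: "norm v \<le> 2 ^ d * (16 * (K * s)\<^sup>2 * b) * measure ?H ?D" by (simp add: mult_ac)
  have "norm ((\<integral>x. indicator M x *\<^sub>R f x \<partial>?H) - (\<integral>y. indicator ?D y *\<^sub>R f0 y \<partial>?H))
     \<le> 2 ^ d * e * measure ?H ?D + 2 ^ d * (16 * (K * s)\<^sup>2 * b) * measure ?H ?D"
    by (rule norm_diff_triangle_le[OF 1 2[unfolded v_def]])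
  then show ?thesis by (simp add: algebra_simps)
qed

text \<open>On a piece the radii \<open>norm (x - x0)\<close> and \<open>norm (pr x)\<close> agree
  up to a relative error of second order. In the second estimate the factor
  \<open>norm (pr x)\<close>, supplied later by the model, offsets the singular
  denominators.\<close>

lemma radial_compare:
  fixes k \<xi> :: "real \<Rightarrow> real"
  assumes k: "\<And>t u. \<bar>k t - k u\<bar> \<le> \<Lambda> * \<bar>t - u\<bar>" "k 0 = 0"
    and \<xi>: "\<And>t u. \<bar>\<xi> t - \<xi> u\<bar> \<le> \<Lambda> * \<bar>t - u\<bar>"
    and s: "s > 0" "2 * s \<le> r" and x: "x \<in> piece s"
  shows "\<bar>\<xi> (norm (x - x0) / s) - \<xi> (norm (pr x) / s)\<bar> \<le> 8 * \<Lambda> * (K * s)\<^sup>2"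
    and "\<bar>k (norm (x - x0) / s) / norm (x - x0) - k (norm (pr x) / s) / norm (pr x)\<bar> * norm (pr x) \<le> 16 * \<Lambda> * (K * s)\<^sup>2"
proof -
  define h where "h = norm (x - x0)"
  define y where "y = norm (pr x)"
  have \<Lambda>: "\<Lambda> \<ge> 0" using \<xi>[of 1 0] by (auto intro: order_trans[OF abs_ge_zero])
  have y: "0 \<le> y" "y \<le> s" using x by (auto simp: y_def piece_def)
  have yh: "y \<le> h" using norm_pr_le by (simp add: y_def h_def)
  have hy: "h - y \<le> 8 * (K * s)\<^sup>2 * y" using piece_radial[OF s x] by (simp add: h_def y_def)
  have "8 * (K * s)\<^sup>2 * y \<le> 8 * (K * s)\<^sup>2 * s" using y by (intro mult_left_mono) auto
  then have "(h - y) / s \<le> 8 * (K * s)\<^sup>2" using hy s by (simp add: pos_divide_le_eq)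
  moreover have hys: "\<bar>h / s - y / s\<bar> = (h - y) / s" using yh s by (simp flip: diff_divide_distrib)
  ultimately have d: "\<bar>h / s - y / s\<bar> \<le> 8 * (K * s)\<^sup>2" by simp
  have dl: "\<Lambda> * \<bar>h / s - y / s\<bar> \<le> \<Lambda> * (8 * (K * s)\<^sup>2)" using d \<Lambda> by (rule mult_left_mono)
  show "\<bar>\<xi> (norm (x - x0) / s) - \<xi> (norm (pr x) / s)\<bar> \<le> 8 * \<Lambda> * (K * s)\<^sup>2"
    using \<xi>[of "h / s" "y / s"] dl by (simp add: h_def y_def)
  show "\<bar>k (norm (x - x0) / s) / norm (x - x0) - k (norm (pr x) / s) / norm (pr x)\<bar> * norm (pr x) \<le> 16 * \<Lambda> * (K * s)\<^sup>2"
  proof (cases "y = 0")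
    case True
    then show ?thesis using \<Lambda> by (simp add: y_def)
  next
    case False
    then have y0: "y > 0" "h > 0" using y yh by auto
    have "\<bar>k (h / s) / h - k (y / s) / y\<bar> * y = \<bar>(k (h / s) / h - k (y / s) / y) * y\<bar>"
      using y0 by (simp add: abs_mult)
    \<comment> \<open>Separates the change of the numerator from that of the denominator; each part
      costs \<open>8 * \<Lambda> * (K * s)\<^sup>2\<close>.\<close>
    also have "(k (h / s) / h - k (y / s) / y) * y = (k (h / s) - k (y / s)) - k (h / s) * ((h - y) / h)"
      using y0 by (simp add: field_simps)
    also have "\<bar>\<dots>\<bar> \<le> \<bar>k (h / s) - k (y / s)\<bar> + \<bar>k (h / s)\<bar> * ((h - y) / h)"
      using y0 yh by (intro order_trans[OF abs_triangle_ineq4]) (simp add: abs_mult)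
    also have "\<dots> \<le> \<Lambda> * (8 * (K * s)\<^sup>2) + (\<Lambda> * (h / s)) * ((h - y) / h)"
      using k(1)[of "h / s" "y / s"] k(1)[of "h / s" 0] k(2) dl y0 yh s
      by (intro add_mono mult_right_mono) auto
    also have "(\<Lambda> * (h / s)) * ((h - y) / h) = \<Lambda> * \<bar>h / s - y / s\<bar>"
      unfolding hys using y0 by simp
    also have "\<Lambda> * (8 * (K * s)\<^sup>2) + \<dots> \<le> 16 * \<Lambda> * (K * s)\<^sup>2" using dl by simp
    finally show ?thesis by (simp add: h_def y_def)
  qed
qed

text \<open>The linear part of the integrand is odd, and the quadratic part only sees the trace.\<close>

lemma tangent_plane_integral:
  fixes k \<xi> :: "real \<Rightarrow> real"
  assumes n: "CARD('n) \<ge> 2" and B: "orthonormal_basis {v. N \<bullet> v = 0} B"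
    and k[measurable]: "k \<in> borel_measurable borel" and k_lip: "\<And>t. \<bar>k t\<bar> \<le> \<Lambda> * \<bar>t\<bar>" and \<Lambda>: "\<Lambda> \<ge> 0"
    and rel: "\<And>t. real CARD('n) * \<xi> t = - t * k t"
    and s: "s > 0" and fin: "emeasure (hausdorff_measure d) (disk N s) < \<infinity>"
  shows "(\<integral>y. indicator (disk N s) y *\<^sub>R ((k (norm y / s) / norm y) *\<^sub>R model a y) \<partial>hausdorff_measure d)
    = ((\<Sum>b\<in>B. Q b \<bullet> b) * real CARD('n) * s / real (CARD('n) - 1) *
       (\<integral>y. indicator (disk N s) y * \<xi> (norm y / s) \<partial>hausdorff_measure d)) *\<^sub>R N"
proof -
  let ?H = "hausdorff_measure d :: (real^'n) measure"
  let ?D = "disk N s"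
  define w where "w t = k (t / s) / t" for t
  have w[measurable]: "w \<in> borel_measurable borel" unfolding w_def by measurable
  have [measurable]: "Q \<in> borel_measurable borel"
    using linear_continuous_on[of Q UNIV] Q(1) by (intro borel_measurable_continuous_onI) (simp add: linear_conv_bounded_linear)
  \<comment> \<open>\<open>k t\<close> is at most a multiple of \<open>\<bar>t\<bar>\<close>, so the
    quotient stays bounded; at \<open>t = 0\<close> it is 0 by division by zero.\<close>
  have wb: "\<bar>w t\<bar> \<le> \<Lambda> / s" for t
  proof (cases "t = 0")
    case False
    have "\<bar>k (t / s)\<bar> / \<bar>t\<bar> \<le> (\<Lambda> * \<bar>t / s\<bar>) / \<bar>t\<bar>" using k_lip by (rule divide_right_mono) simp
    then show ?thesis using False s by (simp add: w_def abs_divide)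
  qed (use \<Lambda> s in \<open>simp add: w_def\<close>)
  have N0: "N \<noteq> 0" using N1 by auto
  have i1: "integrable ?H (\<lambda>y. indicator ?D y *\<^sub>R (w (norm y) *\<^sub>R y))"
  proof (rule integrableI_bounded_set_indicator[of _ _ _ "\<Lambda> / s * s"])
    show "AE y in ?H. y \<in> ?D \<longrightarrow> norm (w (norm y) *\<^sub>R y) \<le> \<Lambda> / s * s"
    proof (intro AE_I2 impI)
      fix y assume "y \<in> ?D"
      then show "norm (w (norm y) *\<^sub>R y) \<le> \<Lambda> / s * s"
        unfolding norm_scaleR using wb[of "norm y"] \<Lambda> s
        by (intro mult_mono) (auto simp: disk_def)
    qed
  qed (use fin in \<open>auto cong: measurable_cong_sets\<close>)
  have i2: "integrable ?H (\<lambda>y. indicator ?D y *\<^sub>R (w (norm y) * (Q y \<bullet> y)))"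
  proof (rule integrableI_bounded_set_indicator[of _ _ _ "\<Lambda> / s * (K * s * s)"])
    show "AE y in ?H. y \<in> ?D \<longrightarrow> norm (w (norm y) * (Q y \<bullet> y)) \<le> \<Lambda> / s * (K * s * s)"
    proof (intro AE_I2 impI)
      fix y assume "y \<in> ?D"
      then have y: "norm y \<le> s" by (simp add: disk_def)
      have "\<bar>Q y \<bullet> y\<bar> \<le> norm (Q y) * norm y" by (rule Cauchy_Schwarz_ineq2)
      also have "\<dots> \<le> (K * s) * s"
        using y K s order_trans[OF Q(2) mult_left_mono[OF y K(1)]] by (intro mult_mono) auto
      finally show "norm (w (norm y) * (Q y \<bullet> y)) \<le> \<Lambda> / s * (K * s * s)"
        unfolding real_norm_def abs_mult using wb[of "norm y"] \<Lambda> s by (intro mult_mono[of "\<bar>w (norm y)\<bar>"]) auto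
    qed
  qed (use fin in \<open>auto cong: measurable_cong_sets\<close>)
  have "(\<integral>y. indicator ?D y *\<^sub>R ((k (norm y / s) / norm y) *\<^sub>R model a y) \<partial>?H)
      = (\<integral>y. a *\<^sub>R (indicator ?D y *\<^sub>R (w (norm y) *\<^sub>R y)) - (indicator ?D y *\<^sub>R (w (norm y) * (Q y \<bullet> y))) *\<^sub>R N \<partial>?H)"
    by (intro Bochner_Integration.integral_cong) (simp_all add: w_def scaleR_diff_right mult_ac)
  also have "\<dots> = a *\<^sub>R (\<integral>y. indicator ?D y *\<^sub>R (w (norm y) *\<^sub>R y) \<partial>?H) - (\<integral>y. indicator ?D y *\<^sub>R (w (norm y) * (Q y \<bullet> y)) \<partial>?H) *\<^sub>R N"
  proof -
    have "integrable ?H (\<lambda>y. a *\<^sub>R (indicator ?D y *\<^sub>R (w (norm y) *\<^sub>R y)))"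
      "integrable ?H (\<lambda>y. (indicator ?D y *\<^sub>R (w (norm y) * (Q y \<bullet> y))) *\<^sub>R N)"
      by (rule integrable_scaleR_right[OF i1] integrable_scaleR_left[OF i2])+
    from Bochner_Integration.integral_diff[OF this] show ?thesis
      by (simp only: integral_scaleR_right integral_scaleR_left[OF i2])
  qed
  also have "\<dots> = - (\<integral>y. indicator ?D y * (w (norm y) * (Q y \<bullet> y)) \<partial>?H) *\<^sub>R N"
    by (simp only: integral_disk_odd[OF w] scaleR_zero_right diff_0 scaleR_minus_left real_scaleR_def)
  also have "(\<integral>y. indicator ?D y * (w (norm y) * (Q y \<bullet> y)) \<partial>?H)
      = (\<Sum>b\<in>B. Q b \<bullet> b) / real (CARD('n) - 1) * (\<integral>y. indicator ?D y * (w (norm y) * (norm y)\<^sup>2) \<partial>?H)"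
    by (rule integral_disk_quadratic[OF B N0 n w wb fin Q(1)])
  also have "(\<integral>y. indicator ?D y * (w (norm y) * (norm y)\<^sup>2) \<partial>?H)
      = (\<integral>y. - (real CARD('n) * s) * (indicator ?D y * \<xi> (norm y / s)) \<partial>?H)"
  proof (intro Bochner_Integration.integral_cong refl)
    fix y :: "real^'n"
    \<comment> \<open>Of the two factors \<open>norm y\<close>, one cancels the denominator of
      \<open>w\<close> and the other supplies the factor \<open>t\<close> in the relation between
      the kernels.\<close>
    have "w (norm y) * (norm y)\<^sup>2 = s * (norm y / s * k (norm y / s))"
      using s by (cases "y = 0") (simp_all add: w_def power2_eq_square)
    also have "\<dots> = - (real CARD('n) * s) * \<xi> (norm y / s)"
      using rel[of "norm y / s"] by (simp add: mult_ac)
    finally show "indicator ?D y * (w (norm y) * (norm y)\<^sup>2) = - (real CARD('n) * s) * (indicator ?D y * \<xi> (norm y / s))"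
      by simp
  qed
  also have "\<dots> = - (real CARD('n) * s) * (\<integral>y. indicator ?D y * \<xi> (norm y / s) \<partial>?H)"
    by (rule integral_mult_right_zero)
  finally show ?thesis by simp
qed

text \<open>\<open>C\<close> and \<open>s0\<close> do not depend on \<open>\<eta>\<close>, which is
  chosen afterwards according to the regularity. Up to constants, the numerator has size
  \<open>s ^ (d + 1)\<close> and error \<open>(\<eta> + s) * s ^ (d + 1)\<close>, the denominator
  has size \<open>s ^ d\<close> and error \<open>s ^ (d + 2)\<close>.\<close>

lemma approx_curvature_estimate:
  fixes k \<xi> :: "real \<Rightarrow> real"
  assumes n: "CARD('n) \<ge> 2" and d: "d = CARD('n) - 1" and B: "orthonormal_basis {v. N \<bullet> v = 0} B"
    and M[measurable]: "M \<in> sets borel" and fin: "emeasure (hausdorff_measure d) M < \<infinity>"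
    and k[measurable]: "k \<in> borel_measurable borel" and \<xi>[measurable]: "\<xi> \<in> borel_measurable borel"
    and k_lip: "\<And>t u. \<bar>k t - k u\<bar> \<le> \<Lambda> * \<bar>t - u\<bar>" and k0: "k 0 = 0" and k1: "\<And>t. t \<ge> 1 \<Longrightarrow> k t = 0"
    and \<xi>_lip: "\<And>t u. \<bar>\<xi> t - \<xi> u\<bar> \<le> \<Lambda> * \<bar>t - u\<bar>" and \<xi>1: "\<And>t. t \<ge> 1 \<Longrightarrow> \<xi> t = 0"
    and \<xi>_nn: "\<And>t. \<xi> t \<ge> 0" and \<xi>_b: "\<And>t. \<xi> t \<le> \<Lambda>" and \<xi>_pos: "\<And>t. t \<in> {0<..<1} \<Longrightarrow> \<xi> t > 0"
    and rel: "\<And>t. real CARD('n) * \<xi> t = - t * k t"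
    and P: "P \<in> projection_choices M x0"
    and F_def: "\<And>s x. F s x = (k (norm (x - x0) / s) / norm (x - x0)) *\<^sub>R P x (tangent_space M x) (x - x0)"
    and F_meas: "\<And>s. (\<lambda>x. indicator M x *\<^sub>R F s x) \<in> borel_measurable borel"
  shows "\<exists>C s0. s0 > 0 \<and> (\<forall>s \<eta>. 0 < s \<longrightarrow> s < s0 \<longrightarrow>
      linear_error s \<eta> \<longrightarrow>
      norm (- (real d / (real CARD('n) * s)) *\<^sub>R
         ((\<integral>x. indicator M x *\<^sub>R F s x \<partial>hausdorff_measure d)
            /\<^sub>R (\<integral>x. indicator M x *\<^sub>R \<xi> (norm (x - x0) / s) \<partial>hausdorff_measure d))
        - (- (\<Sum>b\<in>B. Q b \<bullet> b) *\<^sub>R N)) \<le> C * (\<eta> + s))"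
proof -
  let ?H = "hausdorff_measure d :: (real^'n) measure"
  let ?n = "real CARD('n)"
  define tr where "tr = (\<Sum>b\<in>B. Q b \<bullet> b)"
  define \<mu> where "\<mu> = measure ?H (disk N 1)"
  define \<delta> where "\<delta> = (\<integral>y. indicator (disk N 1) y * \<xi> (norm y) \<partial>?H)"
  have Dfin: "emeasure ?H (disk N s) < \<infinity>" if "s > 0" for s
    by (rule emeasure_disk_finite[OF M fin that])
  have \<mu>0: "\<mu> \<ge> 0" by (simp add: \<mu>_def)
  have \<delta>: "\<delta> > 0"
    unfolding \<delta>_def d by (rule integral_disk_pos[OF n N1 _ \<xi> \<xi>_nn \<xi>_b \<xi>_pos]) (use Dfin[of 1] d in auto)
  have \<Lambda>: "\<Lambda> \<ge> 0" using \<xi>_lip[of 1 0] by (auto intro: order_trans[OF abs_ge_zero])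
  have k_abs: "\<bar>k t\<bar> \<le> \<Lambda> * \<bar>t\<bar>" for t using k_lip[of t 0] k0 by simp
  have [measurable]: "Q \<in> borel_measurable borel"
    using linear_continuous_on[of Q UNIV] Q(1) by (intro borel_measurable_continuous_onI) (simp add: linear_conv_bounded_linear)
  obtain a :: real where a: "0 \<le> a" "a \<le> 2" and
    P2: "\<forall>s \<eta> x. s > 0 \<longrightarrow> 2 * s \<le> r \<longrightarrow> x \<in> piece s \<longrightarrow>
      linear_error s \<eta> \<longrightarrow>
      norm (P x (tangent_space M x) (x - x0) - model a (pr x)) \<le> model_error s \<eta>"
    using projections_second_order[OF P] by (elim exE conjE) (rule that)
  \<comment> \<open>121 is 25 from \<open>model_error\<close>, 48 from comparing radii and 48 from
    the change of measure, the last two being 16 times the factor 3 that bounds the model. In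
    \<open>C3\<close>, 24 is 8 from comparing radii and 16 from the change of measure.\<close>
  define C2 where "C2 = 2 ^ d * (\<Lambda> * (11 + 121 * K\<^sup>2)) * \<mu>"
  define C3 where "C3 = 2 ^ d * (24 * \<Lambda> * K\<^sup>2) * \<mu>"
  define C where "C = real d / ?n * (2 * C2 / \<delta>) + 2 * C3 / \<delta> * \<bar>tr\<bar>"
  \<comment> \<open>Below \<open>s0\<close> pieces lie in the chart,
    \<open>s\<^sup>2 \<le> s\<close>, and the denominator keeps half of its main term. The summand 1
    guards against \<open>C3 = 0\<close>.\<close>
  define s0 where "s0 = min (r / 2) (min 1 (\<delta> / (2 * (C3 + 1))))"
  have C2: "C2 \<ge> 0" and C3: "C3 \<ge> 0" using \<Lambda> \<mu>0 by (auto simp: C2_def C3_def intro!: mult_nonneg_nonneg add_nonneg_nonneg)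
  have s0: "s0 > 0" using r \<delta> C3 by (simp add: s0_def)
  have "norm (- (real d / (?n * s)) *\<^sub>R ((\<integral>x. indicator M x *\<^sub>R F s x \<partial>?H) /\<^sub>R (\<integral>x. indicator M x *\<^sub>R \<xi> (norm (x - x0) / s) \<partial>?H))
        - (- tr *\<^sub>R N)) \<le> C * (\<eta> + s)"
    if s: "0 < s" "s < s0" and R: "linear_error s \<eta>" for s \<eta>
  proof -
    have sr: "2 * s \<le> r" and s1: "s \<le> 1" and s2: "s \<le> \<delta> / (2 * (C3 + 1))" using s by (auto simp: s0_def)
    have Ks: "0 \<le> K * s" "K * s \<le> 1/8" using K s Ke[OF sr] by auto
    have "norm (G x0 - N - Q (x0 - x0)) \<le> \<eta> * s" using R[rule_format, of x0] s by simp
    then have "0 \<le> \<eta> * s" by (rule order_trans[OF norm_ge_zero])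
    then have \<eta>: "0 \<le> \<eta>" using s(1) by (simp add: zero_le_mult_iff)
    have mD: "measure ?H (disk N s) = s ^ d * \<mu>"
      using emeasure_disk_scale[OF s(1), of d N 1] s(1) unfolding \<mu>_def measure_def by (simp add: enn2real_mult)
    have \<xi>D: "(\<integral>y. indicator (disk N s) y * \<xi> (norm y / s) \<partial>?H) = s ^ d * \<delta>"
      unfolding \<delta>_def by (rule integral_disk_scale[OF s(1) \<xi> \<xi>_nn])
    have outside: "norm (x - x0) / s \<ge> 1" if "x \<in> M" "x \<notin> piece s" for x
    proof -
      have "norm (x - x0) > s" using that norm_pr_le[of x] s(1) by (auto simp: piece_def)
      then show ?thesis using s(1) by simp
    qed
    define X where "X = (\<integral>x. indicator M x *\<^sub>R F s x \<partial>?H)"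
    define D where "D = (\<integral>x. indicator M x *\<^sub>R \<xi> (norm (x - x0) / s) \<partial>?H)"
    define D0 where "D0 = s ^ d * \<delta>"
    define F0 where "F0 y = (k (norm y / s) / norm y) *\<^sub>R model a y" for y
    have F0_meas: "F0 \<in> borel_measurable borel" unfolding F0_def by measurable
    have lin: "norm (model a y) \<le> 3 * norm y" if "norm y \<le> s" for y
    proof -
      have "\<bar>Q y \<bullet> y\<bar> \<le> norm (Q y) * norm y" by (rule Cauchy_Schwarz_ineq2)
      also have "\<dots> \<le> (K * s) * norm y"
        using order_trans[OF Q(2) mult_left_mono[OF that K(1)]] by (rule mult_right_mono) simp
      also have "\<dots> \<le> 1 * norm y" using Ks by (intro mult_right_mono) auto
      finally have "\<bar>Q y \<bullet> y\<bar> \<le> norm y" by simp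
      moreover have "a * norm y \<le> 2 * norm y" using a by (intro mult_right_mono) auto
      moreover have "norm (model a y) \<le> a * norm y + \<bar>Q y \<bullet> y\<bar>"
        using a N1 by (intro order_trans[OF norm_triangle_ineq4]) simp
      ultimately show ?thesis by linarith
    qed
    have F0_b: "norm (F0 y) \<le> 3 * \<Lambda>" if "y \<in> disk N s" for y
    proof (cases "y = 0")
      case False
      have y: "norm y \<le> s" using that by (simp add: disk_def)
      have "norm (F0 y) = (\<bar>k (norm y / s)\<bar> / norm y) * norm (model a y)"
        by (simp add: F0_def)
      also have "\<dots> \<le> (\<bar>k (norm y / s)\<bar> / norm y) * (3 * norm y)"
        using lin[OF y] by (intro mult_left_mono) auto
      also have "\<dots> = 3 * \<bar>k (norm y / s)\<bar>" using False by simp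
      also have "\<bar>k (norm y / s)\<bar> \<le> \<Lambda> * \<bar>norm y / s\<bar>" by (rule k_abs)
      also have "\<dots> \<le> \<Lambda> * 1" using y s(1) \<Lambda> by (intro mult_left_mono) auto
      finally show ?thesis by simp
    qed (use \<Lambda> in \<open>simp add: F0_def\<close>)
    have F_close: "norm (F s x - F0 (pr x)) \<le> \<Lambda> * (11 * \<eta> + 73 * K\<^sup>2 * s) * s" if x: "x \<in> piece s" for x
    proof -
      define m where "m = k (norm (x - x0) / s) / norm (x - x0)"
      define m0 where "m0 = k (norm (pr x) / s) / norm (pr x)"
      define v where "v = P x (tangent_space M x) (x - x0)"
      define v0 where "v0 = model a (pr x)"
      have y: "norm (pr x) \<le> s" using x by (simp add: piece_def)
      have m: "\<bar>m\<bar> \<le> \<Lambda> / s"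
      proof (cases "x = x0")
        case False
        have "\<bar>k (norm (x - x0) / s)\<bar> / norm (x - x0) \<le> (\<Lambda> * \<bar>norm (x - x0) / s\<bar>) / norm (x - x0)"
          using k_abs by (rule divide_right_mono) simp
        then show ?thesis using False s(1) by (simp add: m_def)
      qed (use \<Lambda> s in \<open>simp add: m_def\<close>)
      have vv: "norm (v - v0) \<le> model_error s \<eta>"
        unfolding v_def v0_def using P2 s(1) sr x R by blast
      have mm: "\<bar>m - m0\<bar> * norm (pr x) \<le> 16 * \<Lambda> * (K * s)\<^sup>2"
        unfolding m_def m0_def by (rule radial_compare(2)[OF k_lip k0 \<xi>_lip s(1) sr x])
      \<comment> \<open>In this splitting the singular difference \<open>m - m0\<close> meets
        \<open>v0\<close>, whose norm is at most \<open>3 * norm (pr x)\<close>.\<close>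
      have "F s x - F0 (pr x) = m *\<^sub>R (v - v0) + (m - m0) *\<^sub>R v0"
        by (simp add: F_def F0_def m_def m0_def v_def v0_def algebra_simps)
      also have "norm \<dots> \<le> \<bar>m\<bar> * norm (v - v0) + \<bar>m - m0\<bar> * norm v0"
        by (rule order_trans[OF norm_triangle_ineq]) simp
      also have "\<dots> \<le> (\<Lambda> / s) * (model_error s \<eta>) + \<bar>m - m0\<bar> * (3 * norm (pr x))"
        using m vv lin[OF y] \<Lambda> s(1) by (intro add_mono mult_mono) (auto simp: v0_def)
      also have "\<dots> \<le> (\<Lambda> / s) * (model_error s \<eta>) + 3 * (16 * \<Lambda> * (K * s)\<^sup>2)"
        using mm by simp
      also have "\<dots> = \<Lambda> * (11 * \<eta> + 73 * K\<^sup>2 * s) * s"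
        using s(1) by (simp add: power2_eq_square algebra_simps)
      finally show ?thesis .
    qed
    have X: "norm (X - (\<integral>y. indicator (disk N s) y *\<^sub>R F0 y \<partial>?H))
        \<le> 2 ^ d * (\<Lambda> * (11 * \<eta> + 73 * K\<^sup>2 * s) * s + 16 * (K * s)\<^sup>2 * (3 * \<Lambda>)) * measure ?H (disk N s)"
      unfolding X_def
    proof (rule integral_compare[OF M fin s(1) sr F_meas F0_meas F_close _ F0_b])
      fix x assume "x \<in> M" "x \<notin> piece s"
      then show "F s x = 0" using k1[OF outside] by (simp add: F_def)
    qed (use \<Lambda> \<eta> s in auto)
    have "2 ^ d * (\<Lambda> * (11 * \<eta> + 73 * K\<^sup>2 * s) * s + 16 * (K * s)\<^sup>2 * (3 * \<Lambda>)) * measure ?H (disk N s)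
        = (2 ^ d * \<mu> * \<Lambda>) * (11 * \<eta> + 121 * K\<^sup>2 * s) * s * s ^ d"
      unfolding mD by (simp add: power2_eq_square algebra_simps)
    also have "\<dots> \<le> (2 ^ d * \<mu> * \<Lambda>) * ((11 + 121 * K\<^sup>2) * (\<eta> + s)) * s * s ^ d"
      using \<eta> s(1) \<mu>0 \<Lambda> by (intro mult_right_mono mult_left_mono) (auto simp: algebra_simps)
    also have "\<dots> = C2 * (\<eta> + s) * s * s ^ d" by (simp add: C2_def mult_ac)
    finally have X2: "norm (X - (\<integral>y. indicator (disk N s) y *\<^sub>R F0 y \<partial>?H)) \<le> C2 * (\<eta> + s) * s * s ^ d"
      using X by linarith
    have X0: "(\<integral>y. indicator (disk N s) y *\<^sub>R F0 y \<partial>?H) = (tr * ?n * s / real d * D0) *\<^sub>R N"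
      unfolding F0_def tangent_plane_integral[OF n B k k_abs \<Lambda> rel s(1) Dfin[OF s(1)]] \<xi>D
      by (simp add: tr_def d D0_def)
    have "norm (D - (\<integral>y. indicator (disk N s) y *\<^sub>R \<xi> (norm y / s) \<partial>?H))
        \<le> 2 ^ d * (8 * \<Lambda> * (K * s)\<^sup>2 + 16 * (K * s)\<^sup>2 * \<Lambda>) * measure ?H (disk N s)"
      unfolding D_def
    proof (rule integral_compare[OF M fin s(1) sr])
      fix x assume x: "x \<in> piece s"
      show "norm (\<xi> (norm (x - x0) / s) - \<xi> (norm (pr x) / s)) \<le> 8 * \<Lambda> * (K * s)\<^sup>2"
        using radial_compare(1)[OF k_lip k0 \<xi>_lip s(1) sr x] by simp
    next
      fix x assume "x \<in> M" "x \<notin> piece s"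
      then show "\<xi> (norm (x - x0) / s) = 0" using \<xi>1[OF outside] by simp
    qed (use \<Lambda> \<xi>_nn \<xi>_b in auto)
    then have "\<bar>D - D0\<bar> \<le> 2 ^ d * (8 * \<Lambda> * (K * s)\<^sup>2 + 16 * (K * s)\<^sup>2 * \<Lambda>) * (s ^ d * \<mu>)"
      by (simp add: \<xi>D D0_def mD)
    also have "\<dots> = C3 * s\<^sup>2 * s ^ d" by (simp add: C3_def power2_eq_square algebra_simps)
    finally have D: "\<bar>D - D0\<bar> \<le> C3 * s\<^sup>2 * s ^ d" .
    have sd: "s ^ d > 0" using s(1) by simp
    have C3s: "C3 * s\<^sup>2 \<le> \<delta> / 2" "s\<^sup>2 \<le> s"
    proof -
      show ss: "s\<^sup>2 \<le> s" using mult_left_mono[OF s1, of s] s(1) by (simp add: power2_eq_square)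
      have "C3 * s\<^sup>2 \<le> C3 * s" using ss C3 by (rule mult_left_mono)
      also have "\<dots> \<le> (C3 + 1) * s" using s(1) by (simp add: algebra_simps)
      also have "\<dots> \<le> (C3 + 1) * (\<delta> / (2 * (C3 + 1)))" using s2 C3 by (intro mult_left_mono) auto
      also have "\<dots> = \<delta> / 2" using C3 by (simp add: field_simps)
      finally show "C3 * s\<^sup>2 \<le> \<delta> / 2" .
    qed
    have "C3 * s\<^sup>2 * s ^ d \<le> \<delta> / 2 * s ^ d" using C3s(1) sd by (intro mult_right_mono) auto
    then have DD: "\<delta> / 2 * s ^ d \<le> D" using D by (simp add: D0_def abs_le_iff algebra_simps)
    have "0 < \<delta> / 2 * s ^ d" using \<delta> sd by simp
    then have D_pos: "D > 0" using DD by linarith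
    have dn: "real d > 0" "?n > 0" using n d by auto
    \<comment> \<open>The numerator on the tangent plane over the denominator \<open>D0\<close>
      there gives exactly the limit, so only the two deviations remain, each divided by the true
      denominator.\<close>
    have eq: "- (real d / (?n * s)) *\<^sub>R (X /\<^sub>R D) - (- tr *\<^sub>R N)
        = (- (real d / (?n * s)) / D) *\<^sub>R (X - (tr * ?n * s / real d * D0) *\<^sub>R N) + (tr * ((D - D0) / D)) *\<^sub>R N"
    proof -
      have "- (real d / (?n * s)) / D * (tr * ?n * s / real d * D0) = - tr * D0 / D"
        using dn s(1) by (simp add: field_simps)
      moreover have "tr * ((D - D0) / D) = tr - tr * D0 / D" using D_pos by (simp add: field_simps)
      moreover have "- (real d / (?n * s)) *\<^sub>R (X /\<^sub>R D) = (- (real d / (?n * s)) / D) *\<^sub>R X"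
        by (simp add: divide_inverse)
      ultimately show ?thesis
        unfolding scaleR_diff_right scaleR_scaleR by (simp add: scaleR_diff_left)
    qed
    have "norm (- (real d / (?n * s)) *\<^sub>R (X /\<^sub>R D) - (- tr *\<^sub>R N))
        \<le> (real d / (?n * s)) / D * (C2 * (\<eta> + s) * s * s ^ d) + \<bar>tr\<bar> * ((C3 * s\<^sup>2 * s ^ d) / D)"
      unfolding eq
    proof (rule order_trans[OF norm_triangle_ineq add_mono])
      have "norm ((- (real d / (?n * s)) / D) *\<^sub>R (X - (tr * ?n * s / real d * D0) *\<^sub>R N))
          = (real d / (?n * s)) / D * norm (X - (tr * ?n * s / real d * D0) *\<^sub>R N)"
        using dn s(1) D_pos by (simp add: abs_mult)
      also have "\<dots> \<le> (real d / (?n * s)) / D * (C2 * (\<eta> + s) * s * s ^ d)"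
        using X2 dn s(1) D_pos unfolding X0 by (intro mult_left_mono) auto
      finally show "norm ((- (real d / (?n * s)) / D) *\<^sub>R (X - (tr * ?n * s / real d * D0) *\<^sub>R N))
          \<le> (real d / (?n * s)) / D * (C2 * (\<eta> + s) * s * s ^ d)" .
      have "norm ((tr * ((D - D0) / D)) *\<^sub>R N) = \<bar>tr\<bar> * (\<bar>D - D0\<bar> / D)"
        using N1 D_pos by (simp add: abs_mult)
      also have "\<dots> \<le> \<bar>tr\<bar> * ((C3 * s\<^sup>2 * s ^ d) / D)"
        using D D_pos by (intro mult_left_mono divide_right_mono) auto
      finally show "norm ((tr * ((D - D0) / D)) *\<^sub>R N) \<le> \<bar>tr\<bar> * ((C3 * s\<^sup>2 * s ^ d) / D)" .
    qed
    also have "\<dots> \<le> real d / ?n * (2 * C2 / \<delta>) * (\<eta> + s) + 2 * C3 / \<delta> * \<bar>tr\<bar> * (\<eta> + s)"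
    proof (rule add_mono)
      have sD: "s ^ d / D \<le> 2 / \<delta>"
        using DD D_pos \<delta> by (simp add: field_simps)
      have "(real d / (?n * s)) / D * (C2 * (\<eta> + s) * s * s ^ d) = (real d / ?n * C2 * (\<eta> + s)) * (s ^ d / D)"
        using s(1) dn D_pos by (simp add: field_simps)
      also have "\<dots> \<le> (real d / ?n * C2 * (\<eta> + s)) * (2 / \<delta>)"
        using sD C2 \<eta> s(1) by (intro mult_left_mono) auto
      finally show "(real d / (?n * s)) / D * (C2 * (\<eta> + s) * s * s ^ d) \<le> real d / ?n * (2 * C2 / \<delta>) * (\<eta> + s)"
        by (simp add: mult_ac)
      have "\<bar>tr\<bar> * ((C3 * s\<^sup>2 * s ^ d) / D) = \<bar>tr\<bar> * C3 * (s\<^sup>2 * (s ^ d / D))" by simp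
      also have "\<dots> \<le> \<bar>tr\<bar> * C3 * ((\<eta> + s) * (2 / \<delta>))"
        using C3s(2) \<eta> sD C3 s(1) D_pos by (intro mult_left_mono mult_mono) auto
      finally show "\<bar>tr\<bar> * ((C3 * s\<^sup>2 * s ^ d) / D) \<le> 2 * C3 / \<delta> * \<bar>tr\<bar> * (\<eta> + s)"
        by (simp add: mult_ac)
    qed
    also have "\<dots> = C * (\<eta> + s)" by (simp add: C_def distrib_right)
    finally show ?thesis unfolding X_def D_def .
  qed
  then show ?thesis using s0 unfolding tr_def by blast
qed

end

subsection \<open>The varifold of a submanifold and the convergence\<close>

lemma Ck_on_compact_support_lipschitz:
  fixes f :: "real \<Rightarrow> real"
  assumes C1: "Ck_on (Suc 0) f UNIV" and supp: "\<And>t. \<bar>t\<bar> > 1 \<Longrightarrow> f t = 0"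
  shows "\<exists>\<Lambda>. \<forall>t u. \<bar>f t - f u\<bar> \<le> \<Lambda> * \<bar>t - u\<bar>"
proof -
  have d: "(f has_derivative frechet_derivative f (at x)) (at x)" for x
    using C1 by (simp add: frechet_derivative_works)
  have "continuous_on {-2..2} (\<lambda>x. frechet_derivative f (at x) 1)"
    using C1 by (auto intro: continuous_on_subset)
  then have "bounded ((\<lambda>x. frechet_derivative f (at x) 1) ` {-2..2})"
    by (intro compact_imp_bounded compact_continuous_image) auto
  then obtain \<Lambda> where "\<forall>x\<in>{-2..2}. \<bar>frechet_derivative f (at x) 1\<bar> \<le> \<Lambda>"
    unfolding bounded_iff by auto
  then have \<Lambda>: "\<And>x. x \<in> {-2..2} \<Longrightarrow> \<bar>frechet_derivative f (at x) 1\<bar> \<le> \<Lambda>" by blast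
  have lip: "\<bar>f t - f u\<bar> \<le> \<Lambda> * \<bar>t - u\<bar>" if "t \<in> {-2..2}" "u \<in> {-2..2}" for t u
  proof -
    have "norm (f t - f u) \<le> \<Lambda> * norm (t - u)"
    proof (rule differentiable_bound[where S="{-2..2}" and f'="\<lambda>x. frechet_derivative f (at x)"])
      fix x :: real assume x: "x \<in> {-2..2}"
      show "(f has_derivative frechet_derivative f (at x)) (at x within {-2..2})"
        by (rule has_derivative_at_withinI[OF d])
      show "onorm (frechet_derivative f (at x)) \<le> \<Lambda>"
      proof (rule onorm_bound)
        show "0 \<le> \<Lambda>" using \<Lambda>[OF x] by linarith
        fix h :: real
        have "frechet_derivative f (at x) h = h * frechet_derivative f (at x) 1"
          using linear_scale[OF has_derivative_linear[OF d], of x h 1] by simp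
        then show "norm (frechet_derivative f (at x) h) \<le> \<Lambda> * norm h"
          using mult_right_mono[OF \<Lambda>[OF x], of "\<bar>h\<bar>"] by (simp add: abs_mult mult.commute)
      qed
    qed (use that in auto)
    then show ?thesis by simp
  qed
  have "\<bar>f t - f u\<bar> \<le> \<Lambda> * \<bar>t - u\<bar>" for t u
  proof -
    \<comment> \<open>Clamping to \<open>{-2..2}\<close> is 1-Lipschitz and does not change
      \<open>f\<close>: a point that moves lies beyond the support, and so does its image.\<close>
    define c :: "real \<Rightarrow> real" where "c x = max (-2) (min 2 x)" for x
    have c: "c x \<in> {-2..2}" "f (c x) = f x" for x
      using supp[of x] supp[of "c x"] by (auto simp: c_def max_def min_def)
    have "0 \<le> \<Lambda>" using \<Lambda>[of 0] by (simp add: order_trans[OF abs_ge_zero])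
    moreover have "\<bar>c t - c u\<bar> \<le> \<bar>t - u\<bar>" by (auto simp: c_def max_def min_def)
    ultimately have "\<Lambda> * \<bar>c t - c u\<bar> \<le> \<Lambda> * \<bar>t - u\<bar>" by (intro mult_left_mono)
    then show ?thesis using lip[OF c(1)[of t] c(1)[of u]] by (simp add: c(2))
  qed
  then show ?thesis by blast
qed

text \<open>Points slightly farther out, where \<open>f\<close> vanishes, force the value at the
  endpoints.\<close>

lemma lipschitz_vanishes_at_boundary:
  fixes f :: "real \<Rightarrow> real"
  assumes lip: "\<And>t u. \<bar>f t - f u\<bar> \<le> \<Lambda> * \<bar>t - u\<bar>" and supp: "\<And>t. \<bar>t\<bar> > 1 \<Longrightarrow> f t = 0"
    and t: "\<bar>t\<bar> \<ge> 1"
  shows "f t = 0"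
proof -
  have "\<bar>f t\<bar> \<le> 0"
  proof (rule field_le_epsilon)
    fix e :: real assume e: "e > 0"
    have \<Lambda>: "\<Lambda> \<ge> 0" using lip[of 1 0] by (auto intro: order_trans[OF abs_ge_zero])
    define u where "u = t + sgn t * (e / (\<Lambda> + 1))"
    have "e / (\<Lambda> + 1) > 0" using e \<Lambda> by simp
    then have "\<bar>u\<bar> > 1" using t by (auto simp: u_def sgn_if abs_if split: if_splits)
    moreover have "\<bar>t - u\<bar> = e / (\<Lambda> + 1)" using t e \<Lambda> by (auto simp: u_def sgn_if)
    ultimately have "\<bar>f t\<bar> \<le> \<Lambda> * (e / (\<Lambda> + 1))" using lip[of t u] supp[of u] by simp
    also have "\<dots> \<le> e" using e \<Lambda> by (simp add: field_simps)
    finally show "\<bar>f t\<bar> \<le> 0 + e" by simp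
  qed
  then show ?thesis by simp
qed

section \<open>Borel structure of the submanifold, its tangent planes and its varifold\<close>

lemma submanifold_borel:
  fixes M :: "(real^'n) set"
  assumes M: "submanifold k (CARD('n) - 1) M" and k: "k = 2 \<or> k = 3"
  shows "M \<in> sets borel"
proof -
  \<comment> \<open>The union of the open sets in which \<open>M\<close> is relatively closed. It
    contains \<open>M\<close> because zero sets of continuous functions are closed, and it exhibits
    \<open>M\<close> as the intersection of an open set with its closure.\<close>
  define O' where "O' = \<Union>{U. open U \<and> U \<inter> closure M \<subseteq> M}"
  have "M \<subseteq> O'"
  proof
    fix x assume "x \<in> M"
    then obtain U g G DG where def: "defining_function k M U g G DG" and xU: "x \<in> U"
      using submanifold_defining_function[OF M k] by blast
    note U = defining_functionD(1)[OF def] xU and g = defining_functionD(2)[OF def]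
      and Mg = defining_functionD(3)[OF def]
    have "U \<inter> closure M \<subseteq> M"
    proof
      fix y assume y: "y \<in> U \<inter> closure M"
      then obtain X where X: "\<And>n. X n \<in> M" "X \<longlonglongrightarrow> y" by (auto simp: closure_sequential)
      have "isCont g y" using has_derivative_continuous[OF g] y by blast
      then have "(\<lambda>n. g (X n)) \<longlonglongrightarrow> g y" using X(2) by (rule isCont_tendsto_compose)
      moreover have "\<forall>\<^sub>F n in sequentially. X n \<in> U"
        using topological_tendstoD[OF X(2) U(1)] y by blast
      then have "\<forall>\<^sub>F n in sequentially. g (X n) = 0"
        by eventually_elim (use X(1) Mg in blast)
      then have "(\<lambda>n. g (X n)) \<longlonglongrightarrow> 0" by (rule tendsto_eventually)
      ultimately have "g y = 0" by (rule LIMSEQ_unique)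
      then show "y \<in> M" using Mg y by blast
    qed
    with U show "x \<in> O'" by (auto simp: O'_def)
  qed
  then have "M = O' \<inter> closure M" using closure_subset[of M] by (auto simp: O'_def)
  moreover have "open O'" by (auto simp: O'_def)
  ultimately show ?thesis by (metis borel_open borel_closed closed_closure sets.Int)
qed

lemma tangent_space_grassmannian:
  fixes M :: "(real^'n) set"
  assumes M: "submanifold k (CARD('n) - 1) M" and k: "k = 2 \<or> k = 3" and x: "x \<in> M"
  shows "tangent_space M x \<in> grassmannian (CARD('n) - 1)"
proof -
  obtain U g G DG where def: "defining_function k M U g G DG" and xU: "x \<in> U"
    using submanifold_defining_function[OF M k x] .
  have "G x \<noteq> 0" "tangent_space M x = {v. G x \<bullet> v = 0}"
    using defining_functionD(4,7)[OF def xU] x by simp_all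
  then show ?thesis by (simp add: grassmannian_def subspace_hyperplane dim_hyperplane)
qed

text \<open>\<open>grassmannian_borel\<close> is pulled back along the projector matrix, so
  measurability of \<open>tangent_space M\<close> amounts to that of this matrix field. Locally its
  entries are rational functions of \<open>G\<close>.\<close>

lemma continuous_on_tangent_projection:
  fixes M :: "(real^'n) set"
  assumes M: "submanifold k (CARD('n) - 1) M" and k: "k = 2 \<or> k = 3"
  shows "continuous_on M (\<lambda>x. matrix (oproj (tangent_space M x)))"
  unfolding continuous_on_eq_continuous_within
proof
  fix x assume x: "x \<in> M"
  obtain U g G DG where def: "defining_function k M U g G DG" and xU: "x \<in> U"
    using submanifold_defining_function[OF M k x] .
  note U = defining_functionD(1)[OF def] xU and G = defining_functionD(4,5)[OF def]
    and T = defining_functionD(7)[OF def]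
  have Gc: "continuous_on (M \<inter> U) G"
    by (intro continuous_at_imp_continuous_on ballI has_derivative_continuous[OF G(2)]) auto
  have "continuous_on (M \<inter> U) (\<lambda>y. (\<chi> i j. (axis j 1 - (G y \<bullet> axis j 1 / (G y \<bullet> G y)) *\<^sub>R G y) $ i) :: real^'n^'n)"
    using G(1) by (intro continuous_on_vec_lambda continuous_intros Gc) auto
  also have "?this \<longleftrightarrow> continuous_on (M \<inter> U) (\<lambda>y. matrix (oproj (tangent_space M y)))"
    by (intro continuous_on_cong refl) (simp add: matrix_def T oproj_hyperplane G(1))
  finally have "continuous (at x within M \<inter> U) (\<lambda>y. matrix (oproj (tangent_space M y)))"
    using x U by (auto simp: continuous_on_eq_continuous_within)
  moreover have "at x within M \<inter> U = at x within M"
    using U by (intro at_within_nhd[of x U]) auto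
  ultimately show "continuous (at x within M) (\<lambda>y. matrix (oproj (tangent_space M y)))" by simp
qed

text \<open>The Borel structure of the Grassmannian sees \<open>oproj S\<close> as a matrix, and
  applying a matrix to a vector is jointly continuous. On genuine subspaces \<open>oproj\<close> is
  linear, so its matrix represents it.\<close>

lemma measurable_oproj [measurable]:
  assumes [measurable]: "f \<in> borel_measurable (N :: 'a measure)" and S: "T \<in> measurable N (grassmannian_borel d)"
  shows "(\<lambda>x. oproj (T x) (f x)) \<in> borel_measurable N"
proof -
  have "(\<lambda>S. matrix (oproj S)) \<in> borel_measurable (grassmannian_borel d :: (real^'n) set measure)"
    unfolding grassmannian_borel_def by (rule measurable_vimage_algebra1) auto
  from measurable_compose[OF S this]
  have "(\<lambda>x. matrix (oproj (T x))) \<in> borel_measurable N" .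
  then have "(\<lambda>x. matrix (oproj (T x)) *v f x) \<in> borel_measurable N"
  proof (rule borel_measurable_continuous_Pair[OF _ assms(1)])
    show "continuous_on UNIV (\<lambda>p. fst p *v snd p :: real^'n)"
      unfolding matrix_vector_mult_def by (intro continuous_on_vec_lambda continuous_intros)
  qed
  moreover have "matrix (oproj (T x)) *v f x = oproj (T x) (f x)" if "x \<in> space N" for x
  proof -
    have "T x \<in> grassmannian d"
      using measurable_space[OF S that] by (simp add: grassmannian_borel_def)
    then show ?thesis by (simp add: grassmannian_def linear_oproj matrix_works)
  qed
  ultimately show ?thesis by (simp cong: measurable_cong)
qed

lemma measurable_projection_choices:
  fixes M :: "(real^'n) set" and h :: "(real^'n) \<Rightarrow> real"
  assumes P: "P \<in> projection_choices M x0" and h[measurable]: "h \<in> borel_measurable borel"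
    and T0: "subspace (tangent_space M x0)"
  shows "(\<lambda>p. h (fst p) *\<^sub>R P (fst p) (snd p) (fst p - x0)) \<in> borel_measurable (borel \<Otimes>\<^sub>M grassmannian_borel d)"
proof -
  let ?B = "borel \<Otimes>\<^sub>M grassmannian_borel d :: ((real^'n) \<times> (real^'n) set) measure"
  have S: "snd p \<in> grassmannian d" if "p \<in> space ?B" for p
    using that by (auto simp: space_pair_measure grassmannian_borel_def)
  have 1[measurable]: "(\<lambda>p. oproj (snd p) (fst p - x0)) \<in> borel_measurable ?B" by measurable
  have 2[measurable]: "(\<lambda>p. oproj ((snd p)\<^sup>\<bottom>) (fst p - x0)) \<in> borel_measurable ?B"
  proof -
    have "(\<lambda>p. (fst p - x0) - oproj (snd p) (fst p - x0)) \<in> borel_measurable ?B" by measurable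
    then show ?thesis
      by (rule measurable_cong[THEN iffD1, rotated])
         (use S in \<open>auto simp: oproj_orthogonal_comp grassmannian_def\<close>)
  qed
  let ?N = "oproj ((tangent_space M x0)\<^sup>\<bottom>)"
  have "linear ?N" by (intro linear_oproj subspace_orthogonal_comp)
  then have [measurable]: "?N \<in> borel_measurable borel"
    using linear_continuous_on[of ?N UNIV] by (intro borel_measurable_continuous_onI) (simp add: linear_conv_bounded_linear)
  from P consider "P = (\<lambda>x S v. oproj S v)" | "P = (\<lambda>x S v. - 2 *\<^sub>R oproj (S\<^sup>\<bottom>) v)"
    | "P = (\<lambda>x S v. 2 *\<^sub>R v)" | "P = (\<lambda>x S v. ?N (oproj S v))"
    | "P = (\<lambda>x S v. - 2 *\<^sub>R ?N (oproj (S\<^sup>\<bottom>) v))" | "P = (\<lambda>x S v. 2 *\<^sub>R ?N v)"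
    unfolding projection_choices_def Let_def by blast
  then show ?thesis by cases (simp_all, measurable)
qed

lemma measurable_tangent_lift:
  fixes M :: "(real^'n) set"
  assumes M: "submanifold k (CARD('n) - 1) M" and k: "k = 2 \<or> k = 3"
  shows "(\<lambda>x. (x, tangent_space M x)) \<in> measurable (restrict_space (hausdorff_measure d) M) (borel \<Otimes>\<^sub>M grassmannian_borel (CARD('n) - 1))"
proof -
  have sets: "sets (restrict_space (hausdorff_measure d) M) = sets (restrict_space borel M)"
    by (rule sets_restrict_space_cong) simp
  have "(\<lambda>x. matrix (oproj (tangent_space M x))) \<in> borel_measurable (restrict_space borel M)"
    by (rule borel_measurable_continuous_on_restrict[OF continuous_on_tangent_projection[OF M k]])
  then have "tangent_space M \<in> measurable (restrict_space borel M) (grassmannian_borel (CARD('n) - 1))"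
    unfolding grassmannian_borel_def
    by (rule measurable_vimage_algebra2[rotated])
       (simp add: space_restrict_space Pi_iff tangent_space_grassmannian[OF M k] del: One_nat_def)
  then show ?thesis
    unfolding measurable_cong_sets[OF sets refl]
    by (rule measurable_Pair[OF measurable_restrict_space1[OF measurable_ident_sets[OF refl]]])
qed

lemma integral_submanifold_varifold:
  fixes M :: "(real^'n) set" and F :: "(real^'n) \<times> (real^'n) set \<Rightarrow> 'b::{banach, second_countable_topology}"
  assumes M: "submanifold k (CARD('n) - 1) M" and k: "k = 2 \<or> k = 3"
    and F: "F \<in> borel_measurable (borel \<Otimes>\<^sub>M grassmannian_borel (CARD('n) - 1))"
  shows "(\<integral>p. F p \<partial>submanifold_varifold (CARD('n) - 1) M)
      = (\<integral>x. indicator M x *\<^sub>R F (x, tangent_space M x) \<partial>hausdorff_measure (CARD('n) - 1))"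
    and "(\<lambda>x. indicator M x *\<^sub>R F (x, tangent_space M x)) \<in> borel_measurable borel"
proof -
  let ?H = "hausdorff_measure (CARD('n) - 1) :: (real^'n) measure"
  note T = measurable_tangent_lift[OF M k, of "CARD('n) - 1"]
  have Mb: "M \<inter> space ?H \<in> sets ?H" using submanifold_borel[OF M k] by simp
  have "(\<integral>p. F p \<partial>submanifold_varifold (CARD('n) - 1) M)
      = (\<integral>x. F (x, tangent_space M x) \<partial>restrict_space ?H M)"
    unfolding submanifold_varifold_def by (rule integral_distr[OF T F])
  also have "\<dots> = (\<integral>x. indicator M x *\<^sub>R F (x, tangent_space M x) \<partial>?H)"
    by (rule integral_restrict_space[OF Mb])
  finally show "(\<integral>p. F p \<partial>submanifold_varifold (CARD('n) - 1) M)
      = (\<integral>x. indicator M x *\<^sub>R F (x, tangent_space M x) \<partial>?H)" .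
  have "(\<lambda>x. F (x, tangent_space M x)) \<in> borel_measurable (restrict_space ?H M)"
    by (rule measurable_compose[OF T F])
  then have "(\<lambda>x. indicator M x *\<^sub>R F (x, tangent_space M x)) \<in> borel_measurable ?H"
    using Mb by (simp add: borel_measurable_restrict_space_iff)
  then show "(\<lambda>x. indicator M x *\<^sub>R F (x, tangent_space M x)) \<in> borel_measurable borel"
    by (simp cong: measurable_cong_sets)
qed

lemma approx_mean_curvature_submanifold:
  fixes M :: "(real^'n) set"
  assumes M: "submanifold k (CARD('n) - 1) M" and k: "k = 2 \<or> k = 3" and x0: "x0 \<in> M"
    and P: "P \<in> projection_choices M x0"
    and \<rho>: "deriv \<rho> \<in> borel_measurable borel" and \<xi>: "\<xi> \<in> borel_measurable borel"
    and F_def: "\<And>x. F x = (deriv \<rho> (norm (x - x0) / \<epsilon>) / norm (x - x0)) *\<^sub>R P x (tangent_space M x) (x - x0)"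
  shows "approx_mean_curvature \<rho> \<xi> (CARD('n) - 1) \<epsilon> P x0 (submanifold_varifold (CARD('n) - 1) M)
     = - (real (CARD('n) - 1) / (real CARD('n) * \<epsilon>)) *\<^sub>R
         ((\<integral>x. indicator M x *\<^sub>R F x \<partial>hausdorff_measure (CARD('n) - 1))
            /\<^sub>R (\<integral>x. indicator M x *\<^sub>R \<xi> (norm (x - x0) / \<epsilon>) \<partial>hausdorff_measure (CARD('n) - 1)))"
    and "(\<lambda>x. indicator M x *\<^sub>R F x) \<in> borel_measurable borel"
proof -
  let ?V = "submanifold_varifold (CARD('n) - 1) M"
  let ?B = "borel \<Otimes>\<^sub>M grassmannian_borel (CARD('n) - 1) :: ((real^'n) \<times> (real^'n) set) measure"
  have T0: "subspace (tangent_space M x0)"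
    using tangent_space_grassmannian[OF M k x0] by (simp add: grassmannian_def)
  let ?X = "\<integral>x. indicator M x *\<^sub>R F x \<partial>hausdorff_measure (CARD('n) - 1)"
  let ?Y = "\<integral>x. indicator M x *\<^sub>R \<xi> (norm (x - x0) / \<epsilon>) \<partial>hausdorff_measure (CARD('n) - 1)"
  let ?Z = "\<integral>(x, S). (if x = x0 then 0 else (deriv \<rho> (norm (x - x0) / \<epsilon>) / norm (x - x0)) *\<^sub>R P x S (x - x0)) \<partial>?V"
  note [measurable] = \<rho> \<xi>
  define h where "h x = deriv \<rho> (norm (x - x0) / \<epsilon>) / norm (x - x0)" for x
  have [measurable]: "h \<in> borel_measurable borel" unfolding h_def by measurable
  have meas: "(\<lambda>p. h (fst p) *\<^sub>R P (fst p) (snd p) (fst p - x0)) \<in> borel_measurable ?B"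
    by (rule measurable_projection_choices[OF P _ T0]) measurable
  note I = integral_submanifold_varifold[OF M k meas]
  show "(\<lambda>x. indicator M x *\<^sub>R F x) \<in> borel_measurable borel"
    using I(2) by (simp add: F_def h_def)
  \<comment> \<open>At \<open>x = x0\<close> the factor \<open>h\<close> is 0 by division by zero,
    which absorbs the case distinction in the definition.\<close>
  have "?Z
      = (\<integral>p. h (fst p) *\<^sub>R P (fst p) (snd p) (fst p - x0) \<partial>?V)"
    by (intro Bochner_Integration.integral_cong) (auto simp: h_def)
  also have "\<dots> = ?X"
    by (subst I(1)) (simp add: F_def h_def)
  finally have num: "?Z
      = ?X" .
  have fst_V: "fst \<in> borel_measurable ?V"
    unfolding submanifold_varifold_def by simp
  have "(\<integral>x. \<xi> (norm (x - x0) / \<epsilon>) \<partial>mass ?V) = (\<integral>p. \<xi> (norm (fst p - x0) / \<epsilon>) \<partial>?V)"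
    unfolding mass_def by (rule integral_distr[OF fst_V]) measurable
  also have "\<dots> = ?Y"
    by (subst integral_submanifold_varifold(1)[OF M k]) simp_all
  finally have den: "(\<integral>x. \<xi> (norm (x - x0) / \<epsilon>) \<partial>mass ?V)
      = ?Y" .
  show "approx_mean_curvature \<rho> \<xi> (CARD('n) - 1) \<epsilon> P x0 ?V
     = - (real (CARD('n) - 1) / (real CARD('n) * \<epsilon>)) *\<^sub>R
         (?X
            /\<^sub>R ?Y)"
    unfolding approx_mean_curvature_def num den ..
qed

section \<open>Normalised charts, with a quadratic remainder in class 3\<close>

lemma submanifold_chart:
  fixes M :: "(real^'n) set"
  assumes M: "submanifold k (CARD('n) - 1) M" and k: "k = 2 \<or> k = 3" and x0: "x0 \<in> M"
  obtains g G Q r K B where "hypersurface_chart M x0 g G Q r K"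
    "orthonormal_basis {v. G x0 \<bullet> v = 0} B" "mean_curvature M x0 = - (\<Sum>b\<in>B. Q b \<bullet> b) *\<^sub>R G x0"
    "(G has_derivative Q) (at x0)"
    "k = 3 \<longrightarrow> (\<exists>C e. e > 0 \<and> (\<forall>z. norm (z - x0) < e \<longrightarrow> norm (G z - G x0 - Q (z - x0)) \<le> C * (norm (z - x0))\<^sup>2))"
proof -
  obtain U g1 G1 DG1 where def: "defining_function k M U g1 G1 DG1" and xU: "x0 \<in> U"
    using submanifold_defining_function[OF M k x0] .
  note U = defining_functionD(1)[OF def] xU and g1 = defining_functionD(2)[OF def]
    and M1 = defining_functionD(3)[OF def] and G1 = defining_functionD(4,5)[OF def]
    and DG1 = defining_functionD(6)[OF def] and T1 = defining_functionD(7)[OF def]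
  define c where "c = norm (G1 x0)"
  have c: "c > 0" using G1(1)[OF U(2)] by (simp add: c_def)
  define g where "g x = g1 x / c" for x
  define G where "G x = G1 x /\<^sub>R c" for x
  define DG where "DG x w = DG1 x w /\<^sub>R c" for x w
  have g: "(g has_derivative (\<lambda>h. G x \<bullet> h)) (at x)" if "x \<in> U" for x
  proof -
    have "(g has_derivative (\<lambda>h. (G1 x \<bullet> h) * inverse c)) (at x)"
      unfolding g_def divide_inverse using g1[OF that] by (rule has_derivative_mult_left)
    moreover have "(\<lambda>h. (G1 x \<bullet> h) * inverse c) = (\<lambda>h. G x \<bullet> h)" by (simp add: G_def fun_eq_iff mult.commute)
    ultimately show ?thesis by simp
  qed
  have Mg: "x \<in> M \<longleftrightarrow> g x = 0" if "x \<in> U" for x using M1[OF that] c by (simp add: g_def)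
  have GU: "G x \<noteq> 0" if "x \<in> U" for x using G1(1)[OF that] c by (simp add: G_def)
  have DG: "(G has_derivative DG x) (at x)" if "x \<in> U" for x
    unfolding G_def DG_def using G1(2)[OF that] by (rule has_derivative_scaleR_right)
  have DG3: "(\<lambda>x. DG x w) differentiable (at x)" if "k = 3" "x \<in> U" for w x
    unfolding DG_def using DG1[OF that] by (intro differentiable_scaleR differentiable_const)
  have T: "tangent_space M x = {v. G x \<bullet> v = 0}" if "x \<in> U" "x \<in> M" for x
    using T1[OF that] c by (simp add: G_def)
  have N: "norm (G x0) = 1" using c by (simp add: G_def c_def)
  obtain B where B: "orthonormal_basis {v. G x0 \<bullet> v = 0} B"
      and H: "mean_curvature M x0 = - ((\<Sum>b\<in>B. DG x0 b \<bullet> b) / (G x0 \<bullet> G x0)) *\<^sub>R G x0"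
    using mean_curvature_level_set[OF U x0 DG[OF U(2)] GU[OF U(2)] T] by blast
  have bl: "bounded_linear (DG x0)" using DG[OF U(2)] by (rule has_derivative_bounded_linear)
  \<comment> \<open>The summand 1 is the tolerance with which differentiability of \<open>G\<close>
    at \<open>x0\<close> is used just below.\<close>
  define K where "K = onorm (DG x0) + 1"
  have on: "onorm (DG x0) \<ge> 0" using bl by (rule onorm_pos_le)
  obtain e where e: "e > 0" "\<And>y. norm (y - x0) < e \<Longrightarrow> norm (G y - G x0 - DG x0 (y - x0)) \<le> 1 * norm (y - x0)"
    using DG[OF U(2)] unfolding has_derivative_at_alt by (metis zero_less_one)
  obtain e' where e': "e' > 0" "ball x0 e' \<subseteq> U" using U by (meson openE)
  \<comment> \<open>Halving puts closed balls inside the open ones, and the last entry ensures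
    \<open>K * r \<le> 1/4\<close>.\<close>
  define r where "r = min (e / 2) (min (e' / 2) (1 / (4 * K)))"
  have r: "r > 0" using e(1) e'(1) on by (simp add: r_def K_def)
  have rU: "x \<in> U" if "x \<in> cball x0 r" for x
    using that e' by (auto simp: r_def intro!: subsetD[OF e'(2)])
  have chart: "hypersurface_chart M x0 g G (DG x0) r K"
  proof (rule hypersurface_chart.intro)
    show "r > 0" by (rule r)
    show "K \<ge> 0" using on by (simp add: K_def)
    have "K * r \<le> K * (1 / (4 * K))" using on by (intro mult_left_mono) (auto simp: r_def K_def)
    also have "\<dots> = 1/4" using on by (simp add: K_def)
    finally show "K * r \<le> 1/4" .
    show "norm (G x - G x0) \<le> K * norm (x - x0)" if "x \<in> cball x0 r" for x
    proof -
      have "norm (x - x0) < e" using that e(1) by (auto simp: r_def dist_norm norm_minus_commute)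
      from e(2)[OF this] have "norm (G x - G x0) \<le> norm (DG x0 (x - x0)) + norm (x - x0)" by norm
      also have "norm (DG x0 (x - x0)) \<le> onorm (DG x0) * norm (x - x0)" using bl by (rule onorm)
      finally show ?thesis by (simp add: K_def algebra_simps)
    qed
    show "linear (DG x0)" using bl by (rule bounded_linear.linear)
    show "norm (DG x0 h) \<le> K * norm h" for h
    proof -
      have "norm (DG x0 h) \<le> onorm (DG x0) * norm h" using bl by (rule onorm)
      also have "\<dots> \<le> K * norm h" by (intro mult_right_mono) (auto simp: K_def)
      finally show ?thesis .
    qed
  qed (use x0 N g Mg T rU in auto)
  \<comment> \<open>The remainder of \<open>G\<close> has derivative \<open>DG y - DG x0\<close>, of
    order \<open>norm (y - x0)\<close>; the mean value inequality on the ball reaching to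
    \<open>z\<close> gains one more order.\<close>
  have C3: "\<exists>C e. e > 0 \<and> (\<forall>z. norm (z - x0) < e \<longrightarrow> norm (G z - G x0 - DG x0 (z - x0)) \<le> C * (norm (z - x0))\<^sup>2)"
    if k3: "k = 3"
  proof -
    have "\<exists>C d. d > 0 \<and> (\<forall>z. norm (z - x0) < d \<longrightarrow> norm (DG z b - DG x0 b) \<le> C * norm (z - x0))" for b
    proof -
      obtain D where D: "((\<lambda>x. DG x b) has_derivative D) (at x0)"
        using DG3[OF k3 U(2)] unfolding differentiable_def by blast
      then have blD: "bounded_linear D" by (rule has_derivative_bounded_linear)
      obtain d where d: "d > 0" "\<And>y. norm (y - x0) < d \<Longrightarrow> norm (DG y b - DG x0 b - D (y - x0)) \<le> 1 * norm (y - x0)"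
        using D unfolding has_derivative_at_alt by (metis zero_less_one)
      have "norm (DG z b - DG x0 b) \<le> (onorm D + 1) * norm (z - x0)" if "norm (z - x0) < d" for z
      proof -
        from d(2)[OF that] have "norm (DG z b - DG x0 b) \<le> norm (D (z - x0)) + norm (z - x0)" by norm
        also have "norm (D (z - x0)) \<le> onorm D * norm (z - x0)" using blD by (rule onorm)
        finally show ?thesis by (simp add: algebra_simps)
      qed
      with d(1) show ?thesis by blast
    qed
    then obtain C d where Cd: "\<And>b. d b > 0" "\<And>b z. norm (z - x0) < d b \<Longrightarrow> norm (DG z b - DG x0 b) \<le> C b * norm (z - x0)"
      by metis
    \<comment> \<open>Differentiability is known for each \<open>DG x b\<close> separately, so the
      bounds are summed over the basis.\<close>
    define C' where "C' = (\<Sum>b\<in>Basis. C b)"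
    define d' where "d' = Min (insert e' (d ` (Basis :: (real^'n) set)))"
    have d'_pos: "d' > 0" using e'(1) Cd(1) by (auto simp: d'_def)
    have "d' \<le> e'" "d' \<le> d b" if "b \<in> Basis" for b
      unfolding d'_def by (rule Min_le; use that in simp)+
    then have d': "d' > 0" "d' \<le> e'" "\<And>b. b \<in> Basis \<Longrightarrow> d' \<le> d b"
      using d'_pos SOME_Basis by blast+
    have "norm (G z - G x0 - DG x0 (z - x0)) \<le> C' * (norm (z - x0))\<^sup>2" if z: "norm (z - x0) < d'" for z
    proof -
      define s where "s = norm (z - x0)"
      define R where "R y = G y - G x0 - DG x0 (y - x0)" for y
      have "norm (R z - R x0) \<le> (C' * s) * norm (z - x0)"
      proof (rule differentiable_bound[where S="cball x0 s" and f'="\<lambda>y w. DG y w - 0 - DG x0 (w - 0)"])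
        fix y assume "y \<in> cball x0 s"
        then have ys: "norm (y - x0) \<le> s" and yd: "norm (y - x0) < d'"
          using z by (auto simp: s_def dist_norm norm_minus_commute)
        have yU: "y \<in> U" using yd d' by (intro subsetD[OF e'(2)]) (auto simp: dist_norm norm_minus_commute)
        show "(R has_derivative (\<lambda>w. DG y w - 0 - DG x0 (w - 0))) (at y within cball x0 s)"
          unfolding R_def
          by (intro has_derivative_diff has_derivative_const has_derivative_at_withinI[OF DG[OF yU]]
              bounded_linear.has_derivative[OF bl] has_derivative_ident)
        show "onorm (\<lambda>w. DG y w - 0 - DG x0 (w - 0)) \<le> C' * s"
        proof (rule onorm_le)
          fix w
          have lin: "linear (\<lambda>w. DG y w - DG x0 w)"
            using has_derivative_linear[OF DG[OF yU]] bounded_linear.linear[OF bl] by (rule linear_compose_sub)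
          have "DG y w - DG x0 w = (\<Sum>b\<in>Basis. (w \<bullet> b) *\<^sub>R (DG y b - DG x0 b))"
            using linear_sum[OF lin, of "\<lambda>b. (w \<bullet> b) *\<^sub>R b" Basis] linear_scale[OF lin]
            by (simp add: euclidean_representation)
          also have "norm \<dots> \<le> (\<Sum>b\<in>Basis. norm w * (C b * s))"
          proof (rule sum_norm_le)
            fix b :: "real^'n" assume b: "b \<in> Basis"
            have "norm (DG y b - DG x0 b) \<le> C b * norm (y - x0)" using yd d'(3)[OF b] by (intro Cd(2)) linarith
            moreover have "C b * norm (y - x0) \<le> C b * s"
            \<comment> \<open>The sign of \<open>C b\<close> is not given. It is read off from
              \<open>y\<close> if \<open>y\<close> differs from \<open>x0\<close>, and otherwise the
              bound at \<open>z\<close> takes its place.\<close>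
            proof (cases "y = x0")
              case False
              have "0 \<le> C b * norm (y - x0)" using calculation norm_ge_zero order_trans by blast
              then have "0 \<le> C b" using False by (simp add: zero_le_mult_iff)
              then show ?thesis using ys by (rule mult_left_mono[rotated])
            next
              case True
              have "norm (DG z b - DG x0 b) \<le> C b * norm (z - x0)"
                using z d'(3)[OF b] by (intro Cd(2)) linarith
              then have "0 \<le> C b * norm (z - x0)" using norm_ge_zero order_trans by blast
              then show ?thesis using True by (simp add: s_def)
            qed
            ultimately show "norm ((w \<bullet> b) *\<^sub>R (DG y b - DG x0 b)) \<le> norm w * (C b * s)"
              unfolding norm_scaleR using Basis_le_norm[OF b, of w] by (intro mult_mono) auto
          qed
          also have "\<dots> = C' * s * norm w" by (simp add: C'_def sum_distrib_left sum_distrib_right mult_ac)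
          finally show "norm (DG y w - 0 - DG x0 (w - 0)) \<le> C' * s * norm w" by simp
        qed
      qed (auto simp: s_def dist_norm norm_minus_commute)
      moreover have "R x0 = 0" by (simp add: R_def linear_0[OF bounded_linear.linear[OF bl]])
      ultimately show ?thesis by (simp add: R_def s_def power2_eq_square)
    qed
    with d'(1) show ?thesis by blast
  qed
  have "mean_curvature M x0 = - (\<Sum>b\<in>B. DG x0 b \<bullet> b) *\<^sub>R G x0"
    using H N by (simp add: norm_eq_1)
  then show ?thesis using that[OF chart B _ DG[OF U(2)]] C3 by blast
qed

section \<open>Convergence and rate\<close>

lemma approx_mean_curvature_convergence:
  fixes M :: "(real^'n) set" and \<rho> \<xi> :: "real \<Rightarrow> real"
  assumes n: "CARD('n) \<ge> 2" and d: "d = CARD('n) - 1"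
    and M: "submanifold k d M" and k: "k = 2 \<or> k = 3" and fin: "emeasure (hausdorff_measure d) M < \<infinity>"
    and \<rho>C: "Ck_on 2 \<rho> UNIV" and \<xi>C: "Ck_on 1 \<xi> UNIV" and \<xi>_nn: "\<And>s. \<xi> s \<ge> 0"
    and \<rho>_even: "\<And>s. \<rho> (- s) = \<rho> s" and \<xi>_even: "\<And>s. \<xi> (- s) = \<xi> s"
    and \<rho>_supp: "closure {s. \<rho> s \<noteq> 0} \<subseteq> {-1..1}" and \<xi>_supp: "closure {s. \<xi> s \<noteq> 0} \<subseteq> {-1..1}"
    and \<xi>_pos: "\<And>s. s \<in> {0<..<1} \<Longrightarrow> \<xi> s > 0"
    and rel: "\<And>s. s \<in> {-1<..<1} \<Longrightarrow> real CARD('n) * \<xi> s = - s * deriv \<rho> s"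
    and x0: "x0 \<in> M" and P: "P \<in> projection_choices M x0"
  defines "H \<equiv> \<lambda>\<epsilon>. approx_mean_curvature \<rho> \<xi> d \<epsilon> P x0 (submanifold_varifold d M)"
  shows "(H \<longlongrightarrow> mean_curvature M x0) (at_right 0)"
    and "k = 3 \<Longrightarrow> (\<lambda>\<epsilon>. norm (H \<epsilon> - mean_curvature M x0)) \<in> O[at_right 0](\<lambda>\<epsilon>. \<epsilon>)"
proof -
  have \<rho>0: "\<rho> t = 0" if "\<bar>t\<bar> > 1" for t
    using \<rho>_supp closure_subset[of "{s. \<rho> s \<noteq> 0}"] that by (fastforce simp: abs_if split: if_splits)
  have \<xi>0: "\<xi> t = 0" if "\<bar>t\<bar> > 1" for t
    using \<xi>_supp closure_subset[of "{s. \<xi> s \<noteq> 0}"] that by (fastforce simp: abs_if split: if_splits)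
  have \<rho>d: "(\<rho> has_derivative frechet_derivative \<rho> (at t)) (at t)" for t
    using \<rho>C by (simp add: numeral_2_eq_2 frechet_derivative_works)
  have d\<rho>: "(\<rho> has_real_derivative frechet_derivative \<rho> (at t) 1) (at t)" for t
  proof -
    have "frechet_derivative \<rho> (at t) = (*) (frechet_derivative \<rho> (at t) 1)"
    proof
      fix h :: real
      show "frechet_derivative \<rho> (at t) h = frechet_derivative \<rho> (at t) 1 * h"
        using linear_scale[OF has_derivative_linear[OF \<rho>d], of t h 1] by (simp add: mult.commute)
    qed
    then show ?thesis using \<rho>d[of t] by (simp add: has_field_derivative_def)
  qed
  then have deriv_eq: "deriv \<rho> = (\<lambda>t. frechet_derivative \<rho> (at t) 1)"
    by (intro ext DERIV_imp_deriv)
  have k0': "deriv \<rho> t = 0" if "\<bar>t\<bar> > 1" for t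
  proof -
    have "open {t::real. \<bar>t\<bar> > 1}" by (intro open_Collect_less continuous_intros)
    then have "\<forall>\<^sub>F u in nhds t. \<rho> u = 0"
      using that \<rho>0 by (auto simp: eventually_nhds intro!: exI[of _ "{t. \<bar>t\<bar> > 1}"])
    then have "deriv \<rho> t = deriv (\<lambda>_. 0) t" by (intro deriv_cong_ev) auto
    then show ?thesis by simp
  qed
  have "Ck_on (Suc 0) (deriv \<rho>) UNIV" using \<rho>C unfolding deriv_eq by (simp add: numeral_2_eq_2)
  from Ck_on_compact_support_lipschitz[OF this k0'] obtain \<Lambda>1 where
    l1: "\<And>t u. \<bar>deriv \<rho> t - deriv \<rho> u\<bar> \<le> \<Lambda>1 * \<bar>t - u\<bar>" by blast
  have "Ck_on (Suc 0) \<xi> UNIV" using \<xi>C by simp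
  from Ck_on_compact_support_lipschitz[OF this \<xi>0] obtain \<Lambda>2 where
    l2: "\<And>t u. \<bar>\<xi> t - \<xi> u\<bar> \<le> \<Lambda>2 * \<bar>t - u\<bar>" by blast
  define \<Lambda> where "\<Lambda> = max \<Lambda>1 \<Lambda>2"
  have k_lip: "\<bar>deriv \<rho> t - deriv \<rho> u\<bar> \<le> \<Lambda> * \<bar>t - u\<bar>" for t u
    using l1[of t u] mult_right_mono[of \<Lambda>1 \<Lambda> "\<bar>t - u\<bar>"] by (simp add: \<Lambda>_def)
  have \<xi>_lip: "\<bar>\<xi> t - \<xi> u\<bar> \<le> \<Lambda> * \<bar>t - u\<bar>" for t u
    using l2[of t u] mult_right_mono[of \<Lambda>2 \<Lambda> "\<bar>t - u\<bar>"] by (simp add: \<Lambda>_def)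
  have \<Lambda>: "\<Lambda> \<ge> 0" using \<xi>_lip[of 1 0] by (auto intro: order_trans[OF abs_ge_zero])
  have k1: "deriv \<rho> t = 0" if "\<bar>t\<bar> \<ge> 1" for t
    by (rule lipschitz_vanishes_at_boundary[OF k_lip k0' that])
  have \<xi>1: "\<xi> t = 0" if "\<bar>t\<bar> \<ge> 1" for t
    by (rule lipschitz_vanishes_at_boundary[OF \<xi>_lip \<xi>0 that])
  have k0: "deriv \<rho> 0 = 0"
  proof -
    have D: "(\<rho> has_real_derivative deriv \<rho> 0) (at 0)" using d\<rho> by (simp add: deriv_eq)
    then have "((\<lambda>t. \<rho> (- t)) has_real_derivative - deriv \<rho> 0) (at 0)"
      using DERIV_mirror[of \<rho> "deriv \<rho> 0" 0] by simp
    then have "(\<rho> has_real_derivative - deriv \<rho> 0) (at 0)" by (simp add: \<rho>_even)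
    from DERIV_unique[OF D this] show ?thesis by simp
  qed
  have \<xi>_b: "\<xi> t \<le> \<Lambda>" for t
  proof (cases "\<bar>t\<bar> \<ge> 1")
    case False
    have "\<xi> t = \<xi> \<bar>t\<bar>" using \<xi>_even by (simp add: abs_if)
    also have "\<dots> \<le> \<Lambda> * \<bar>\<bar>t\<bar> - 1\<bar>" using \<xi>_lip[of "\<bar>t\<bar>" 1] \<xi>1[of 1] by simp
    also have "\<dots> \<le> \<Lambda> * 1" using False \<Lambda> by (intro mult_left_mono) auto
    finally show ?thesis by simp
  qed (use \<xi>1 \<Lambda> in simp)
  \<comment> \<open>The relation is assumed on the open interval; elsewhere, endpoints included,
    both kernels vanish.\<close>
  have rel': "real CARD('n) * \<xi> t = - t * deriv \<rho> t" for t
  proof (cases "\<bar>t\<bar> \<ge> 1")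
    case True
    then show ?thesis using k1 \<xi>1 by simp
  next
    case False
    then have "t \<in> {-1<..<1}" by (auto simp: not_le abs_less_iff)
    then show ?thesis by (rule rel)
  qed
  have cont: "f \<in> borel_measurable borel" if "\<And>t u. \<bar>f t - f u\<bar> \<le> \<Lambda> * \<bar>t - u\<bar>" for f :: "real \<Rightarrow> real"
  proof (rule borel_measurable_continuous_onI)
    have "\<Lambda>-lipschitz_on UNIV f" using that \<Lambda> by (intro lipschitz_onI) (auto simp: dist_real_def)
    then show "continuous_on UNIV f" by (rule lipschitz_on_continuous_on)
  qed
  note k_meas = cont[of "deriv \<rho>", OF k_lip] and \<xi>_meas = cont[of \<xi>, OF \<xi>_lip]
  have M': "submanifold k (CARD('n) - 1) M" using M by (simp add: d)
  obtain g G Q r K B where chart: "hypersurface_chart M x0 g G Q r K"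
    and B: "orthonormal_basis {v. G x0 \<bullet> v = 0} B" and mc: "mean_curvature M x0 = - (\<Sum>b\<in>B. Q b \<bullet> b) *\<^sub>R G x0"
    and GQ: "(G has_derivative Q) (at x0)"
    and C3: "k = 3 \<longrightarrow> (\<exists>C e. e > 0 \<and> (\<forall>z. norm (z - x0) < e \<longrightarrow> norm (G z - G x0 - Q (z - x0)) \<le> C * (norm (z - x0))\<^sup>2))"
    using submanifold_chart[OF M' k x0] .
  interpret hypersurface_chart M x0 g G Q r K by (rule chart)
  define F where "F s x = (deriv \<rho> (norm (x - x0) / s) / norm (x - x0)) *\<^sub>R P x (tangent_space M x) (x - x0)" for s x
  note A = approx_mean_curvature_submanifold[OF M' k x0 P k_meas \<xi>_meas F_def]
  from approx_curvature_estimate[OF n d B submanifold_borel[OF M' k] fin k_meas \<xi>_meas k_lip k0 _ \<xi>_lip _ \<xi>_nn \<xi>_b \<xi>_pos rel' P F_def A(2)]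
  obtain C s0 where s0: "s0 > 0" and est: "\<And>s \<eta>. 0 < s \<Longrightarrow> s < s0 \<Longrightarrow>
      linear_error s \<eta> \<Longrightarrow> norm (H s - mean_curvature M x0) \<le> C * (\<eta> + s)"
    using k1 \<xi>1 unfolding H_def mc d A(1) by (simp add: d) blast
  have near: "\<forall>\<^sub>F s in at_right 0. 0 < s \<and> s < (e::real)" if "e > 0" for e
    using that by (auto simp: eventually_at_right_field)
  \<comment> \<open>\<open>C\<close> may have any sign; a positive constant permits the division in
    the choice of \<open>\<eta>\<close>.\<close>
  define C1 where "C1 = \<bar>C\<bar> + 1"
  have C1: "C1 > 0" by (simp add: C1_def)
  have est1: "norm (H s - mean_curvature M x0) \<le> C1 * (\<eta> + s)"
    if "0 < s" "s < s0" "\<eta> \<ge> 0" "linear_error s \<eta>" for s \<eta>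
  proof -
    have "C * (\<eta> + s) \<le> C1 * (\<eta> + s)" using that by (intro mult_right_mono) (auto simp: C1_def)
    then show ?thesis using est[OF that(1,2,4)] by linarith
  qed
  show "(H \<longlongrightarrow> mean_curvature M x0) (at_right 0)"
  proof (rule tendstoI)
    fix e :: real assume e: "e > 0"
    \<comment> \<open>For \<open>s < \<eta>\<close> the error is below
      \<open>2 * C1 * \<eta>\<close>, which is \<open>e / 2\<close>.\<close>
    define \<eta> where "\<eta> = e / (4 * C1)"
    have \<eta>: "\<eta> > 0" using e C1 by (simp add: \<eta>_def)
    \<comment> \<open>The tolerance is halved because the ball in \<open>linear_error\<close> has
      radius \<open>2 * s\<close>.\<close>
    obtain e' where e': "e' > 0" "\<And>z. norm (z - x0) < e' \<Longrightarrow> norm (G z - G x0 - Q (z - x0)) \<le> \<eta> / 2 * norm (z - x0)"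
      using GQ \<eta> unfolding has_derivative_at_alt by (metis half_gt_zero)
    have "\<forall>\<^sub>F s in at_right 0. 0 < s \<and> s < min (min s0 (e' / 2)) \<eta>"
      using s0 e'(1) \<eta> by (intro near) auto
    then show "\<forall>\<^sub>F s in at_right 0. dist (H s) (mean_curvature M x0) < e"
    proof eventually_elim
      case (elim s)
      have "norm (G z - G x0 - Q (z - x0)) \<le> \<eta> * s" if "z \<in> cball x0 (2 * s)" for z
      proof -
        have z: "norm (z - x0) \<le> 2 * s" using that by (simp add: dist_norm norm_minus_commute)
        then have "norm (G z - G x0 - Q (z - x0)) \<le> \<eta> / 2 * norm (z - x0)" using elim by (intro e'(2)) auto
        also have "\<dots> \<le> \<eta> / 2 * (2 * s)" using z \<eta> by (intro mult_left_mono) auto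
        finally show ?thesis by simp
      qed
      then have "norm (H s - mean_curvature M x0) \<le> C1 * (\<eta> + s)" using elim \<eta> by (intro est1) auto
      also have "\<dots> < C1 * (\<eta> + \<eta>)" using elim C1 by simp
      also have "\<dots> = e / 2" using C1 by (simp add: \<eta>_def field_simps)
      finally show ?case using e by (simp add: dist_norm)
    qed
  qed
  show "(\<lambda>\<epsilon>. norm (H \<epsilon> - mean_curvature M x0)) \<in> O[at_right 0](\<lambda>\<epsilon>. \<epsilon>)" if k3: "k = 3"
  proof -
    obtain C' e' where e': "e' > 0" "\<And>z. norm (z - x0) < e' \<Longrightarrow> norm (G z - G x0 - Q (z - x0)) \<le> C' * (norm (z - x0))\<^sup>2"
      using C3 k3 by blast
    have "\<forall>\<^sub>F s in at_right 0. 0 < s \<and> s < min s0 (e' / 2)"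
      using s0 e'(1) by (intro near) auto
    then have "\<forall>\<^sub>F s in at_right 0. norm (norm (H s - mean_curvature M x0)) \<le> (C1 * (4 * \<bar>C'\<bar> + 1)) * norm s"
    proof eventually_elim
      case (elim s)
      \<comment> \<open>On the ball of radius \<open>2 * s\<close> the quadratic remainder is at
        most \<open>4 * \<bar>C'\<bar> * s\<^sup>2\<close>, so here \<open>\<eta>\<close> itself is
        of order \<open>s\<close>.\<close>
      have "norm (G z - G x0 - Q (z - x0)) \<le> (4 * \<bar>C'\<bar> * s) * s" if "z \<in> cball x0 (2 * s)" for z
      proof -
        have z: "norm (z - x0) \<le> 2 * s" using that by (simp add: dist_norm norm_minus_commute)
        then have "norm (G z - G x0 - Q (z - x0)) \<le> C' * (norm (z - x0))\<^sup>2" using elim by (intro e'(2)) auto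
        also have "\<dots> \<le> \<bar>C'\<bar> * (2 * s)\<^sup>2" using z by (intro mult_mono power_mono) auto
        finally show ?thesis by (simp add: power2_eq_square)
      qed
      then have "norm (H s - mean_curvature M x0) \<le> C1 * (4 * \<bar>C'\<bar> * s + s)" using elim by (intro est1) auto
      then show ?case using elim by (simp add: algebra_simps)
    qed
    then show ?thesis by (rule bigoI)
  qed
qed

theorem proposition3p3:
  fixes M :: "(real^'n) set" and d :: nat and \<rho> \<xi> :: "real \<Rightarrow> real"
  assumes "CARD('n) \<ge> 2" and "d = CARD('n) - 1"
    and "\<And>k. Ck_on k \<rho> UNIV" and "\<And>k. Ck_on k \<xi> UNIV"
    and "\<And>s. \<rho> s \<ge> 0" and "\<And>s. \<xi> s \<ge> 0"
    and "\<And>s. \<rho> (- s) = \<rho> s" and "\<And>s. \<xi> (- s) = \<xi> s"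
    and "closure {s. \<rho> s \<noteq> 0} \<subseteq> {-1..1}" and "closure {s. \<xi> s \<noteq> 0} \<subseteq> {-1..1}"
    and "\<And>s. s \<in> {0<..<1} \<Longrightarrow> \<rho> s > 0" and "\<And>s. s \<in> {0<..<1} \<Longrightarrow> \<xi> s > 0"
    and "antimono_on {0..1} \<rho>"
    and "\<And>s. s \<in> {-1<..<1} \<Longrightarrow> real CARD('n) * \<xi> s = - s * deriv \<rho> s"
    and "submanifold 2 d M" and "emeasure (hausdorff_measure d) M < \<infinity>"
    and "V = submanifold_varifold d M"
  shows "\<forall>x0\<in>M. \<forall>P\<in>projection_choices M x0.
           ((\<lambda>\<epsilon>. approx_mean_curvature \<rho> \<xi> d \<epsilon> P x0 V) \<longlongrightarrow> mean_curvature M x0) (at_right 0) \<and>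
           (submanifold 3 d M \<longrightarrow>
             (\<lambda>\<epsilon>. norm (approx_mean_curvature \<rho> \<xi> d \<epsilon> P x0 V - mean_curvature M x0))
               \<in> O[at_right 0](\<lambda>\<epsilon>. \<epsilon>))"
proof (intro ballI conjI impI)
  note kernel = assms(16,3,4,6-10,12,14)
  fix x0 P assume x0: "x0 \<in> M" and P: "P \<in> projection_choices M x0"
  show "((\<lambda>\<epsilon>. approx_mean_curvature \<rho> \<xi> d \<epsilon> P x0 V) \<longlongrightarrow> mean_curvature M x0) (at_right 0)"
    using approx_mean_curvature_convergence(1)[OF assms(1,2,15) _ kernel x0 P] by (simp add: assms(17))
  assume "submanifold 3 d M"
  \<comment> \<open>The class 3 charts enter here directly, with \<open>k = 3\<close>; varifold and
    mean curvature are defined without reference to \<open>k\<close>, so both claims concern the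
    same objects.\<close>
  from approx_mean_curvature_convergence(2)[OF assms(1,2) this _ kernel x0 P]
  show "(\<lambda>\<epsilon>. norm (approx_mean_curvature \<rho> \<xi> d \<epsilon> P x0 V - mean_curvature M x0)) \<in> O[at_right 0](\<lambda>\<epsilon>. \<epsilon>)"
    by (simp add: assms(17))
qed

end
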